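(* Let $s \ge 0$ be an integer. For each $n\ge 1$ let $A$ be a set of $n$ points sampled independently and uniformly at random in $[0,1]^2$, let $\chi\colon A\to\{0,1,\ldots,s\}$ be a random $(s+1)$-coloring, and write $A_i=\chi^{-1}(i)$. Then there exists a constant $c_s$ (depending only on $s$) such that $$\lim_{n\to\infty}\frac{\mathbb{E}_{A,\chi}\left[\operatorname{Cost}(A_0,A_1,\ldots,A_s)\right]}{\sqrt n}=c_s ,$$ where $\operatorname{Cost}(A_0,\ldots,A_s)$ is the cost of the $s$-lunar Euclidean minimum spanning tree of the coloring.
   Context: Random coloring: all $(s+1)^n$ colorings of the $n$ points are equally likely, i.e. each point independently receives a uniformly random color in $\{0,\ldots,s\}$. Cost of the $s$-lunar Euclidean minimum spanning tree (EMST): let $A_0,\ldots,A_s\subseteq\mathbb{R}^2$ be finite. A colorful $s$-simplex is a tuple $\mathbf{a}=(a_0,\ldots,a_s)$ with $a_i\in A_i$. Its lune at radius $r\ge0$ is the intersection of the $s+1$ closed disks of radius $r$ centered at $a_0,\ldots,a_s$. As $r$ grows from $0$ to $\infty$, the connected components of the union of all lunes are born (at radii $b_0\le b_1\le\cdots\le b_m$) and merge (at radii $d_1\le\cdots\le d_m$), and $\operatorname{Cost}(A_0,\ldots,A_s)=2\sum_{i=1}^m d_i-2\sum_{i=1}^m b_i$. Equivalently: take the complete graph whose nodes are all colorful $s$-simplices, give a node $\mathbf a$ the diameter of the smallest enclosing circle of $\{a_0,\ldots,a_s\}$ as cost, and an arc $\mathbf a\mathbf b$ the diameter of the smallest enclosing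 circle of $\{a_0,\ldots,a_s\}\cup\{b_0,\ldots,b_s\}$ as cost; then $\operatorname{Cost}(A_0,\ldots,A_s)$ is the minimum total arc cost of a spanning tree, minus the sum of all node costs, plus the minimum node cost. If some $A_i$ is empty there are no colorful $s$-simplices and the cost is $0$. *)

theory Defs
  imports "HOL-Probability.Probability"
begin

section \<open>Smallest enclosing circles\<close>

definition sec_radius :: "(real^2) set \<Rightarrow> real" where
  "sec_radius S = Inf {r. 0 \<le> r \<and> (\<exists>c. S \<subseteq> cball c r)}"

definition sec_diameter :: "(real^2) set \<Rightarrow> real" where
  "sec_diameter S = 2 * sec_radius S"

section \<open>Spanning trees of the complete graph on a vertex set\<close>

text \<open>
  An undirected edge is a two-element set. The graph is simple, so a cycle is a list of at
  least three distinct vertices that are cyclically adjacent.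
\<close>

definition is_cycle :: "'v set set \<Rightarrow> 'v list \<Rightarrow> bool" where
  "is_cycle T p \<longleftrightarrow> 3 \<le> length p \<and> distinct p \<and>
     (\<forall>i<length p. {p ! i, p ! (Suc i mod length p)} \<in> T)"

definition spanning_tree :: "'v set \<Rightarrow> 'v set set \<Rightarrow> bool" where
  "spanning_tree V T \<longleftrightarrow>
     T \<subseteq> {{a, b} | a b. a \<in> V \<and> b \<in> V \<and> a \<noteq> b} \<and>
     (\<forall>a\<in>V. \<forall>b\<in>V. (a, b) \<in> {(x, y). {x, y} \<in> T}\<^sup>*) \<and>
     (\<nexists>p. is_cycle T p)"

section \<open>The cost of the lunar Euclidean minimum spanning tree\<close>

text \<open>The tuple \<open>(a\<^sub>0, \<dots>, a\<^sub>s)\<close> is the function \<open>a\<close> on \<open>{..s}\<close>; its set of points is \<open>a ` {..s}\<close>.\<close>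

definition colorful_simplices :: "nat \<Rightarrow> (nat \<Rightarrow> (real^2) set) \<Rightarrow> (nat \<Rightarrow> real^2) set" where
  "colorful_simplices s A = (\<Pi>\<^sub>E i\<in>{..s}. A i)"

definition lune :: "nat \<Rightarrow> (nat \<Rightarrow> real^2) \<Rightarrow> real \<Rightarrow> (real^2) set" where
  "lune s a r = (\<Inter>i\<le>s. cball (a i) r)"

definition node_cost :: "nat \<Rightarrow> (nat \<Rightarrow> real^2) \<Rightarrow> real" where
  "node_cost s a = sec_diameter (a ` {..s})"

definition arc_cost :: "nat \<Rightarrow> (nat \<Rightarrow> real^2) set \<Rightarrow> real" where
  "arc_cost s e = sec_diameter (\<Union>a\<in>e. a ` {..s})"

definition lunar_cost :: "nat \<Rightarrow> (nat \<Rightarrow> (real^2) set) \<Rightarrow> real" where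
  "lunar_cost s A = (let V = colorful_simplices s A in
     if V = {} then 0
     else Min ((\<lambda>T. \<Sum>e\<in>T. arc_cost s e) ` {T. spanning_tree V T})
          - (\<Sum>a\<in>V. node_cost s a) + Min (node_cost s ` V))"

section \<open>Random points with random colors\<close>

text \<open>
  An outcome consists of the points \<open>X 0, \<dots>, X (n - 1)\<close> and a coloring \<open>\<kappa>\<close> of their indices.
  The points are pairwise distinct almost surely, so this is a coloring of an \<open>n\<close>-point set.
\<close>

definition colored_sample :: "nat \<Rightarrow> nat \<Rightarrow> ((nat \<Rightarrow> real^2) \<times> (nat \<Rightarrow> nat)) measure" where
  "colored_sample s n =
     (\<Pi>\<^sub>M j\<in>{..<n}. uniform_measure lborel (cbox 0 1)) \<Otimes>\<^sub>M
     uniform_count_measure ({..<n} \<rightarrow>\<^sub>E {..s})"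

definition color_class :: "nat \<Rightarrow> (nat \<Rightarrow> real^2) \<Rightarrow> (nat \<Rightarrow> nat) \<Rightarrow> nat \<Rightarrow> (real^2) set" where
  "color_class n X \<kappa> i = {X j | j. j < n \<and> \<kappa> j = i}"

definition expected_lunar_cost :: "nat \<Rightarrow> nat \<Rightarrow> real" where
  "expected_lunar_cost s n =
     (\<integral>\<omega>. lunar_cost s (color_class n (fst \<omega>) (snd \<omega>)) \<partial>colored_sample s n)"

section \<open>Sanity checks\<close>

lemma prob_space_colored_sample: "prob_space (colored_sample s n)"
proof -
  have eq: "emeasure lborel (cbox (0::real^2) 1) = 1"
  proof (subst emeasure_lborel_cbox)
    show "ennreal (\<Prod>b\<in>Basis. (1 - 0 :: real^2) \<bullet> b) = 1"
      by (subst prod.neutral) (auto simp: Basis_vec_def inner_axis)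
  qed (auto simp: Basis_vec_def inner_axis)
  have 1: "prob_space (uniform_measure lborel (cbox (0::real^2) 1))"
    by (rule prob_space_uniform_measure) (simp_all add: eq)
  have 2: "prob_space (\<Pi>\<^sub>M j\<in>{..<n}. uniform_measure lborel (cbox (0::real^2) 1))"
    by (rule prob_space_PiM) (rule 1)
  have 3: "prob_space (uniform_count_measure ({..<n} \<rightarrow>\<^sub>E {..s}))"
    by (rule prob_space_uniform_count_measure) (auto intro: finite_PiE simp: PiE_eq_empty_iff)
  show ?thesis unfolding colored_sample_def using 2 3 by (rule prob_space_pair)
qed

text \<open>The infimum in the smallest enclosing radius is attained.\<close>

lemma sec_radius_le_iff:
  assumes "finite S" "S \<noteq> {}" "0 \<le> r"
  shows "sec_radius S \<le> r \<longleftrightarrow> (\<exists>c. S \<subseteq> cball c r)"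
proof -
  define R where "R = {r. 0 \<le> r \<and> (\<exists>c. S \<subseteq> cball c r)}"
  have bdd: "bdd_below R" unfolding R_def by (rule bdd_belowI[of _ 0]) auto
  show ?thesis
  proof
    assume "\<exists>c. S \<subseteq> cball c r"
    then have "r \<in> R" using assms by (auto simp: R_def)
    then show "sec_radius S \<le> r"
      unfolding sec_radius_def R_def[symmetric] using bdd by (rule cInf_lower)
  next
    assume le: "sec_radius S \<le> r"
    obtain B where B: "0 < B" "S \<subseteq> cball 0 B"
      using bounded_subset_ballD[OF finite_imp_bounded[OF assms(1)], of 0] ball_subset_cball
      by blast
    have ne: "R \<noteq> {}"
    proof -
      have "B \<in> R" unfolding R_def using B by fastforce
      then show ?thesis by blast
    qed
    let ?K = "\<lambda>k::nat. \<Inter>x\<in>S. cball x (r + inverse (real (Suc k)))"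
    have "\<Inter>(range ?K) \<noteq> {}"
    proof (rule compact_nest)
      show "compact (?K k)" for k
        using assms(2) by (intro compact_Inter) auto
      show "?K k \<noteq> {}" for k
      proof -
        have "Inf R < r + inverse (real (Suc k))"
          using le unfolding sec_radius_def R_def[symmetric]
          by (meson add_strict_increasing2 inverse_positive_iff_positive less_add_same_cancel1
              of_nat_0_less_iff order_le_less_trans zero_less_Suc)
        then obtain t where t: "t \<in> R" "t < r + inverse (real (Suc k))"
          using cInf_lessD[OF ne] by blast
        then obtain c where "S \<subseteq> cball c t" by (auto simp: R_def)
        then have "c \<in> ?K k" using t(2) by (force simp: dist_commute)
        then show ?thesis by blast
      qed
      show "m \<le> n \<Longrightarrow> ?K n \<subseteq> ?K m" for m n
      proof -
        assume "m \<le> n"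
        then have "inverse (real (Suc n)) \<le> inverse (real (Suc m))" by (simp add: le_imp_inverse_le)
        then show ?thesis by (intro INF_mono') (simp add: subset_cball)
      qed
    qed
    then obtain c where c: "\<And>k x. x \<in> S \<Longrightarrow> dist x c \<le> r + inverse (real (Suc k))"
      by fastforce
    have "dist x c \<le> r" if "x \<in> S" for x
    proof (rule LIMSEQ_le_const)
      show "(\<lambda>k. r + inverse (real (Suc k))) \<longlonglongrightarrow> r"
        using LIMSEQ_inverse_real_of_nat_add .
      show "\<exists>N. \<forall>k\<ge>N. dist x c \<le> r + inverse (real (Suc k))" using c[OF that] by blast
    qed
    then have "S \<subseteq> cball c r" by (auto simp: dist_commute)
    then show "\<exists>c. S \<subseteq> cball c r" by blast
  qed
qed

text \<open>
  Lunes are convex, so the components of their union at radius \<open>r\<close> correspond to those of the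
  intersection graph of the nonempty lunes. By the following two facts, this is the graph of
  all nodes and arcs of cost at most \<open>2 * r\<close>.
\<close>

lemma lune_nonempty_iff:
  assumes "0 \<le> r"
  shows "lune s a r \<noteq> {} \<longleftrightarrow> node_cost s a \<le> 2 * r"
proof -
  have "lune s a r \<noteq> {} \<longleftrightarrow> (\<exists>c. a ` {..s} \<subseteq> cball c r)"
    by (simp add: lune_def ex_in_conv[symmetric] image_subset_iff dist_commute)
  then show ?thesis
    using sec_radius_le_iff[of "a ` {..s}" r] assms by (simp add: node_cost_def sec_diameter_def)
qed

lemma lunes_meet_iff:
  assumes "0 \<le> r"
  shows "lune s a r \<inter> lune s b r \<noteq> {} \<longleftrightarrow> arc_cost s {a, b} \<le> 2 * r"
proof -
  have "lune s a r \<inter> lune s b r \<noteq> {} \<longleftrightarrow> (\<exists>c. a ` {..s} \<union> b ` {..s} \<subseteq> cball c r)"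
    by (simp add: lune_def ex_in_conv[symmetric] image_subset_iff dist_commute)
  then show ?thesis
    using sec_radius_le_iff[of "a ` {..s} \<union> b ` {..s}" r] assms
    by (simp add: arc_cost_def sec_diameter_def)
qed

text \<open>The minimum over spanning trees is over a finite nonempty set.\<close>

lemma finite_spanning_trees: "finite V \<Longrightarrow> finite {T. spanning_tree V T}"
  by (rule finite_subset[of _ "Pow (Pow V)"]) (auto simp: spanning_tree_def)

lemma spanning_tree_exists:
  assumes "V \<noteq> {}"
  shows "\<exists>T. spanning_tree V T"
proof -
  obtain z where z: "z \<in> V" using assms by blast
  define T where "T = {{z, b} | b. b \<in> V \<and> b \<noteq> z}"
  have path: "(a, b) \<in> {(x, y). {x, y} \<in> T}\<^sup>*" if "a \<in> V" "b \<in> V" for a b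
  proof (rule rtrancl_trans)
    show "(a, z) \<in> {(x, y). {x, y} \<in> T}\<^sup>*"
      using that by (cases "a = z") (auto simp: T_def insert_commute)
    show "(z, b) \<in> {(x, y). {x, y} \<in> T}\<^sup>*"
      using that by (cases "b = z") (auto simp: T_def)
  qed
  have "\<not> is_cycle T p" for p
  proof
    assume "is_cycle T p"
    then have len: "3 \<le> length p" and d: "distinct p"
      and adj: "\<And>i. i < length p \<Longrightarrow> {p ! i, p ! (Suc i mod length p)} \<in> T"
      by (auto simp: is_cycle_def)
    have mem: "p ! i = z \<or> p ! (Suc i mod length p) = z" if "i < length p" for i
      using adj[OF that] unfolding T_def by (auto simp: doubleton_eq_iff)
    have inj: "i = j" if "i < length p" "j < length p" "p ! i = z" "p ! j = z" for i j
      using that d by (metis nth_eq_iff_index_eq)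
    have "p ! 0 = z \<or> p ! 1 = z" "p ! 1 = z \<or> p ! 2 = z"
      using mem[of 0] mem[of 1] len by (auto simp: numeral_2_eq_2 simp flip: length_greater_0_conv)
    moreover have "\<not> (p ! 0 = z \<and> p ! 2 = z)" using inj[of 0 2] len by fastforce
    ultimately have p1: "p ! 1 = z" by blast
    have lt: "3 mod length p < length p" using len by (intro mod_less_divisor) linarith
    have ne1: "3 mod length p \<noteq> 1" using len by (cases "length p = 3") auto
    have "p ! 2 = z \<or> p ! (3 mod length p) = z" using mem[of 2] len by (simp add: eval_nat_numeral)
    then show False using inj[of 2 1] inj[OF lt, of 1] p1 ne1 len by auto
  qed
  moreover have "T \<subseteq> {{a, b} | a b. a \<in> V \<and> b \<in> V \<and> a \<noteq> b}"
    using z unfolding T_def by blast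
  ultimately have "spanning_tree V T" using path by (auto simp: spanning_tree_def)
  then show ?thesis by blast
qed

end

(*
  At threshold t let k(t) be the number of components of the graph formed by the nodes and arcs
  of cost at most t. Kruskal's algorithm gives Cost = \<integral> (k(t) - 1)^+ dt. Substituting
  t = \<rho> / sqrt n, the claim follows by dominated convergence in \<rho> from two facts about
  E k(\<rho> / sqrt n) / n.

  Convergence for fixed \<rho>: k is the sum over the nodes of 1 / |component|. Components with more
  than M nodes contribute at most (number of nodes) / M, and the remaining contribution of the
  nodes containing a given point depends only on the sample points in a square of side 2 K / sqrt n
  around that point. The number of these is binomial with a Poisson limit, and given their number,
  the rescaled configuration has a law that does not depend on n.

  Domination by C / (1 + \<rho>^2): cut the unit square into cells of diameter about t. All simplices
  whose enclosing circle is centered in a cell that contains a point of every color lie in one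
  component, so such cells contribute O(1 / t^2) = O(n / \<rho>^2) components; a cell that misses
  a color is exponentially unlikely in \<rho>^2.
*)

theory Submission
  imports Defs
begin

section \<open>Minimum spanning trees and components of threshold graphs\<close>

text \<open>The cost is a sum over the arcs of a tree minus a sum over the nodes, each with up to
  the order of n^(s+1) terms, although the difference is only of order sqrt n; passing to k(t) makes
  this cancellation exact before anything is estimated. The obstacle is then that the size of a
  component is not a local quantity, since components at scale 1 / sqrt n may be long. The cutoff M
  restores locality, at an error of the expected node count over M, which is O(n / M) at fixed
  \<rho>. The limit at fixed \<rho> is therefore never computed directly: for each M there are
  bounds with a common limit up to A / M, and this makes the sequence Cauchy. The subtracted 1 in
  k(t) - 1 is essential for domination: past the diameter of the square k(t) is 1 as soon as there
  is a node, and would not be integrable. Near \<rho> = 0 the cells are too fine to help, and k is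
  bounded by the number of nodes, of order n \<rho>^(2 s) in expectation. Nodes are tuples of
  indices rather than of points, so that passing to a subsample, rescaling and relabelling lead to
  graphs of the same kind.\<close>

definition rel_components :: "'v set \<Rightarrow> ('v \<times> 'v) set \<Rightarrow> 'v set set" where
  "rel_components V r = (\<lambda>a. r\<^sup>* `` {a}) ` V"

definition edge_rel :: "'v set set \<Rightarrow> ('v \<times> 'v) set" where
  "edge_rel T = {(x, y). {x, y} \<in> T}"

definition edges_on :: "'v set \<Rightarrow> 'v set set" where
  "edges_on V = {{a, b} | a b. a \<in> V \<and> b \<in> V \<and> a \<noteq> b}"

lemma pair_in_edges_on: "{x, y} \<in> edges_on V \<longleftrightarrow> x \<in> V \<and> y \<in> V \<and> x \<noteq> y"
  by (auto simp: edges_on_def doubleton_eq_iff)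

lemma sym_edge_rel: "sym (edge_rel T)"
  by (auto simp: sym_def edge_rel_def insert_commute)

lemma component_eq_iff:
  assumes "sym r"
  shows "r\<^sup>* `` {a} = r\<^sup>* `` {b} \<longleftrightarrow> (a, b) \<in> r\<^sup>*"
proof -
  have "equiv UNIV (r\<^sup>*)"
    using assms by (auto simp: equiv_def refl_rtrancl trans_rtrancl sym_rtrancl)
  then show ?thesis by (metis UNIV_I eq_equiv_class_iff)
qed

text \<open>A walk can be cut down to one that uses the new edge at most once; the two mixed
  disjuncts are the two directions of travel.\<close>

lemma rtrancl_edge_rel_insert:
  "(x, y) \<in> (edge_rel (insert {a, b} T))\<^sup>* \<longleftrightarrow>
     (x, y) \<in> (edge_rel T)\<^sup>* \<or> (x, a) \<in> (edge_rel T)\<^sup>* \<and> (b, y) \<in> (edge_rel T)\<^sup>* \<or>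
     (x, b) \<in> (edge_rel T)\<^sup>* \<and> (a, y) \<in> (edge_rel T)\<^sup>*"
proof -
  have e: "edge_rel (insert {a, b} T) = insert (a, b) (insert (b, a) (edge_rel T))"
    by (auto simp: edge_rel_def doubleton_eq_iff)
  show ?thesis unfolding e rtrancl_insert
    by (auto intro: rtrancl_trans)
qed

text \<open>An edge between two classes replaces them by their union and leaves all others alone, so
  exactly one class is lost.\<close>

lemma card_components_insert:
  assumes V: "finite V" "a \<in> V" "b \<in> V" and ab: "(a, b) \<notin> (edge_rel T)\<^sup>*"
  shows "Suc (card (rel_components V (edge_rel (insert {a, b} T)))) = card (rel_components V
      (edge_rel T))"
proof -
  define r where "r = edge_rel T"
  have symr: "sym r" by (simp add: r_def sym_edge_rel)
  let ?C = "\<lambda>x. r\<^sup>* `` {x}" and ?D = "\<lambda>x. (edge_rel (insert {a, b} T))\<^sup>* `` {x}"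
  have sy: "(x, y) \<in> r\<^sup>* \<longleftrightarrow> (y, x) \<in> r\<^sup>*" for x y
    using sym_rtrancl[OF symr] by (auto dest: symD)
  have D: "?D x = (if x \<in> ?C a \<union> ?C b then ?C a \<union> ?C b else ?C x)" for x
    unfolding set_eq_iff Image_singleton_iff rtrancl_edge_rel_insert r_def[symmetric]
    using sy by (auto intro: rtrancl_trans)
  have eq: "rel_components V (edge_rel (insert {a, b} T)) =
      insert (?C a \<union> ?C b) (rel_components V r - {?C a, ?C b})" (is "?L = ?R")
  proof
    show "?L \<subseteq> ?R"
    proof
      fix X assume "X \<in> ?L"
      then obtain x where x: "x \<in> V" "X = ?D x" by (auto simp: rel_components_def)
      show "X \<in> ?R"
      proof (cases "x \<in> ?C a \<union> ?C b")
        case False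
        then have "?C x \<noteq> ?C a" "?C x \<noteq> ?C b" by blast+
        then show ?thesis using x False by (simp add: D rel_components_def)
      qed (simp add: x(2) D)
    qed
    show "?R \<subseteq> ?L"
    proof
      fix X assume "X \<in> ?R"
      then consider "X = ?C a \<union> ?C b" | x where "x \<in> V" "X = ?C x" "?C x \<noteq> ?C a" "?C x \<noteq> ?C b"
        by (auto simp: rel_components_def)
      then show "X \<in> ?L"
      proof cases
        case 1
        then have "X = ?D a" by (simp add: D)
        then show ?thesis using V by (auto simp: rel_components_def)
      next
        case (2 x)
        then have "x \<notin> ?C a \<union> ?C b"
          using component_eq_iff[OF symr] by (metis Image_singleton_iff UnE)
        then have "X = ?D x" using 2 by (simp add: D)
        then show ?thesis using 2 by (auto simp: rel_components_def)
      qed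
    qed
  qed
  have ne: "?C a \<noteq> ?C b" using ab component_eq_iff[OF symr] by (simp add: r_def)
  \<comment> \<open>The count of the new set of classes needs the union to be a new element, not one
    of the old classes.\<close>
  have notin: "?C a \<union> ?C b \<notin> rel_components V r - {?C a, ?C b}"
  proof
    assume "?C a \<union> ?C b \<in> rel_components V r - {?C a, ?C b}"
    then obtain x where x: "?C x = ?C a \<union> ?C b" "?C x \<noteq> ?C a" by (auto simp: rel_components_def)
    then have "(x, a) \<in> r\<^sup>*" by blast
    then show False using x component_eq_iff[OF symr] by metis
  qed
  have fin: "finite (rel_components V r)" using V by (simp add: rel_components_def)
  have sub: "{?C a, ?C b} \<subseteq> rel_components V r" using V by (auto simp: rel_components_def)
  have "card (rel_components V r - {?C a, ?C b}) = card (rel_components V r) - 2"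
    using sub ne by (subst card_Diff_subset) auto
  moreover have "2 \<le> card (rel_components V r)"
    using card_mono[OF fin sub] ne by simp
  ultimately show ?thesis using fin notin unfolding eq by (simp add: r_def)
qed

lemma components_insert_same:
  assumes "(a, b) \<in> (edge_rel T)\<^sup>*"
  shows "(edge_rel (insert {a, b} T))\<^sup>* = (edge_rel T)\<^sup>*"
proof -
  have "(b, a) \<in> (edge_rel T)\<^sup>*"
    by (rule symD[OF sym_rtrancl[OF sym_edge_rel] assms])
  then show ?thesis
    using assms by (auto simp: rtrancl_edge_rel_insert intro: rtrancl_trans)
qed

text \<open>One edge lowers the number of classes by at most one. This turns into lower bounds on
  edge counts: edges that connect the classes of A are at least as many as the classes that they
  remove.\<close>

lemma card_components_union:
  assumes "finite V" "finite B" "B \<subseteq> edges_on V"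
  shows "card (rel_components V (edge_rel A)) \<le> card (rel_components V (edge_rel (A \<union> B))) + card B"
  using assms(2,3)
proof (induction B)
  case (insert e B)
  then obtain a b where e: "e = {a, b}" "a \<in> V" "b \<in> V" by (auto simp: edges_on_def)
  have "card (rel_components V (edge_rel (A \<union> B))) \<le> card (rel_components V (edge_rel (insert e (A \<union>
      B)))) + 1"
  proof (cases "(a, b) \<in> (edge_rel (A \<union> B))\<^sup>*")
    case True
    then show ?thesis by (simp add: e rel_components_def components_insert_same)
  next
    case False
    show ?thesis using card_components_insert[OF assms(1) e(2,3) False] by (simp add: e)
  qed
  then show ?case using insert by (simp add: edges_on_def)
qed simp

text \<open>Closing a class of r under r' gives a class of r', and all classes of r' arise so; this
  surjection bounds the cardinality.\<close>

lemma components_antimono: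
  assumes "finite V" "r \<subseteq> r'" "sym r" "sym r'"
  shows "card (rel_components V r') \<le> card (rel_components V r)"
proof -
  have eq: "rel_components V r' = (\<lambda>X. r'\<^sup>* `` X) ` rel_components V r"
  proof -
    have "r'\<^sup>* `` (r\<^sup>* `` {a}) = r'\<^sup>* `` {a}" for a
      using rtrancl_mono[OF assms(2)] by (auto intro: rtrancl_trans)
    then show ?thesis by (simp add: rel_components_def image_image)
  qed
  show ?thesis unfolding eq using assms(1) by (intro card_image_le) (simp add: rel_components_def)
qed

lemma components_connected:
  assumes "V \<noteq> {}" "\<And>a b. a \<in> V \<Longrightarrow> b \<in> V \<Longrightarrow> (a, b) \<in> r\<^sup>*" "sym r"
  shows "card (rel_components V r) = 1"
proof -
  obtain z where z: "z \<in> V" using assms by blast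
  have "rel_components V r = {r\<^sup>* `` {z}}"
    unfolding rel_components_def using assms z component_eq_iff[OF assms(3)] by blast
  then show ?thesis by simp
qed

text \<open>By the hypothesis F has the fewest edges that can produce its classes. The closing edge
  of a cycle joins vertices that the rest of the cycle already connects, so deleting it would give
  the same classes with fewer edges.\<close>

lemma not_is_cycle_if_card:
  assumes "finite V" "F \<subseteq> edges_on V" "card F + card (rel_components V (edge_rel F)) = card V"
  shows "\<not> is_cycle F p"
proof
  assume cyc: "is_cycle F p"
  have fin: "finite F" using assms(1,2) by (rule_tac finite_subset[of _ "Pow V"]) (auto simp:
      edges_on_def)
  from cyc have len: "3 \<le> length p" and d: "distinct p"
    and adj: "\<And>i. i < length p \<Longrightarrow> {p ! i, p ! (Suc i mod length p)} \<in> F"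
    by (auto simp: is_cycle_def)
  have "p \<noteq> []" using len by auto
  let ?a = "p ! 0" and ?b = "p ! (length p - 1)"
  define F' where "F' = F - {{?a, ?b}}"
  have e: "{?a, ?b} \<in> F"
  proof -
    have "Suc (length p - 1) = length p" using len by simp
    then have "Suc (length p - 1) mod length p = 0" by simp
    then show ?thesis using adj[of "length p - 1"] len by (simp add: insert_commute)
  qed
  \<comment> \<open>Only the closing edge was removed, so the other edges must differ from it.
    Distinctness leaves a list of length 2 as the only exception, and \<open>is_cycle\<close>
    demands at least 3 vertices.\<close>
  have step: "(p ! i, p ! Suc i) \<in> edge_rel F'" if "Suc i < length p" for i
  proof -
    have "{p ! i, p ! Suc i} \<noteq> {?a, ?b}"
    proof
      assume "{p ! i, p ! Suc i} = {?a, ?b}"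
      then consider "p ! i = ?a" "p ! Suc i = ?b" | "p ! i = ?b" "p ! Suc i = ?a"
        by (auto simp: doubleton_eq_iff)
      then show False
      proof cases
        case 1
        then have "i = 0" "Suc i = length p - 1"
          using nth_eq_iff_index_eq[OF d, of i 0] nth_eq_iff_index_eq[OF d that, of "length p - 1"]
            that len \<open>p \<noteq> []\<close> by simp_all
        then show False using len by simp
      next
        case 2
        then have "Suc i = 0"
          using nth_eq_iff_index_eq[OF d that, of 0] len \<open>p \<noteq> []\<close> by auto
        then show False by simp
      qed
    qed
    then show ?thesis using adj[of i] that by (simp add: edge_rel_def F'_def)
  qed
  have "(?a, p ! i) \<in> (edge_rel F')\<^sup>*" if "i < length p" for i
    using that by (induction i) (auto intro: rtrancl_into_rtrancl step)
  then have con: "(?a, ?b) \<in> (edge_rel F')\<^sup>*" using len by simp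
  have F: "F = insert {?a, ?b} F'" using e by (auto simp: F'_def)
  have "card (rel_components V (edge_rel F)) = card (rel_components V (edge_rel F'))"
    using components_insert_same[OF con] F by (simp add: rel_components_def)
  moreover have "card F' < card F"
    unfolding F'_def by (rule card_Diff1_less[OF fin e])
  moreover have "card V \<le> card (rel_components V (edge_rel F')) + card F'"
  proof -
    have "rel_components V (edge_rel {}) = (\<lambda>a. {a}) ` V"
      by (simp add: rel_components_def edge_rel_def)
    then have "card (rel_components V (edge_rel {})) = card V" by (simp add: card_image)
    then show ?thesis
      using card_components_union[of V F' "{}"] assms(1,2) fin by (auto simp: F'_def)
  qed
  ultimately show False using assms(3) by simp
qed

text \<open>Kruskal's algorithm: processing the edges in order of weight keeps, below every threshold,
  a spanning forest of the edges below that threshold.\<close>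

lemma kruskal:
  fixes w :: "'v set \<Rightarrow> real"
  assumes "finite V" "finite E" "E \<subseteq> edges_on V"
  shows "\<exists>F\<subseteq>E. \<forall>t. (edge_rel {e\<in>F. w e \<le> t})\<^sup>* = (edge_rel {e\<in>E. w e \<le> t})\<^sup>* \<and>
     card {e\<in>F. w e \<le> t} + card (rel_components V (edge_rel {e\<in>E. w e \<le> t})) = card V"
  using assms(2,3)
proof (induction E rule: finite_ranking_induct[where f = w])
  case empty
  have "rel_components V (edge_rel {}) = (\<lambda>a. {a}) ` V"
    by (simp add: rel_components_def edge_rel_def)
  then show ?case by (simp add: card_image)
next
  case (insert e E)
  then obtain F where F: "F \<subseteq> E"
    "\<And>t. (edge_rel {e\<in>F. w e \<le> t})\<^sup>* = (edge_rel {e\<in>E. w e \<le> t})\<^sup>*"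
    "\<And>t. card {e\<in>F. w e \<le> t} + card (rel_components V (edge_rel {e\<in>E. w e \<le> t})) = card V"
    by auto
  obtain a b where e: "e = {a, b}" "a \<in> V" "b \<in> V" using insert.prems by (auto simp: edges_on_def)
  show ?case
  proof (cases "e \<in> E")
    case True
    then show ?thesis using F by (intro exI[of _ F]) (auto simp: insert_absorb)
  next
    case False
    \<comment> \<open>The ranking induction adds e with maximal weight. Hence a threshold either
      lies below w e and does not see e, or sees all of E and F.\<close>
    have all: "{e\<in>E. w e \<le> t} = E" "{e\<in>F. w e \<le> t} = F" if "w e \<le> t" for t
      using insert.hyps(2) F(1) that by (auto intro: order_trans)
    have FE: "(edge_rel F)\<^sup>* = (edge_rel E)\<^sup>*" "card F + card (rel_components V (edge_rel E)) = card V"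
      using F(2,3)[of "w e"] all[of "w e"] by auto
    have finF: "finite F" using F(1) insert.hyps(1) by (rule finite_subset)
    \<comment> \<open>Kruskal's decision: an edge inside a class is discarded, an edge between two
      classes is kept.\<close>
    show ?thesis
    proof (cases "(a, b) \<in> (edge_rel E)\<^sup>*")
      case True
      have "(edge_rel {x \<in> F. w x \<le> t})\<^sup>* = (edge_rel {x \<in> insert e E. w x \<le> t})\<^sup>* \<and>
        card {x \<in> F. w x \<le> t} + card (rel_components V (edge_rel {x \<in> insert e E. w x \<le> t})) = card
            V" for t
      proof (cases "w e \<le> t")
        case le: True
        have 1: "{x \<in> insert e E. w x \<le> t} = insert e E" using all[OF le] le by auto
        show ?thesis unfolding 1 all[OF le] using FE components_insert_same[OF True]
          by (simp add: e rel_components_def)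
      next
        case le: False
        then have 1: "{x \<in> insert e E. w x \<le> t} = {x \<in> E. w x \<le> t}" by auto
        show ?thesis unfolding 1 using F by blast
      qed
      then show ?thesis using F(1) by blast
    next
      case False2: False
      have "(edge_rel {x \<in> insert e F. w x \<le> t})\<^sup>* = (edge_rel {x \<in> insert e E. w x \<le> t})\<^sup>* \<and>
        card {x \<in> insert e F. w x \<le> t} + card (rel_components V (edge_rel {x \<in> insert e E. w x \<le>
            t})) = card V" for t
      proof (cases "w e \<le> t")
        case le: True
        have 1: "{x \<in> insert e E. w x \<le> t} = insert e E" "{x \<in> insert e F. w x \<le> t} = insert e F"
          using all[OF le] le by auto
        have 2: "(edge_rel (insert e F))\<^sup>* = (edge_rel (insert e E))\<^sup>*"
          using FE(1) by (auto simp: e rtrancl_edge_rel_insert)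
        have "Suc (card (rel_components V (edge_rel (insert e E)))) = card (rel_components V
            (edge_rel E))"
          using card_components_insert[OF assms(1) e(2,3) False2] by (simp add: e)
        then show ?thesis unfolding 1 using 2 FE(2) False F(1) finF
          by (subst card_insert_disjoint) auto
      next
        case le: False
        then have 1: "{x \<in> insert e E. w x \<le> t} = {x \<in> E. w x \<le> t}"
           "{x \<in> insert e F. w x \<le> t} = {x \<in> F. w x \<le> t}" by auto
        show ?thesis unfolding 1 using F by blast
      qed
      then show ?thesis using F(1) by (intro exI[of _ "insert e F"]) blast
    qed
  qed
qed

text \<open>Layer-cake formula: w e is the length of the interval from 0 to w e, and at each t the
  intervals reaching beyond t are counted.\<close>

lemma sum_eq_integral_card:
  fixes w :: "'e \<Rightarrow> real"
  assumes "finite T" "\<And>e. e \<in> T \<Longrightarrow> 0 \<le> w e"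
  shows "has_bochner_integral lborel (\<lambda>t. indicator {0..} t * real (card {e\<in>T. t < w e})) (\<Sum>e\<in>T. w e)"
proof -
  have "has_bochner_integral lborel (\<lambda>t. \<Sum>e\<in>T. indicator {0..<w e} t *\<^sub>R 1) (\<Sum>e\<in>T. w e *\<^sub>R 1 :: real)"
  proof (rule has_bochner_integral_sum)
    fix e assume "e \<in> T"
    then show "has_bochner_integral lborel (\<lambda>t. indicator {0..<w e} t *\<^sub>R 1) (w e *\<^sub>R 1 :: real)"
      using has_bochner_integral_indicator[of "{0..<w e}" lborel "1::real"] assms(2) by simp
  qed
  moreover have "(\<Sum>e\<in>T. indicator {0..<w e} t *\<^sub>R 1) = indicator {0..} t * real (card {e\<in>T. t < w
      e})" for t
  proof -
    have "real (card {e\<in>T. t < w e}) = (\<Sum>e\<in>T. if t < w e then 1 else 0)"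
      using assms(1) by (simp add: sum.If_cases Int_def)
    then show ?thesis
      by (simp add: sum_distrib_left indicator_def cong: if_cong) (auto intro!: sum.cong)
  qed
  ultimately show ?thesis by simp
qed

text \<open>One weight serves nodes and arcs: its value on a singleton is the node cost, since {x,
  x} = {x}. A node present at t is thus a loop, and when no node is dearer than its arcs,
  \<open>Domain\<close> is exactly the set of these nodes.\<close>

definition threshold_rel :: "'v set \<Rightarrow> ('v set \<Rightarrow> real) \<Rightarrow> real \<Rightarrow> ('v \<times> 'v) set" where
  "threshold_rel V w t = {(x, y). x \<in> V \<and> y \<in> V \<and> w {x, y} \<le> t}"

lemma sym_threshold_rel: "sym (threshold_rel V w t)"
  by (auto simp: sym_def threshold_rel_def insert_commute)

text \<open>Spanning trees live on all of V, while a lune appears only at its birth. A node of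
  weight above t has no edge of weight at most t, so it is an isolated vertex on the left; the last
  term counts these.\<close>

lemma card_components_threshold:
  assumes fin: "finite V" and w: "\<And>a b. a \<in> V \<Longrightarrow> b \<in> V \<Longrightarrow> w {a} \<le> w {a, b}"
  shows "card (rel_components V (edge_rel {e \<in> edges_on V. w e \<le> t})) =
    card (rel_components (Domain (threshold_rel V w t)) (threshold_rel V w t)) + card {v \<in> V. t < w {v}}"
proof -
  let ?r = "threshold_rel V w t" and ?q = "edge_rel {e \<in> edges_on V. w e \<le> t}"
  have dom: "Domain ?r = {v\<in>V. w {v} \<le> t}"
    using w by (force simp: threshold_rel_def)
  \<comment> \<open>The two relations differ at most by loops, which reachability ignores.\<close>
  have "?r\<^sup>= = ?q\<^sup>="
  proof (rule set_eqI, clarify)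
    fix x y show "(x, y) \<in> ?r\<^sup>= \<longleftrightarrow> (x, y) \<in> ?q\<^sup>="
      by (cases "x = y") (simp_all add: threshold_rel_def edge_rel_def pair_in_edges_on)
  qed
  then have eq: "?r\<^sup>* = ?q\<^sup>*" by (metis rtrancl_reflcl)
  have iso: "?r\<^sup>* `` {v} = {v}" if "v \<notin> Domain ?r" for v
    using that by (auto elim: converse_rtranclE)
  have V: "V = Domain ?r \<union> {v\<in>V. t < w {v}}" by (auto simp: dom)
  have "rel_components V ?q = rel_components (Domain ?r) ?r \<union> (\<lambda>v. {v}) ` {v\<in>V. t < w {v}}"
  proof -
    have "rel_components V ?q = (\<lambda>a. ?r\<^sup>* `` {a}) ` (Domain ?r \<union> {v\<in>V. t < w {v}})"
      unfolding rel_components_def eq[symmetric] using V by simp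
    also have "\<dots> = rel_components (Domain ?r) ?r \<union> (\<lambda>v. {v}) ` {v\<in>V. t < w {v}}"
      unfolding image_Un unfolding rel_components_def
      by (intro arg_cong2[where f = "(\<union>)"] refl image_cong iso) (auto simp: dom)
    finally show ?thesis .
  qed
  moreover have "rel_components (Domain ?r) ?r \<inter> (\<lambda>v. {v}) ` {v\<in>V. t < w {v}} = {}"
  proof -
    have False if "v \<in> Domain ?r" "?r\<^sup>* `` {v} = {u}" "t < w {u}" for u v
    proof -
      have "v \<in> ?r\<^sup>* `` {v}" by blast
      then have "u = v" unfolding that(2) by simp
      then show False using that dom by auto
    qed
    then show ?thesis by (auto simp: rel_components_def)
  qed
  moreover have "finite (rel_components (Domain ?r) ?r)" using fin by (simp add: rel_components_def dom)
  ultimately show ?thesis using fin by (simp add: card_Un_disjoint card_image)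
qed

lemma spanning_tree_alt:
  "spanning_tree V T \<longleftrightarrow> T \<subseteq> edges_on V \<and> (\<forall>a\<in>V. \<forall>b\<in>V. (a, b) \<in> (edge_rel T)\<^sup>*) \<and> (\<nexists>p. is_cycle T p)"
  by (simp add: spanning_tree_def edges_on_def edge_rel_def)

text \<open>A merge tree reading of the minimum spanning tree: integrate over the threshold \<open>t\<close> the
  number of merges that are still to happen.\<close>

lemma mst_cost_integral:
  fixes w :: "'v set \<Rightarrow> real"
  assumes fin: "finite V" "V \<noteq> {}" and w: "\<And>a b. a \<in> V \<Longrightarrow> b \<in> V \<Longrightarrow> w {a} \<le> w {a, b}"
    and w0: "\<And>a. a \<in> V \<Longrightarrow> 0 \<le> w {a}"
  shows "has_bochner_integral lborel
     (\<lambda>t. indicator {0..} t * real (card (rel_components (Domain (threshold_rel V w t))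
         (threshold_rel V w t)) - 1))
     (Min ((\<lambda>T. \<Sum>e\<in>T. w e) ` {T. spanning_tree V T}) - (\<Sum>a\<in>V. w {a}) + Min ((\<lambda>a. w {a}) ` V))"
proof -
  let ?E = "edges_on V"
  have finE: "finite ?E"
    using fin by (rule_tac finite_subset[of _ "Pow V"]) (auto simp: edges_on_def)
  have nonneg: "0 \<le> w e" if eE: "e \<in> ?E" for e
  proof -
    obtain a b where e: "e = {a, b}" "a \<in> V" "b \<in> V" using eE by (auto simp: edges_on_def)
    show ?thesis using w0[OF e(2)] w[OF e(2,3)] unfolding e(1) by linarith
  qed
  obtain F where F: "F \<subseteq> ?E"
    "\<And>t. (edge_rel {e\<in>F. w e \<le> t})\<^sup>* = (edge_rel {e\<in>?E. w e \<le> t})\<^sup>*"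
    "\<And>t. card {e\<in>F. w e \<le> t} + card (rel_components V (edge_rel {e\<in>?E. w e \<le> t})) = card V"
    using kruskal[OF fin(1) finE order_refl, of w] by blast
  have finF: "finite F" using F(1) finE by (rule finite_subset)
  \<comment> \<open>A threshold at which every edge is visible; the inserted 0 covers a single node,
    where there are no edges.\<close>
  define t0 where "t0 = Max (insert 0 (w ` ?E))"
  have t0: "w e \<le> t0" if "e \<in> ?E" for e
    unfolding t0_def using finE that by (intro Max_ge) auto
  have full: "{e\<in>F. w e \<le> t0} = F" "{e\<in>?E. w e \<le> t0} = ?E" using t0 F(1) by auto
  have con: "(a, b) \<in> (edge_rel ?E)\<^sup>*" if "a \<in> V" "b \<in> V" for a b
    using that by (cases "a = b") (auto simp: edge_rel_def edges_on_def intro!: r_into_rtrancl)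
  have card1: "card (rel_components V (edge_rel ?E)) = 1"
    using fin(2) con sym_edge_rel by (rule components_connected)
  have cardF: "card F + 1 = card V" using F(3)[of t0] full card1 by simp
  have stF: "spanning_tree V F"
    unfolding spanning_tree_alt
  proof (intro conjI ballI)
    have *: "(edge_rel F)\<^sup>* = (edge_rel ?E)\<^sup>*" using F(2)[of t0] full by simp
    then show "(a, b) \<in> (edge_rel F)\<^sup>*" if "a \<in> V" "b \<in> V" for a b using con that by simp
    have "card F + card (rel_components V (edge_rel F)) = card V"
      using cardF card1 * by (simp add: rel_components_def)
    then show "\<nexists>p. is_cycle F p" using not_is_cycle_if_card[OF fin(1) F(1)] by blast
  qed (rule F)
  let ?c = "\<lambda>t. card (rel_components V (edge_rel {e\<in>?E. w e \<le> t}))"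
  have split: "card T = card {e\<in>T. w e \<le> t} + card {e\<in>T. t < w e}" if "finite T" for T t
    using that by (subst card_Un_disjoint[symmetric]) (auto intro: arg_cong[where f = card])
  \<comment> \<open>Counting the edges above t compares trees at all thresholds at once: F attains
    the lower bound that \<open>Tgt\<close> gives for every spanning tree, so it is minimal after
    integration.\<close>
  have Fgt: "card {e\<in>F. t < w e} + 1 = ?c t" for t
    using F(3)[of t] cardF split[OF finF, of t] by linarith
  have Tgt: "?c t \<le> card {e\<in>T. t < w e} + 1" if "spanning_tree V T" for T t
  proof -
    have T: "T \<subseteq> ?E" using that by (simp add: spanning_tree_alt)
    have finT: "finite T" using T finE by (rule finite_subset)
    have "?c t \<le> card (rel_components V (edge_rel {e\<in>T. w e \<le> t}))"
      using T by (intro components_antimono fin sym_edge_rel) (auto simp: edge_rel_def)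
    also have "\<dots> \<le> card (rel_components V (edge_rel ({e\<in>T. w e \<le> t} \<union> {e\<in>T. t < w e}))) + card {e\<in>T.
        t < w e}"
      using finT T by (intro card_components_union fin) auto
    also have "{e\<in>T. w e \<le> t} \<union> {e\<in>T. t < w e} = T" by auto
    also have "card (rel_components V (edge_rel T)) = 1"
      using that by (intro components_connected fin sym_edge_rel) (auto simp: spanning_tree_alt)
    finally show ?thesis by simp
  qed
  have intF: "has_bochner_integral lborel (\<lambda>t. indicator {0..} t * real (card {e\<in>F. t < w e}))
      (\<Sum>e\<in>F. w e)"
    using finF nonneg F(1) by (intro sum_eq_integral_card) auto
  have min: "Min ((\<lambda>T. \<Sum>e\<in>T. w e) ` {T. spanning_tree V T}) = (\<Sum>e\<in>F. w e)"
  proof (rule Min_eqI)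
    show "finite ((\<lambda>T. \<Sum>e\<in>T. w e) ` {T. spanning_tree V T})"
      using finite_spanning_trees[OF fin(1)] by simp
    show "(\<Sum>e\<in>F. w e) \<in> (\<lambda>T. \<Sum>e\<in>T. w e) ` {T. spanning_tree V T}" using stF by simp
    fix y assume "y \<in> (\<lambda>T. \<Sum>e\<in>T. w e) ` {T. spanning_tree V T}"
    then obtain T where T: "spanning_tree V T" "y = (\<Sum>e\<in>T. w e)" by blast
    have TE: "T \<subseteq> ?E" using T by (simp add: spanning_tree_alt)
    have finT: "finite T" using TE finE by (rule finite_subset)
    have intT: "has_bochner_integral lborel (\<lambda>t. indicator {0..} t * real (card {e\<in>T. t < w e}))
        (\<Sum>e\<in>T. w e)"
      using finT nonneg TE by (intro sum_eq_integral_card) auto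
    have "real (card {e\<in>F. t < w e}) \<le> real (card {e\<in>T. t < w e})" for t
      using Fgt[of t] Tgt[OF T(1), of t] by linarith
    then show "(\<Sum>e\<in>F. w e) \<le> y" unfolding T(2)
      using integral_mono[of lborel "\<lambda>t. indicator {0..} t * real (card {e\<in>F. t < w e})"
          "\<lambda>t. indicator {0..} t * real (card {e\<in>T. t < w e})"] intF intT
      by (auto simp: has_bochner_integral_iff indicator_def)
  qed
  have intV: "has_bochner_integral lborel (\<lambda>t. indicator {0..} t * real (card {v\<in>V. t < w {v}}))
      (\<Sum>v\<in>V. w {v})"
    using sum_eq_integral_card[of V "\<lambda>v. w {v}"] fin w0 by simp
  define m where "m = Min ((\<lambda>a. w {a}) ` V)"
  have m: "m \<in> (\<lambda>a. w {a}) ` V" "\<And>a. a \<in> V \<Longrightarrow> m \<le> w {a}"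
    unfolding m_def using fin by (auto intro!: Min_in)
  have intm: "has_bochner_integral lborel (\<lambda>t. indicator {0..} t * real (card {v\<in>{m}. t < v})) m"
    using sum_eq_integral_card[of "{m}" "\<lambda>v. v"] m w0 by auto
  let ?k = "\<lambda>t. card (rel_components (Domain (threshold_rel V w t)) (threshold_rel V w t))"
  \<comment> \<open>Natural subtraction matters below the first birth m: there k is 0 and k - 1 is 0
    instead of -1. The term for m supplies this difference, which is where the minimum node cost in
    the formula comes from.\<close>
  have k: "indicator {0..} t * real (?k t - 1) = indicator {0..} t * real (card {e\<in>F. t < w e})
     - indicator {0..} t * real (card {v\<in>V. t < w {v}}) + indicator {0..} t * real (card {v\<in>{m}. t < v})"
    for t :: real
  proof -
    have eq: "?c t = ?k t + card {v \<in> V. t < w {v}}" using fin(1) w by (rule card_components_threshold)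
    have dom: "Domain (threshold_rel V w t) = {v\<in>V. w {v} \<le> t}"
      using w by (force simp: threshold_rel_def)
    have "real (?k t - 1) = real (card {e\<in>F. t < w e}) - real (card {v\<in>V. t < w {v}}) + real (card
        {v\<in>{m}. t < v})"
    proof (cases "t < m")
      case True
      then have "Domain (threshold_rel V w t) = {}" unfolding dom using m(2) by force
      then have "?k t = 0" by (simp add: rel_components_def)
      moreover have "{v\<in>{m}. t < v} = {m}" using True by auto
      ultimately show ?thesis using eq Fgt[of t] by simp
    next
      case False
      then have "Domain (threshold_rel V w t) \<noteq> {}" unfolding dom using m(1) by auto
      moreover have "finite (Domain (threshold_rel V w t))" using fin by (simp add: dom)
      ultimately have "0 < ?k t" by (simp add: rel_components_def card_gt_0_iff)
      then have "real (?k t - 1) = real (?k t) - 1" by (simp add: of_nat_diff)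
      moreover have "{v\<in>{m}. t < v} = {}" using False by auto
      then have "real (card {v\<in>{m}. t < v}) = 0" by (metis card.empty of_nat_0)
      moreover have "real (card {e\<in>F. t < w e}) + 1 = real (?k t) + real (card {v \<in> V. t < w {v}})"
        using eq Fgt[of t] by linarith
      ultimately show ?thesis by linarith
    qed
    then show ?thesis by (simp only: distrib_left right_diff_distrib)
  qed
  show ?thesis
    unfolding k min m_def[symmetric]
    by (intro has_bochner_integral_add has_bochner_integral_diff intF intV intm)
qed

section \<open>The lune graph of a marked configuration\<close>

text \<open>Loops at all elements of the domain let the relation carry its own vertex set, so that a
  graph with isolated nodes is a single relation.\<close>

definition tolerance :: "('v \<times> 'v) set \<Rightarrow> bool" where
  "tolerance r \<longleftrightarrow> sym r \<and> (\<forall>a\<in>Domain r. (a, a) \<in> r)"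

abbreviation num_components :: "('v \<times> 'v) set \<Rightarrow> nat" where
  "num_components r \<equiv> card (rel_components (Domain r) r)"

lemma tolerance_component_subset:
  assumes "tolerance r" "a \<in> Domain r"
  shows "r\<^sup>* `` {a} \<subseteq> Domain r"
proof
  fix b assume "b \<in> r\<^sup>* `` {a}"
  then have "(a, b) \<in> r\<^sup>*" by simp
  then show "b \<in> Domain r"
    using assms by (induction) (auto simp: tolerance_def dest: symD)
qed

text \<open>The map f may identify elements: two preimages of one element are related in r, because
  their common image has a loop in r' and \<open>iff\<close> pulls it back. So fibres stay inside
  components. This covers sample points that coincide.\<close>

lemma component_image:
  assumes r: "tolerance r" "tolerance r'"
    and dom: "f ` Domain r = Domain r'"
    and iff: "\<And>a b. a \<in> Domain r \<Longrightarrow> b \<in> Domain r \<Longrightarrow> (f a, f b) \<in> r' \<longleftrightarrow> (a, b) \<in> r"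
    and a: "a \<in> Domain r"
  shows "r'\<^sup>* `` {f a} = f ` (r\<^sup>* `` {a})"
    and "b \<in> Domain r \<Longrightarrow> (f a, f b) \<in> r'\<^sup>* \<longleftrightarrow> (a, b) \<in> r\<^sup>*"
proof -
  have 1: "(f a, f b) \<in> r'\<^sup>*" if "(a, b) \<in> r\<^sup>*" for b
    using that
  proof induction
    case (step y z)
    have "y \<in> Domain r" "z \<in> Domain r"
      using step(2) r(1) by (auto simp: tolerance_def dest: symD)
    then show ?case using step iff by (meson rtrancl_into_rtrancl)
  qed simp
  have 2: "\<forall>b\<in>Domain r. f b = y \<longrightarrow> (a, b) \<in> r\<^sup>*" if "(f a, y) \<in> r'\<^sup>*" for y
    using that
  proof induction
    case base
    show ?case
    proof (intro ballI impI)
      fix b assume b: "b \<in> Domain r" "f b = f a"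
      have "(f a, f b) \<in> r'" using r(2) dom a b by (auto simp: tolerance_def)
      then show "(a, b) \<in> r\<^sup>*" using iff a b by blast
    qed
  next
    case (step y z)
    have "y \<in> Domain r'" using step(2) by blast
    then obtain c where c: "c \<in> Domain r" "f c = y" unfolding dom[symmetric] by (metis imageE)
    show ?case
    proof (intro ballI impI)
      fix b assume "b \<in> Domain r" "f b = z"
      then have "(c, b) \<in> r" using step(2) c iff by blast
      moreover have "(a, c) \<in> r\<^sup>*" using step(3) c by blast
      ultimately show "(a, b) \<in> r\<^sup>*" by (rule rtrancl_into_rtrancl[rotated])
    qed
  qed
  show 3: "(f a, f b) \<in> r'\<^sup>* \<longleftrightarrow> (a, b) \<in> r\<^sup>*" if "b \<in> Domain r" for b
    using 1 2 that by blast
  have "r'\<^sup>* `` {f a} \<subseteq> Domain r'"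
    using tolerance_component_subset[OF r(2)] dom a by blast
  then show "r'\<^sup>* `` {f a} = f ` (r\<^sup>* `` {a})"
  proof (intro equalityI subsetI)
    fix y assume sub: "r'\<^sup>* `` {f a} \<subseteq> Domain r'" and y: "y \<in> r'\<^sup>* `` {f a}"
    then obtain b where b: "b \<in> Domain r" "y = f b" unfolding dom[symmetric] by (metis imageE subsetD)
    then have "(a, b) \<in> r\<^sup>*" using y 3[OF b(1)] by simp
    then show "y \<in> f ` (r\<^sup>* `` {a})" using b by simp
  next
    fix y assume "y \<in> f ` (r\<^sup>* `` {a})"
    then show "y \<in> r'\<^sup>* `` {f a}" using 1 by blast
  qed
qed

lemma num_components_image:
  assumes r: "tolerance r" "tolerance r'"
    and dom: "f ` Domain r = Domain r'"
    and iff: "\<And>a b. a \<in> Domain r \<Longrightarrow> b \<in> Domain r \<Longrightarrow> (f a, f b) \<in> r' \<longleftrightarrow> (a, b) \<in> r"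
  shows "num_components r' = num_components r"
proof -
  have im: "r'\<^sup>* `` {f a} = f ` (r\<^sup>* `` {a})"
    "b \<in> Domain r \<Longrightarrow> (f a, f b) \<in> r'\<^sup>* \<longleftrightarrow> (a, b) \<in> r\<^sup>*" if "a \<in> Domain r" for a b
    using component_image[OF r dom iff that] by blast+
  have eq: "rel_components (Domain r') r' = (\<lambda>X. f ` X) ` rel_components (Domain r) r"
    unfolding dom[symmetric] rel_components_def image_image
    by (intro image_cong refl im(1))
  have inj: "inj_on (\<lambda>X. f ` X) (rel_components (Domain r) r)"
  proof (rule inj_onI)
    fix X Y assume "X \<in> rel_components (Domain r) r" "Y \<in> rel_components (Domain r) r" and XY: "f `
        X = f ` Y"
    then obtain a b where a: "a \<in> Domain r" "X = r\<^sup>* `` {a}" and b: "b \<in> Domain r" "Y = r\<^sup>* `` {b}"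
      by (auto simp: rel_components_def)
    have "r'\<^sup>* `` {f a} = r'\<^sup>* `` {f b}" using XY im(1)[OF a(1)] im(1)[OF b(1)] a b by simp
    then have "(f a, f b) \<in> r'\<^sup>*" by blast
    then have "(a, b) \<in> r\<^sup>*" using im(2) a b by blast
    then show "X = Y" using component_eq_iff[of r a b] r(1) a b by (simp add: tolerance_def)
  qed
  show ?thesis unfolding eq by (rule card_image[OF inj])
qed

lemma num_components_eq_sum:
  assumes r: "tolerance r" and fin: "finite (Domain r)"
  shows "real (num_components r) = (\<Sum>a\<in>Domain r. 1 / real (card (r\<^sup>* `` {a})))"
proof -
  have sy: "sym r" using r by (simp add: tolerance_def)
  have un: "Domain r = \<Union> (rel_components (Domain r) r)"
    using tolerance_component_subset[OF r] unfolding rel_components_def by blast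
  have "(\<Sum>a\<in>\<Union> (rel_components (Domain r) r). 1 / real (card (r\<^sup>* `` {a}))) =
     (\<Sum>X\<in>rel_components (Domain r) r. \<Sum>a\<in>X. 1 / real (card (r\<^sup>* `` {a})))"
  proof (subst sum.Union_disjoint)
    show "\<forall>A\<in>rel_components (Domain r) r. finite A"
      using un fin by (metis Union_upper finite_subset)
    show "\<forall>A\<in>rel_components (Domain r) r. \<forall>B\<in>rel_components (Domain r) r. A \<noteq> B \<longrightarrow> A \<inter> B = {}"
    proof (intro ballI impI)
      fix A B assume "A \<in> rel_components (Domain r) r" "B \<in> rel_components (Domain r) r" "A \<noteq> B"
      then obtain a b where ab: "A = r\<^sup>* `` {a}" "B = r\<^sup>* `` {b}" by (auto simp: rel_components_def)
      have "A = r\<^sup>* `` {x}" "B = r\<^sup>* `` {x}" if "x \<in> A" "x \<in> B" for x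
        using that unfolding ab component_eq_iff[OF sy] by simp_all
      then show "A \<inter> B = {}" using \<open>A \<noteq> B\<close> by blast
    qed
  qed simp
  also have "\<dots> = (\<Sum>X\<in>rel_components (Domain r) r. 1)"
  proof (rule sum.cong[OF refl])
    fix X assume X: "X \<in> rel_components (Domain r) r"
    then obtain a where a: "a \<in> Domain r" "X = r\<^sup>* `` {a}" by (auto simp: rel_components_def)
    have eq: "r\<^sup>* `` {b} = X" if "b \<in> X" for b
      using component_eq_iff[OF sy, of a b] that a by auto
    have "finite X" "X \<noteq> {}"
      using tolerance_component_subset[OF r a(1)] fin a by (auto intro: finite_subset)
    then have "card X \<noteq> 0" by simp
    have "(\<Sum>a\<in>X. 1 / real (card (r\<^sup>* `` {a}))) = (\<Sum>a\<in>X. 1 / real (card X))"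
      by (rule sum.cong) (simp_all add: eq)
    also have "\<dots> = 1" using \<open>card X \<noteq> 0\<close> by simp
    finally show "(\<Sum>a\<in>X. 1 / real (card (r\<^sup>* `` {a}))) = 1" .
  qed
  finally show ?thesis using un by simp
qed

section \<open>Smallest enclosing circles\<close>

lemma sec_diameter_le_iff:
  assumes "finite S" "S \<noteq> {}" "0 \<le> t"
  shows "sec_diameter S \<le> t \<longleftrightarrow> (\<exists>c. S \<subseteq> cball c (t / 2))"
  using sec_radius_le_iff[OF assms(1,2), of "t / 2"] assms(3) by (auto simp: sec_diameter_def)

lemma sec_diameter_nonneg:
  assumes "finite S" shows "0 \<le> sec_diameter S"
proof -
  obtain B where B: "0 < B" "S \<subseteq> cball 0 B"
    using bounded_subset_ballD[OF finite_imp_bounded[OF assms], of 0] ball_subset_cball by blast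
  have "B \<in> {r. 0 \<le> r \<and> (\<exists>c. S \<subseteq> cball c r)}" using B by force
  then have "0 \<le> sec_radius S" unfolding sec_radius_def by (intro cInf_greatest) auto
  then show ?thesis by (simp add: sec_diameter_def)
qed

lemma sec_diameter_mono:
  assumes "finite T" "S \<subseteq> T" "S \<noteq> {}"
  shows "sec_diameter S \<le> sec_diameter T"
proof -
  have "finite S" "T \<noteq> {}" using assms by (auto intro: finite_subset)
  then show ?thesis
    using sec_diameter_le_iff[of S "sec_diameter T"] sec_diameter_le_iff[of T "sec_diameter T"]
      sec_diameter_nonneg[OF assms(1)] assms by (meson order_refl order_trans)
qed

lemma sec_diameter_dist:
  assumes "finite S" "x \<in> S" "y \<in> S" "sec_diameter S \<le> t"
  shows "dist x y \<le> t"
proof -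
  have "0 \<le> t" using sec_diameter_nonneg[OF assms(1)] assms(4) by linarith
  then obtain c where "S \<subseteq> cball c (t / 2)" using sec_diameter_le_iff[of S t] assms by blast
  then have "dist c x \<le> t / 2" "dist c y \<le> t / 2" using assms by auto
  then show ?thesis using dist_triangle3[of x y c] by linarith
qed

section \<open>Index tuples as nodes of the lune graph\<close>

type_synonym config = "nat \<Rightarrow> (real^2) \<times> nat"

text \<open>With indices in place of points, subsamples and relabellings act on I alone, and for
  finite I the graph takes only finitely many values, which is what measurability rests on.\<close>

definition simplex_indices :: "nat \<Rightarrow> nat set \<Rightarrow> config \<Rightarrow> (nat \<Rightarrow> nat) set" where
  "simplex_indices s I z = {\<phi> \<in> {..s} \<rightarrow>\<^sub>E I. \<forall>i\<le>s. snd (z (\<phi> i)) = i}"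

definition simplex_points :: "nat \<Rightarrow> config \<Rightarrow> (nat \<Rightarrow> nat) \<Rightarrow> (real^2) set" where
  "simplex_points s z \<phi> = (\<lambda>i. fst (z (\<phi> i))) ` {..s}"

definition lune_graph :: "nat \<Rightarrow> nat set \<Rightarrow> config \<Rightarrow> real \<Rightarrow> ((nat \<Rightarrow> nat) \<times> (nat \<Rightarrow> nat)) set" where
  "lune_graph s I z t = {(\<phi>, \<psi>). \<phi> \<in> simplex_indices s I z \<and> \<psi> \<in> simplex_indices s I z \<and>
     sec_diameter (simplex_points s z \<phi> \<union> simplex_points s z \<psi>) \<le> t}"

lemma simplex_points_simps [simp]:
  "finite (simplex_points s z \<phi>)" "simplex_points s z \<phi> \<noteq> {}"
  by (auto simp: simplex_points_def)

lemma finite_simplex_indices: "finite I \<Longrightarrow> finite (simplex_indices s I z)"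
  unfolding simplex_indices_def by (rule finite_subset[of _ "{..s} \<rightarrow>\<^sub>E I"]) (auto intro: finite_PiE)

lemma Domain_lune_graph:
  "Domain (lune_graph s I z t) = {\<phi> \<in> simplex_indices s I z. sec_diameter (simplex_points s z \<phi>) \<le> t}"
proof (intro equalityI subsetI)
  fix \<phi> assume "\<phi> \<in> Domain (lune_graph s I z t)"
  then obtain \<psi> where "\<phi> \<in> simplex_indices s I z" "sec_diameter (simplex_points s z \<phi> \<union>
      simplex_points s z \<psi>) \<le> t"
    by (auto simp: lune_graph_def)
  then show "\<phi> \<in> {\<phi> \<in> simplex_indices s I z. sec_diameter (simplex_points s z \<phi>) \<le> t}"
    using sec_diameter_mono[of "simplex_points s z \<phi> \<union> simplex_points s z \<psi>" "simplex_points s z \<phi>"]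
        by auto
qed (auto simp: lune_graph_def)

lemma tolerance_lune_graph: "tolerance (lune_graph s I z t)"
  unfolding tolerance_def Domain_lune_graph by (auto simp: lune_graph_def sym_def Un_commute)

lemma finite_Domain_lune_graph: "finite I \<Longrightarrow> finite (Domain (lune_graph s I z t))"
  using finite_simplex_indices by (simp add: Domain_lune_graph)

lemma lune_graph_dist:
  assumes "(\<phi>, \<psi>) \<in> lune_graph s I z t" "i \<le> s" "k \<le> s"
  shows "dist (fst (z (\<psi> i))) (fst (z (\<phi> k))) \<le> t"
  using assms by (intro sec_diameter_dist[of "simplex_points s z \<phi> \<union> simplex_points s z \<psi>"])
    (auto simp: lune_graph_def simplex_points_def)

lemma lune_graph_cong:
  assumes "\<And>l. l \<in> I \<Longrightarrow> z l = z' l"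
  shows "lune_graph s I z t = lune_graph s I z' t"
proof -
  have 1: "simplex_indices s I z = simplex_indices s I z'"
    using assms by (auto simp: simplex_indices_def PiE_iff)
  have "simplex_points s z \<phi> = simplex_points s z' \<phi>" if "\<phi> \<in> simplex_indices s I z" for \<phi>
    unfolding simplex_points_def using that assms
    by (intro image_cong) (auto simp: simplex_indices_def PiE_iff)
  then show ?thesis unfolding lune_graph_def 1[symmetric] by auto
qed

lemma lune_graph_subset:
  assumes "J \<subseteq> I"
  shows "lune_graph s J z t = lune_graph s I z t \<inter> (({..s} \<rightarrow>\<^sub>E J) \<times> ({..s} \<rightarrow>\<^sub>E J))"
proof -
  have "simplex_indices s J z = simplex_indices s I z \<inter> ({..s} \<rightarrow>\<^sub>E J)"
    using PiE_mono[of "{..s}" "\<lambda>_. J" "\<lambda>_. I"] assms by (auto simp: simplex_indices_def)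
  then show ?thesis unfolding lune_graph_def by blast
qed

lemma sec_diameter_affine:
  assumes "finite S" "S \<noteq> {}" "0 < c" 
  shows "sec_diameter ((\<lambda>x. y + c *\<^sub>R x) ` S) \<le> c * t \<longleftrightarrow> sec_diameter S \<le> t"
proof (cases "0 \<le> t")
  case True
  have *: "dist (y + c *\<^sub>R d) (y + c *\<^sub>R x) \<le> c * t / 2 \<longleftrightarrow> dist d x \<le> t / 2" for d x
  proof -
    have "dist (y + c *\<^sub>R d) (y + c *\<^sub>R x) = c * dist d x"
      using assms(3) by (simp add: dist_norm flip: scaleR_diff_right)
    then show ?thesis using mult_le_cancel_left_pos[OF assms(3), of "dist d x" "t / 2"] by simp
  qed
  have "(\<exists>d. (\<lambda>x. y + c *\<^sub>R x) ` S \<subseteq> cball d (c * t / 2)) \<longleftrightarrow> (\<exists>d. S \<subseteq> cball d (t / 2))"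
  proof
    assume "\<exists>d. (\<lambda>x. y + c *\<^sub>R x) ` S \<subseteq> cball d (c * t / 2)"
    then obtain d where d: "(\<lambda>x. y + c *\<^sub>R x) ` S \<subseteq> cball d (c * t / 2)" by blast
    have "d = y + c *\<^sub>R ((1 / c) *\<^sub>R (d - y))" using assms(3) by simp
    then have "S \<subseteq> cball ((1 / c) *\<^sub>R (d - y)) (t / 2)"
      using d *[of "(1 / c) *\<^sub>R (d - y)"] by auto
    then show "\<exists>d. S \<subseteq> cball d (t / 2)" by blast
  next
    assume "\<exists>d. S \<subseteq> cball d (t / 2)"
    then obtain d where "S \<subseteq> cball d (t / 2)" by blast
    then have "(\<lambda>x. y + c *\<^sub>R x) ` S \<subseteq> cball (y + c *\<^sub>R d) (c * t / 2)" using * by auto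
    then show "\<exists>d. (\<lambda>x. y + c *\<^sub>R x) ` S \<subseteq> cball d (c * t / 2)" by blast
  qed
  then show ?thesis
    using sec_diameter_le_iff[of S t] sec_diameter_le_iff[of "(\<lambda>x. y + c *\<^sub>R x) ` S" "c * t"] assms True
    by simp
next
  case False
  then have "c * t < 0" using assms(3) by (simp add: mult_pos_neg)
  then show ?thesis
    using False sec_diameter_nonneg[of S] sec_diameter_nonneg[of "(\<lambda>x. y + c *\<^sub>R x) ` S"] assms(1)
    by (smt (verit) finite_imageI)
qed

lemma lune_graph_affine:
  assumes "0 < c"
  shows "lune_graph s I (\<lambda>l. (y + c *\<^sub>R fst (z l), snd (z l))) (c * t) = lune_graph s I z t"
proof -
  have 1: "simplex_points s (\<lambda>l. (y + c *\<^sub>R fst (z l), snd (z l))) \<phi> = (\<lambda>x. y + c *\<^sub>R x) `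
      simplex_points s z \<phi>" for \<phi>
    by (auto simp: simplex_points_def)
  show ?thesis
    unfolding lune_graph_def 1 image_Un[symmetric]
    using sec_diameter_affine[OF _ _ assms, where y = y and t = t] by (simp add: simplex_indices_def)
qed

text \<open>On singletons \<open>arc_cost\<close> is \<open>node_cost\<close>, so the merge tree
  formula applies to the tuples of points. The index tuples map onto these with fibres inside
  components, so the component counts agree. With an empty color class both sides vanish.\<close>

lemma lunar_cost_integral:
  assumes A: "\<And>i. A i = {fst (z j) | j. j \<in> I \<and> snd (z j) = i}" and "finite I"
  shows "has_bochner_integral lborel
     (\<lambda>t. indicator {0..} t * real (num_components (lune_graph s I z t) - 1)) (lunar_cost s A)"
proof (cases "colorful_simplices s A = {}")
  case True
  have "simplex_indices s I z = {}"
  proof (rule ccontr)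
    assume "simplex_indices s I z \<noteq> {}"
    then obtain \<phi> where "\<phi> \<in> simplex_indices s I z" by blast
    then have "(\<lambda>i\<in>{..s}. fst (z (\<phi> i))) \<in> colorful_simplices s A"
      by (force simp: colorful_simplices_def simplex_indices_def A PiE_iff)
    then show False using True by blast
  qed
  then have "Domain (lune_graph s I z t) = {}" for t by (simp add: Domain_lune_graph)
  then show ?thesis
    using True has_bochner_integral_zero by (simp add: lunar_cost_def rel_components_def Let_def)
next
  case False
  let ?V = "colorful_simplices s A"
  have finA: "finite (A i)" for i
    unfolding A using assms(2) by (rule_tac finite_subset[of _ "(\<lambda>j. fst (z j)) ` I"]) auto
  have finV: "finite ?V" unfolding colorful_simplices_def using finA by (auto intro: finite_PiE)
  have w1: "arc_cost s {a} = node_cost s a" for a by (simp add: arc_cost_def node_cost_def)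
  have w2: "arc_cost s {a} \<le> arc_cost s {a, b}" for a b
    unfolding arc_cost_def by (rule sec_diameter_mono) auto
  have w3: "0 \<le> arc_cost s {a}" for a
    unfolding arc_cost_def by (rule sec_diameter_nonneg) auto
  have "num_components (threshold_rel ?V (arc_cost s) t) = num_components (lune_graph s I z t)" for t
  proof (rule num_components_image[where f = "\<lambda>\<phi>. \<lambda>i\<in>{..s}. fst (z (\<phi> i))"])
    let ?f = "\<lambda>\<phi>. \<lambda>i\<in>{..s}. fst (z (\<phi> i))"
    show "tolerance (lune_graph s I z t)" by (rule tolerance_lune_graph)
    have dom: "Domain (threshold_rel ?V (arc_cost s) t) = {a\<in>?V. arc_cost s {a} \<le> t}"
    proof (intro equalityI subsetI)
      fix a assume "a \<in> Domain (threshold_rel ?V (arc_cost s) t)"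
      then obtain b where "a \<in> ?V" "arc_cost s {a, b} \<le> t" by (auto simp: threshold_rel_def)
      then show "a \<in> {a\<in>?V. arc_cost s {a} \<le> t}" using w2[of a b] by simp
    next
      fix a assume "a \<in> {a\<in>?V. arc_cost s {a} \<le> t}"
      then have "(a, a) \<in> threshold_rel ?V (arc_cost s) t" by (simp add: threshold_rel_def)
      then show "a \<in> Domain (threshold_rel ?V (arc_cost s) t)" by blast
    qed
    show "tolerance (threshold_rel ?V (arc_cost s) t)"
      unfolding tolerance_def dom using sym_threshold_rel by (auto simp: threshold_rel_def)
    have pts: "?f \<phi> ` {..s} = simplex_points s z \<phi>" for \<phi> by (simp add: simplex_points_def)
    have cost: "arc_cost s {?f \<phi>, ?f \<psi>} = sec_diameter (simplex_points s z \<phi> \<union> simplex_points s z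
        \<psi>)" for \<phi> \<psi>
      unfolding arc_cost_def using pts by simp
    have mem: "?f \<phi> \<in> ?V" if "\<phi> \<in> simplex_indices s I z" for \<phi>
      using that by (force simp: colorful_simplices_def simplex_indices_def A PiE_iff)
    have surj: "?V \<subseteq> ?f ` simplex_indices s I z"
    proof
      fix a assume a: "a \<in> ?V"
      then have "\<forall>i\<in>{..s}. \<exists>j. j \<in> I \<and> snd (z j) = i \<and> a i = fst (z j)"
        by (force simp: colorful_simplices_def PiE_iff A)
      then obtain g where g: "\<forall>i\<in>{..s}. g i \<in> I \<and> snd (z (g i)) = i \<and> a i = fst (z (g i))" by metis
      have "restrict g {..s} \<in> simplex_indices s I z" using g by (auto simp: simplex_indices_def)
      moreover have "a = ?f (restrict g {..s})"
        using a g by (auto simp: colorful_simplices_def PiE_iff extensional_def fun_eq_iff)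
      ultimately show "a \<in> ?f ` simplex_indices s I z" by blast
    qed
    have cost1: "arc_cost s {?f \<phi>} = sec_diameter (simplex_points s z \<phi>)" for \<phi>
      using cost[of \<phi> \<phi>] by simp
    show "?f ` Domain (lune_graph s I z t) = Domain (threshold_rel ?V (arc_cost s) t)"
      unfolding dom Domain_lune_graph
    proof (intro equalityI subsetI)
      fix a assume "a \<in> {a \<in> ?V. arc_cost s {a} \<le> t}"
      then obtain \<phi> where "\<phi> \<in> simplex_indices s I z" "a = ?f \<phi>" "arc_cost s {a} \<le> t"
        using surj by blast
      then show "a \<in> ?f ` {\<phi> \<in> simplex_indices s I z. sec_diameter (simplex_points s z \<phi>) \<le> t}"
        using cost1 by auto
    next
      fix a assume "a \<in> ?f ` {\<phi> \<in> simplex_indices s I z. sec_diameter (simplex_points s z \<phi>) \<le> t}"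
      then show "a \<in> {a \<in> ?V. arc_cost s {a} \<le> t}" using cost1 mem by auto
    qed
    show "(?f \<phi>, ?f \<psi>) \<in> threshold_rel ?V (arc_cost s) t \<longleftrightarrow> (\<phi>, \<psi>) \<in> lune_graph s I z t"
      if "\<phi> \<in> Domain (lune_graph s I z t)" "\<psi> \<in> Domain (lune_graph s I z t)" for \<phi> \<psi>
      using that mem unfolding threshold_rel_def lune_graph_def Domain_lune_graph
      by (simp add: cost)
  qed
  then show ?thesis
    using mst_cost_integral[OF finV False w2 w3] False by (simp add: lunar_cost_def w1 Let_def)
qed

text \<open>The share of point j in the sum of 1 / |component| over the nodes, with nodes in
  components of more than M members left out. A node is charged to its vertex of color 0, hence to
  exactly one point.\<close>

definition local_count :: "nat \<Rightarrow> nat \<Rightarrow> nat set \<Rightarrow> config \<Rightarrow> real \<Rightarrow> nat \<Rightarrow> real" where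
  "local_count s M I z t j = (let r = lune_graph s I z t in
     \<Sum>\<phi> | \<phi> \<in> Domain r \<and> \<phi> 0 = j. if card (r\<^sup>* `` {\<phi>}) \<le> M then 1 / real (card (r\<^sup>* `` {\<phi>})) else 0)"

lemma local_count_nonneg: "0 \<le> local_count s M I z t j"
  by (auto simp: local_count_def Let_def intro!: sum_nonneg)

lemma local_count_le:
  assumes "finite I"
  shows "local_count s M I z t j \<le> real (card {\<phi> \<in> Domain (lune_graph s I z t). \<phi> 0 = j})"
proof -
  have "(if k \<le> M then 1 / real k else 0) \<le> 1" for k by (cases k) auto
  then show ?thesis unfolding local_count_def Let_def
    by (intro order.trans[OF sum_bounded_above[where K = 1]]) auto
qed

text \<open>A node left out by the cutoff has weight below 1 / M; this is the error term of the
  upper bound.\<close>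

lemma sum_local_count:
  assumes "finite I" "0 < M"
  shows "(\<Sum>j\<in>I. local_count s M I z t j) \<le> real (num_components (lune_graph s I z t))"
    and "real (num_components (lune_graph s I z t)) \<le>
      (\<Sum>j\<in>I. local_count s M I z t j) + real (card (Domain (lune_graph s I z t))) / real M"
proof -
  define r where "r = lune_graph s I z t"
  let ?c = "\<lambda>\<phi>. card (r\<^sup>* `` {\<phi>})"
  have fin: "finite (Domain r)" unfolding r_def by (rule finite_Domain_lune_graph[OF assms(1)])
  have eq: "(\<Sum>j\<in>I. local_count s M I z t j) = (\<Sum>\<phi>\<in>Domain r. if ?c \<phi> \<le> M then 1 / real (?c \<phi>) else 0)"
    unfolding local_count_def Let_def r_def[symmetric]
    using fin assms(1) by (intro sum.group) (auto simp: r_def Domain_lune_graph simplex_indices_def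
        PiE_iff)
  have n: "real (num_components r) = (\<Sum>\<phi>\<in>Domain r. 1 / real (?c \<phi>))"
    using num_components_eq_sum[OF tolerance_lune_graph] fin unfolding r_def by blast
  show "(\<Sum>j\<in>I. local_count s M I z t j) \<le> real (num_components (lune_graph s I z t))"
    unfolding r_def[symmetric] eq n by (rule sum_mono) auto
  have "(\<Sum>\<phi>\<in>Domain r. 1 / real (?c \<phi>)) \<le> (\<Sum>\<phi>\<in>Domain r. (if ?c \<phi> \<le> M then 1 / real (?c \<phi>) else 0) + 1
      / real M)"
    using assms(2) by (intro sum_mono) (auto intro!: divide_left_mono)
  then show "real (num_components (lune_graph s I z t)) \<le>
      (\<Sum>j\<in>I. local_count s M I z t j) + real (card (Domain (lune_graph s I z t))) / real M"
    unfolding r_def[symmetric] eq n by (simp add: sum.distrib)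
qed

text \<open>A component with at most \<open>M\<close> nodes is spanned by at most \<open>M\<^sup>2\<close> arcs, hence is contained in a
  ball of radius \<open>(M\<^sup>2 + 1) t\<close>; its neighbours are seen within one more step.\<close>

lemma local_count_local:
  assumes "finite I" "J \<subseteq> I" "j \<in> J" "0 \<le> t"
    and near: "\<And>l. l \<in> I \<Longrightarrow> dist (fst (z l)) (fst (z j)) \<le> (real M ^ 2 + 2) * t \<Longrightarrow> l \<in> J"
  shows "local_count s M I z t j = local_count s M J z t j"
proof -
  define r where "r = lune_graph s I z t"
  define r' where "r' = lune_graph s J z t"
  let ?D = "{..s} \<rightarrow>\<^sub>E J"
  have r': "r' = r \<inter> ?D \<times> ?D" unfolding r_def r'_def using assms(2) by (rule lune_graph_subset)
  have tol: "tolerance r" "tolerance r'" unfolding r_def r'_def by (rule tolerance_lune_graph)+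
  have finJ: "finite J" using assms(1,2) by (rule finite_subset[rotated])
  have fin: "finite (Domain r)" "finite (Domain r')"
    unfolding r_def r'_def using assms(1) finJ by (simp_all add: finite_Domain_lune_graph)
  have rI: "\<phi> \<in> {..s} \<rightarrow>\<^sub>E I" if "\<phi> \<in> Domain r" for \<phi>
    using that by (auto simp: r_def Domain_lune_graph simplex_indices_def)
  have inD: "\<phi> \<in> ?D" if "\<phi> \<in> Domain r" "\<And>i. i \<le> s \<Longrightarrow> dist (fst (z (\<phi> i))) (fst (z j)) \<le> (real M ^ 2 +
      2) * t" for \<phi>
  proof (rule PiE_I)
    fix i assume "i \<in> {..s}"
    then show "\<phi> i \<in> J" using rI[OF that(1)] that(2)[of i] near[of "\<phi> i"] by (simp add: PiE_iff)
  next
    fix i assume "i \<notin> {..s}"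
    then show "\<phi> i = undefined" using rI[OF that(1)] by (rule PiE_arb[rotated])
  qed
  have far: "dist (fst (z (\<psi> i))) (fst (z j)) \<le> (real n + 1) * t"
    if "(\<phi>, \<psi>) \<in> r ^^ n" "\<phi> \<in> Domain r" "\<phi> 0 = j" "i \<le> s" for \<phi> \<psi> n i
    using that
  proof (induction n arbitrary: \<psi> i)
    case 0
    then have "(\<phi>, \<phi>) \<in> r" using tol(1) by (auto simp: tolerance_def)
    then show ?case using lune_graph_dist[of \<phi> \<phi> s I z t i 0] 0 by (auto simp: r_def)
  next
    case (Suc n)
    then obtain \<xi> where \<xi>: "(\<phi>, \<xi>) \<in> r ^^ n" "(\<xi>, \<psi>) \<in> r" by auto
    have "dist (fst (z (\<xi> 0))) (fst (z j)) \<le> (real n + 1) * t" using Suc \<xi> by blast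
    moreover have "dist (fst (z (\<psi> i))) (fst (z (\<xi> 0))) \<le> t"
      using lune_graph_dist[of \<xi> \<psi> s I z t i 0] \<xi> Suc.prems by (simp add: r_def)
    ultimately show ?case
      using dist_triangle[of "fst (z (\<psi> i))" "fst (z j)" "fst (z (\<xi> 0))"] by (simp add: algebra_simps)
  qed
  have start: "{\<phi> \<in> Domain r. \<phi> 0 = j} = {\<phi> \<in> Domain r'. \<phi> 0 = j}"
  proof (intro equalityI subsetI)
    fix \<phi> assume a: "\<phi> \<in> {\<phi> \<in> Domain r. \<phi> 0 = j}"
    have "t \<le> (real M ^ 2 + 2) * t" using assms(4) by (simp add: distrib_right)
    then have "\<phi> \<in> ?D" using a far[of \<phi> \<phi> 0] by (intro inD) (fastforce+)
    then show "\<phi> \<in> {\<phi> \<in> Domain r'. \<phi> 0 = j}"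
      using a tol(1) by (force simp: r' tolerance_def)
  qed (auto simp: r')
  have sub: "r'\<^sup>* `` {\<phi>} \<subseteq> r\<^sup>* `` {\<phi>}" for \<phi>
    using rtrancl_mono[of r' r] by (auto simp: r')
  \<comment> \<open>Only the component within J is assumed to be small. A walk of the larger graph
    that leaves it would do so along one arc, whose far end is still within the radius and so has
    its indices in J; then this arc already belongs to the smaller graph.\<close>
  have main: "r\<^sup>* `` {\<phi>} = r'\<^sup>* `` {\<phi>}" if \<phi>: "\<phi> \<in> Domain r'" "\<phi> 0 = j" and small: "card (r'\<^sup>* ``
      {\<phi>}) \<le> M" for \<phi>
  proof
    let ?C = "r'\<^sup>* `` {\<phi>}"
    have \<phi>r: "\<phi> \<in> Domain r" using \<phi> by (auto simp: r')
    have finC: "finite ?C" using tolerance_component_subset[OF tol(2) \<phi>(1)] fin(2) by (rule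
        finite_subset)
    have "\<psi> \<in> ?C" if "(\<phi>, \<psi>) \<in> r\<^sup>*" for \<psi>
      using that
    proof induction
      case (step \<xi> \<psi>)
      let ?q = "r' \<inter> ?C \<times> ?C"
      have "(\<phi>, \<xi>) \<in> r'\<^sup>*" using step by simp
      then have "(\<phi>, \<xi>) \<in> ?q\<^sup>*"
      proof induction
        case (step y w)
        then have "(y, w) \<in> ?q" by (auto intro: rtrancl_into_rtrancl)
        then show ?case using step by (meson rtrancl_into_rtrancl)
      qed simp
      moreover have "finite ?q" using finC by auto
      \<comment> \<open>A walk inside the component can be chosen no longer than the number of its
        related pairs, and this bounds the distance travelled.\<close>
      ultimately obtain n where n: "n \<le> card ?q" "(\<phi>, \<xi>) \<in> ?q ^^ n"
        using rtrancl_finite_eq_relpow[of ?q] by blast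
      have "card ?q \<le> card (?C \<times> ?C)" using finC by (intro card_mono) auto
      also have "\<dots> \<le> M ^ 2" using small by (simp add: card_cartesian_product power2_eq_square mult_mono)
      finally have "n \<le> M ^ 2" using n(1) by (rule order.trans[rotated])
      then have "real n \<le> real (M ^ 2)" by (rule of_nat_mono)
      then have nM: "real n \<le> real M ^ 2" by simp
      have "(\<phi>, \<xi>) \<in> r ^^ n"
      proof -
        have "?q \<subseteq> r" by (auto simp: r')
        then have "?q ^^ n \<subseteq> r ^^ n" by (induction n) (auto intro: relcomp_mono)
        then show ?thesis using n(2) by blast
      qed
      then have "(\<phi>, \<psi>) \<in> r ^^ (Suc n)" using step(2) by auto
      then have "dist (fst (z (\<psi> i))) (fst (z j)) \<le> (real (Suc n) + 1) * t" if "i \<le> s" for i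
        using far \<phi>r \<phi>(2) that by blast
      moreover have "(real (Suc n) + 1) * t \<le> (real M ^ 2 + 2) * t"
        using nM assms(4) by (intro mult_right_mono) auto
      ultimately have "dist (fst (z (\<psi> i))) (fst (z j)) \<le> (real M ^ 2 + 2) * t" if "i \<le> s" for i
        using that by (meson order_trans)
      moreover have "\<psi> \<in> Domain r" using step(2) tol(1) by (auto simp: tolerance_def dest: symD)
      ultimately have "\<psi> \<in> ?D" by (intro inD)
      moreover have "\<xi> \<in> ?D"
        using tolerance_component_subset[OF tol(2) \<phi>(1)] step(3) by (auto simp: r')
      ultimately have "(\<xi>, \<psi>) \<in> r'" using step(2) by (simp add: r')
      then show ?case using step(3) by (auto intro: rtrancl_into_rtrancl)
    qed simp
    then show "r\<^sup>* `` {\<phi>} \<subseteq> ?C" by blast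
  qed (rule sub)
  show ?thesis
    unfolding local_count_def Let_def r_def[symmetric] r'_def[symmetric] start
  proof (rule sum.cong[OF refl])
    fix \<phi> assume "\<phi> \<in> {\<phi> \<in> Domain r'. \<phi> 0 = j}"
    then have \<phi>: "\<phi> \<in> Domain r'" "\<phi> 0 = j" "\<phi> \<in> Domain r" by (auto simp: r')
    have finC: "finite (r\<^sup>* `` {\<phi>})"
      using tolerance_component_subset[OF tol(1) \<phi>(3)] fin(1) by (rule finite_subset)
    show "(if card (r\<^sup>* `` {\<phi>}) \<le> M then 1 / real (card (r\<^sup>* `` {\<phi>})) else 0) =
          (if card (r'\<^sup>* `` {\<phi>}) \<le> M then 1 / real (card (r'\<^sup>* `` {\<phi>})) else 0)"
      \<comment> \<open>If the component within J has more than M nodes, so has the larger one that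
        contains it, and both terms are 0.\<close>
      using main[OF \<phi>(1,2)] card_mono[OF finC sub] by (cases "card (r'\<^sup>* `` {\<phi>}) \<le> M") auto
  qed
qed

lemma local_count_affine:
  assumes "0 < c"
  shows "local_count s M I (\<lambda>l. (y + c *\<^sub>R fst (z l), snd (z l))) (c * t) j = local_count s M I z t j"
  unfolding local_count_def lune_graph_affine[OF assms] ..

lemma local_count_cong:
  assumes "\<And>l. l \<in> I \<Longrightarrow> z l = z' l"
  shows "local_count s M I z t j = local_count s M I z' t j"
  unfolding local_count_def using lune_graph_cong[OF assms] by simp

text \<open>Sizes of components enter here, not just their number, so the map on index tuples must
  be injective; the injectivity of p provides this.\<close>

lemma local_count_reindex:
  assumes inj: "inj_on p J" and j: "j \<in> J"
  shows "local_count s M (p ` J) z t (p j) = local_count s M J (z \<circ> p) t j"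
proof -
  define r where "r = lune_graph s J (z \<circ> p) t"
  define r' where "r' = lune_graph s (p ` J) z t"
  let ?f = "\<lambda>\<phi>. \<lambda>i\<in>{..s}. p (\<phi> i)"
  have tol: "tolerance r" "tolerance r'" unfolding r_def r'_def by (rule tolerance_lune_graph)+
  have pts: "simplex_points s z (?f \<phi>) = simplex_points s (z \<circ> p) \<phi>" for \<phi>
    by (simp add: simplex_points_def)
  have mem: "?f \<phi> \<in> simplex_indices s (p ` J) z" if "\<phi> \<in> simplex_indices s J (z \<circ> p)" for \<phi>
    using that by (auto simp: simplex_indices_def PiE_iff)
  have surj: "simplex_indices s (p ` J) z \<subseteq> ?f ` simplex_indices s J (z \<circ> p)"
  proof
    fix \<psi> assume a: "\<psi> \<in> simplex_indices s (p ` J) z"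
    let ?\<phi> = "\<lambda>i\<in>{..s}. inv_into J p (\<psi> i)"
    have im: "\<psi> i \<in> p ` J" if "i \<le> s" for i using a that by (auto simp: simplex_indices_def PiE_iff)
    have "?\<phi> \<in> simplex_indices s J (z \<circ> p)"
      using a im by (auto simp: simplex_indices_def PiE_iff inv_into_into f_inv_into_f)
    moreover have "\<psi> = ?f ?\<phi>"
      using a im by (auto simp: simplex_indices_def PiE_iff extensional_def fun_eq_iff f_inv_into_f)
    ultimately show "\<psi> \<in> ?f ` simplex_indices s J (z \<circ> p)" by blast
  qed
  have dom: "?f ` Domain r = Domain r'"
    unfolding r_def r'_def Domain_lune_graph using mem surj by (auto simp: pts)
  have iff: "(?f \<phi>, ?f \<psi>) \<in> r' \<longleftrightarrow> (\<phi>, \<psi>) \<in> r" if "\<phi> \<in> Domain r" "\<psi> \<in> Domain r" for \<phi> \<psi>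
    using that mem unfolding r_def r'_def Domain_lune_graph lune_graph_def by (simp add: pts)
  have injf: "inj_on ?f (Domain r)"
  proof (rule inj_onI)
    fix \<phi> \<psi> assume a: "\<phi> \<in> Domain r" "\<psi> \<in> Domain r" "?f \<phi> = ?f \<psi>"
    show "\<phi> = \<psi>"
    proof (rule PiE_ext)
      show "\<phi> \<in> {..s} \<rightarrow>\<^sub>E J" "\<psi> \<in> {..s} \<rightarrow>\<^sub>E J"
        using a(1,2) by (auto simp: r_def Domain_lune_graph simplex_indices_def)
      then show "\<phi> i = \<psi> i" if "i \<in> {..s}" for i
        using fun_cong[OF a(3), of i] that inj by (auto simp: PiE_iff inj_on_def)
    qed
  qed
  have card: "card (r'\<^sup>* `` {?f \<phi>}) = card (r\<^sup>* `` {\<phi>})" if "\<phi> \<in> Domain r" for \<phi>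
  proof -
    have "r'\<^sup>* `` {?f \<phi>} = ?f ` (r\<^sup>* `` {\<phi>})"
      by (rule component_image(1)[OF tol dom _ that]) (rule iff)
    then show ?thesis
      using card_image[OF inj_on_subset[OF injf tolerance_component_subset[OF tol(1) that]]] by metis
  qed
  have start: "{\<phi> \<in> Domain r'. \<phi> 0 = p j} = ?f ` {\<phi> \<in> Domain r. \<phi> 0 = j}"
  proof -
    have "?f \<phi> 0 = p j \<longleftrightarrow> \<phi> 0 = j" if "\<phi> \<in> Domain r" for \<phi>
    proof -
      have "\<phi> 0 \<in> J" using that by (auto simp: r_def Domain_lune_graph simplex_indices_def PiE_iff)
      then show ?thesis using inj j by (auto simp: inj_on_def)
    qed
    then show ?thesis unfolding dom[symmetric] by blast
  qed
  show ?thesis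
    unfolding local_count_def Let_def r_def[symmetric] r'_def[symmetric] start
    by (subst sum.reindex) (auto intro!: sum.cong inj_on_subset[OF injf] simp: card[OF DomainI])
qed

section \<open>Measurability and finite product measures\<close>

text \<open>The law of one colored point. With position and color joined, the sample is a product of
  identical factors, and conditioning on the points in a window acts on each factor
  separately.\<close>

definition marked_uniform :: "nat \<Rightarrow> (real^2) set \<Rightarrow> ((real^2) \<times> nat) measure" where
  "marked_uniform s B = uniform_measure lborel B \<Otimes>\<^sub>M measure_pmf (pmf_of_set {..s})"

lemma sets_marked_uniform [measurable_cong]:
  "sets (marked_uniform s B) = sets (borel \<Otimes>\<^sub>M count_space UNIV)"
  unfolding marked_uniform_def by (intro sets_pair_measure_cong) auto

lemma space_marked_uniform [simp]: "space (marked_uniform s B) = UNIV"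
  using sets_eq_imp_space_eq[OF sets_marked_uniform] by (simp add: space_pair_measure)

abbreviation config_space :: "nat set \<Rightarrow> config measure" where
  "config_space I \<equiv> \<Pi>\<^sub>M l\<in>I. borel \<Otimes>\<^sub>M count_space UNIV"

lemma sets_PiM_marked [measurable_cong]:
  "sets (\<Pi>\<^sub>M l\<in>I. marked_uniform s B) = sets (config_space I)"
  by (intro sets_PiM_cong sets_marked_uniform refl)

lemma emeasure_cbox_vec2:
  fixes a :: "real^2"
  assumes "\<And>i. a $ i \<le> b $ i"
  shows "emeasure lborel (cbox a b) = ennreal ((b $ 1 - a $ 1) * (b $ 2 - a $ 2))"
proof -
  have B: "(\<Prod>u\<in>Basis. (b - a) \<bullet> u) = (b $ 1 - a $ 1) * (b $ 2 - a $ 2)"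
  proof -
    have B: "(Basis :: (real^2) set) = {axis 1 1, axis 2 1}"
      by (auto simp: Basis_vec_def UNIV_2)
    have "axis (1::2) (1::real) \<noteq> axis 2 1" by (simp add: axis_eq_axis)
    then show ?thesis unfolding B by (simp add: inner_axis)
  qed
  show ?thesis
    unfolding B[symmetric] using assms
    by (intro emeasure_lborel_cbox) (auto simp: Basis_vec_def inner_axis)
qed

lemma prob_space_marked_uniform:
  assumes "\<And>i. a $ i < b $ i"
  shows "prob_space (marked_uniform s (cbox a b))"
proof -
  have "0 < (b $ 1 - a $ 1) * (b $ 2 - a $ 2)" using assms by simp
  then have "prob_space (uniform_measure lborel (cbox a b))"
    using emeasure_cbox_vec2[of a b, OF less_imp_le[OF assms]]
    by (intro prob_space_uniform_measure) (simp_all only: ennreal_eq_0_iff not_le, auto)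
  then show ?thesis
    unfolding marked_uniform_def by (intro prob_space_pair prob_space_measure_pmf)
qed

section \<open>Measurability of the lune graph\<close>

lemma sec_diameter_le_iff_dense:
  fixes X :: "(real^2) set"
  assumes "finite X" "X \<noteq> {}" and D: "\<And>S. open S \<Longrightarrow> S \<noteq> {} \<Longrightarrow> \<exists>d\<in>D. d \<in> S"
  shows "sec_diameter X \<le> t \<longleftrightarrow> 0 \<le> t \<and> (\<forall>k::nat. \<exists>c\<in>D. \<forall>x\<in>X. dist x c < t / 2 + 1 / real (Suc k))"
proof (cases "0 \<le> t")
  case True
  show ?thesis
  proof
    assume "sec_diameter X \<le> t"
    then obtain c where c: "X \<subseteq> cball c (t / 2)" using sec_diameter_le_iff[of X t] assms True by blast
    have "\<exists>c\<in>D. \<forall>x\<in>X. dist x c < t / 2 + 1 / real (Suc k)" for k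
    proof -
      obtain d where d: "d \<in> D" "d \<in> ball c (1 / real (Suc k))"
        using D[of "ball c (1 / real (Suc k))"] by auto
      have "dist x d < t / 2 + 1 / real (Suc k)" if "x \<in> X" for x
      proof -
        have "dist c x \<le> t / 2" using c that by auto
        moreover have "dist c d < 1 / real (Suc k)" using d by simp
        ultimately show ?thesis using dist_triangle3[of x d c] by linarith
      qed
      then show ?thesis using d by blast
    qed
    then show "0 \<le> t \<and> (\<forall>k::nat. \<exists>c\<in>D. \<forall>x\<in>X. dist x c < t / 2 + 1 / real (Suc k))" using True by blast
  next
    assume a: "0 \<le> t \<and> (\<forall>k::nat. \<exists>c\<in>D. \<forall>x\<in>X. dist x c < t / 2 + 1 / real (Suc k))"
    show "sec_diameter X \<le> t"
    proof (rule field_le_epsilon)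
      fix e :: real assume "0 < e"
      then obtain k where k: "1 / real (Suc k) < e / 2"
        using reals_Archimedean[of "e / 2"] by (auto simp: inverse_eq_divide)
      obtain c where "\<forall>x\<in>X. dist x c < t / 2 + 1 / real (Suc k)" using a by blast
      then have "X \<subseteq> cball c ((t + e) / 2)" using k by (fastforce simp: dist_commute add_divide_distrib)
      then show "sec_diameter X \<le> t + e"
        using sec_diameter_le_iff[of X "t + e"] assms True \<open>0 < e\<close> by auto
    qed
  qed
next
  case False
  then show ?thesis using sec_diameter_nonneg[OF assms(1)] by auto
qed

text \<open>The center of an enclosing circle ranges over an uncountable set. Centers from a
  countable dense set, with slack 1 / (k + 1) for every k, describe the same event by countable
  operations.\<close>

lemma measurable_sec_diameter_le:
  assumes "finite S" "S \<noteq> {}" "S \<subseteq> I"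
  shows "Measurable.pred (borel \<Otimes>\<^sub>M config_space I) (\<lambda>w. sec_diameter ((\<lambda>l. fst (snd w l)) ` S) \<le> fst w)"
proof -
  obtain D :: "(real^2) set" where D: "countable D" "\<And>S. open S \<Longrightarrow> S \<noteq> {} \<Longrightarrow> \<exists>d\<in>D. d \<in> S"
    using countable_dense_exists by metis
  have comp: "(\<lambda>w. fst (snd w l)) \<in> borel_measurable (borel \<Otimes>\<^sub>M config_space I)" if "l \<in> S" for l
  proof -
    have "(\<lambda>w. snd w l) \<in> borel \<Otimes>\<^sub>M config_space I \<rightarrow>\<^sub>M borel \<Otimes>\<^sub>M count_space UNIV"
      using that assms(3)
      by (intro measurable_compose[OF measurable_snd] measurable_component_singleton) auto
    then show ?thesis by (rule measurable_compose[OF _ measurable_fst])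
  qed
  have "Measurable.pred (borel \<Otimes>\<^sub>M config_space I) (\<lambda>w. 0 \<le> fst w \<and>
      (\<forall>k::nat. \<exists>c\<in>D. \<forall>l\<in>S. dist (fst (snd w l)) c < fst w / 2 + 1 / real (Suc k)))"
  proof (intro pred_intros_logic pred_intros_countable)
    show "Measurable.pred (borel \<Otimes>\<^sub>M config_space I) (\<lambda>w. (0::real) \<le> fst w)" by measurable
    fix k :: nat
    show "Measurable.pred (borel \<Otimes>\<^sub>M config_space I)
       (\<lambda>w. \<exists>c\<in>D. \<forall>l\<in>S. dist (fst (snd w l)) c < fst w / 2 + 1 / real (Suc k))"
      unfolding pred_def
    proof (rule sets.sets_Collect_countable_Ex'[OF _ D(1)], unfold pred_def[symmetric], rule
        pred_intros_finite(3)[OF assms(1)])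
      fix c l assume "l \<in> S"
      note [measurable] = comp[OF this]
      show "Measurable.pred (borel \<Otimes>\<^sub>M config_space I) (\<lambda>w. dist (fst (snd w l)) c < fst w / 2 + 1 /
          real (Suc k))"
        by measurable
    qed
  qed
  then show ?thesis
    using sec_diameter_le_iff_dense[where D = D, OF _ _ D(2)] assms(1,2) by simp
qed

text \<open>The graph takes finitely many values, each on a measurable event, so every function F of
  it is measurable, whatever F computes. Threshold and configuration vary jointly because their
  integrals are exchanged later.\<close>

lemma measurable_lune_graph:
  fixes F :: "_ \<Rightarrow> 'b :: topological_space"
  assumes "finite I"
  shows "(\<lambda>w. F (lune_graph s I (snd w) (fst w))) \<in> borel_measurable (borel \<Otimes>\<^sub>M config_space I)"
proof -
  let ?\<Phi> = "{..s} \<rightarrow>\<^sub>E I" and ?M = "borel \<Otimes>\<^sub>M config_space I"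
  have fin: "finite ?\<Phi>" using assms by (auto intro: finite_PiE)
  have si: "Measurable.pred ?M (\<lambda>w. \<phi> \<in> simplex_indices s I (snd w))" if "\<phi> \<in> ?\<Phi>" for \<phi>
  proof -
    have comp: "(\<lambda>w. snd (snd w l)) \<in> ?M \<rightarrow>\<^sub>M count_space UNIV" if "l \<in> I" for l
    proof -
      have "(\<lambda>w. snd w l) \<in> borel \<Otimes>\<^sub>M config_space I \<rightarrow>\<^sub>M borel \<Otimes>\<^sub>M count_space UNIV"
        using that by (intro measurable_compose[OF measurable_snd] measurable_component_singleton) auto
      then show ?thesis by (rule measurable_compose[OF _ measurable_snd])
    qed
    have "Measurable.pred ?M (\<lambda>w. \<forall>i\<in>{..s}. snd (snd w (\<phi> i)) = i)"
    proof (intro pred_intros_finite)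
      fix i assume "i \<in> {..s}"
      then have "\<phi> i \<in> I" using that by (auto simp: PiE_iff)
      note [measurable] = comp[OF this]
      show "Measurable.pred ?M (\<lambda>w. snd (snd w (\<phi> i)) = i)" by measurable
    qed simp
    moreover have "\<phi> \<in> simplex_indices s I z \<longleftrightarrow> (\<forall>i\<in>{..s}. snd (z (\<phi> i)) = i)" for z
      unfolding simplex_indices_def mem_Collect_eq using that by blast
    ultimately show ?thesis by (simp only:)
  qed
  have pr: "Measurable.pred ?M (\<lambda>w. (\<phi>, \<psi>) \<in> lune_graph s I (snd w) (fst w))" if "\<phi> \<in> ?\<Phi>" "\<psi> \<in> ?\<Phi>"
      for \<phi> \<psi>
  proof -
    have "simplex_points s z \<phi> \<union> simplex_points s z \<psi> = (\<lambda>l. fst (z l)) ` (\<phi> ` {..s} \<union> \<psi> ` {..s})" for z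
      by (auto simp: simplex_points_def)
    moreover have "Measurable.pred ?M (\<lambda>w. sec_diameter ((\<lambda>l. fst (snd w l)) ` (\<phi> ` {..s} \<union> \<psi> `
        {..s})) \<le> fst w)"
      using that by (intro measurable_sec_diameter_le) (auto simp: PiE_iff)
    ultimately show ?thesis
      using si[OF that(1)] si[OF that(2)] unfolding lune_graph_def
      by (simp only: mem_Collect_eq case_prod_conv) (intro pred_intros_logic)
  qed
  have "(\<lambda>w. lune_graph s I (snd w) (fst w)) \<in> ?M \<rightarrow>\<^sub>M count_space (Pow (?\<Phi> \<times> ?\<Phi>))"
  proof (subst measurable_count_space_eq_countable)
    show "countable (Pow (?\<Phi> \<times> ?\<Phi>))" using fin by (intro countable_finite) auto
    have sub: "lune_graph s I z t \<subseteq> ?\<Phi> \<times> ?\<Phi>" for z t by (auto simp: lune_graph_def simplex_indices_def)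
    have "(\<lambda>w. lune_graph s I (snd w) (fst w)) -` {r} \<inter> space ?M \<in> sets ?M" if r: "r \<subseteq> ?\<Phi> \<times> ?\<Phi>" for r
    proof -
      have "Measurable.pred ?M (\<lambda>w. \<forall>\<phi>\<in>?\<Phi>. \<forall>\<psi>\<in>?\<Phi>. (\<phi>, \<psi>) \<in> lune_graph s I (snd w) (fst w) \<longleftrightarrow> (\<phi>, \<psi>) \<in> r)"
        using pr fin by (intro pred_intros_finite pred_intros_logic) auto
      then have meas: "{w \<in> space ?M. \<forall>\<phi>\<in>?\<Phi>. \<forall>\<psi>\<in>?\<Phi>. (\<phi>, \<psi>) \<in> lune_graph s I (snd w) (fst w) \<longleftrightarrow> (\<phi>, \<psi>)
          \<in> r} \<in> sets ?M"
        by (simp only: pred_def)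
      have eq: "lune_graph s I z t = r \<longleftrightarrow> (\<forall>\<phi>\<in>?\<Phi>. \<forall>\<psi>\<in>?\<Phi>. (\<phi>, \<psi>) \<in> lune_graph s I z t \<longleftrightarrow> (\<phi>, \<psi>) \<in> r)"
          for z t
      proof
        assume a: "\<forall>\<phi>\<in>?\<Phi>. \<forall>\<psi>\<in>?\<Phi>. (\<phi>, \<psi>) \<in> lune_graph s I z t \<longleftrightarrow> (\<phi>, \<psi>) \<in> r"
        show "lune_graph s I z t = r"
        proof (rule set_eqI)
          fix p show "p \<in> lune_graph s I z t \<longleftrightarrow> p \<in> r"
            using a sub[of z t] r by (cases p) blast
        qed
      qed simp
      have "(\<lambda>w. lune_graph s I (snd w) (fst w)) -` {r} \<inter> space ?M =
         {w \<in> space ?M. \<forall>\<phi>\<in>?\<Phi>. \<forall>\<psi>\<in>?\<Phi>. (\<phi>, \<psi>) \<in> lune_graph s I (snd w) (fst w) \<longleftrightarrow> (\<phi>, \<psi>) \<in> r}"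
      proof (rule set_eqI)
        fix w
        show "w \<in> (\<lambda>w. lune_graph s I (snd w) (fst w)) -` {r} \<inter> space ?M \<longleftrightarrow> w \<in> {w \<in> space ?M.
          \<forall>\<phi>\<in>?\<Phi>. \<forall>\<psi>\<in>?\<Phi>. (\<phi>, \<psi>) \<in> lune_graph s I (snd w) (fst w) \<longleftrightarrow> (\<phi>, \<psi>) \<in> r}"
          using eq[of "snd w" "fst w"] by (simp only: Int_iff vimage_singleton_eq mem_Collect_eq
              conj_commute)
      qed
      then show ?thesis using meas by (simp only:)
    qed
    then show "(\<lambda>w. lune_graph s I (snd w) (fst w)) \<in> space ?M \<rightarrow> Pow (?\<Phi> \<times> ?\<Phi>) \<and>
       (\<forall>r\<in>Pow (?\<Phi> \<times> ?\<Phi>). (\<lambda>w. lune_graph s I (snd w) (fst w)) -` {r} \<inter> space ?M \<in> sets ?M)"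
      using sub by blast
  qed
  then show ?thesis by (rule measurable_compose) simp
qed

lemma measurable_lune_graph_fixed:
  fixes F :: "_ \<Rightarrow> 'b :: topological_space"
  assumes "finite I"
  shows "(\<lambda>z. F (lune_graph s I z t)) \<in> borel_measurable (config_space I)"
  using measurable_compose[OF measurable_Pair1' measurable_lune_graph[OF assms], of t] by simp

lemma measurable_local_count:
  assumes "finite I"
  shows "(\<lambda>z. local_count s M I z t j) \<in> borel_measurable (config_space I)"
  unfolding local_count_def Let_def by (rule measurable_lune_graph_fixed[OF assms])

text \<open>Splits according to the set J of indices whose points fall into B. On that event the
  integrand depends only on the coordinates in J, and every other coordinate contributes the
  probability of missing B.\<close>

lemma nn_integral_PiM_subset_decomposition:
  fixes H :: "'i set \<Rightarrow> ('i \<Rightarrow> 'a) \<Rightarrow> ennreal"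
  assumes M: "prob_space M" and I: "finite I" and B [measurable]: "B \<in> sets M"
    and H: "\<And>J. J \<subseteq> I \<Longrightarrow> H J \<in> borel_measurable (\<Pi>\<^sub>M i\<in>J. M)"
    and cong: "\<And>J z z'. J \<subseteq> I \<Longrightarrow> (\<And>i. i \<in> J \<Longrightarrow> z i = z' i) \<Longrightarrow> H J z = H J z'"
  shows "(\<integral>\<^sup>+z. H {i\<in>I. z i \<in> B} z \<partial>(\<Pi>\<^sub>M i\<in>I. M)) =
    (\<Sum>J\<in>Pow I. emeasure M (space M - B) ^ card (I - J) *
      (\<integral>\<^sup>+z. (\<Prod>i\<in>J. indicator B (z i)) * H J z \<partial>(\<Pi>\<^sub>M i\<in>J. M)))"
proof -
  interpret prob_space M by fact
  interpret P: product_sigma_finite "\<lambda>_::'i. M" by standard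
  let ?g = "\<lambda>J z. (\<Prod>i\<in>J. indicator B (z i)) * (\<Prod>i\<in>I - J. indicator (space M - B) (z i)) * H J z ::
      ennreal"
  have H': "H J \<in> borel_measurable (\<Pi>\<^sub>M i\<in>I. M)" if "J \<subseteq> I" for J
  proof -
    have "(\<lambda>z. H J (restrict z J)) \<in> borel_measurable (\<Pi>\<^sub>M i\<in>I. M)"
      using measurable_restrict_subset[OF that] H[OF that] by (rule measurable_compose)
    moreover have "H J (restrict z J) = H J z" for z by (rule cong[OF that]) simp
    ultimately show ?thesis by simp
  qed
  have g: "?g J \<in> borel_measurable (\<Pi>\<^sub>M i\<in>I. M)" if J: "J \<subseteq> I" for J
  proof -
    note [measurable] = H'[OF J]
    have [measurable]: "(\<lambda>z. z i) \<in> (\<Pi>\<^sub>M i\<in>I. M) \<rightarrow>\<^sub>M M" if "i \<in> I" for i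
      using that by (rule measurable_component_singleton)
    have 1: "(\<lambda>z. \<Prod>i\<in>J. indicator B (z i) :: ennreal) \<in> borel_measurable (\<Pi>\<^sub>M i\<in>I. M)"
      using J by (intro borel_measurable_prod_ennreal) (auto intro!: measurable_compose[OF
          measurable_component_singleton])
    have 2: "(\<lambda>z. \<Prod>i\<in>I-J. indicator (space M - B) (z i) :: ennreal) \<in> borel_measurable (\<Pi>\<^sub>M i\<in>I. M)"
      by (intro borel_measurable_prod_ennreal) (auto intro!: measurable_compose[OF
          measurable_component_singleton])
    show ?thesis using 1 2 by measurable
  qed
  have "H {i\<in>I. z i \<in> B} z = (\<Sum>J\<in>Pow I. ?g J z)" if z: "z \<in> space (\<Pi>\<^sub>M i\<in>I. M)" for z
  proof -
    let ?J = "{i\<in>I. z i \<in> B}"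
    have "?g J z = (if J = ?J then H J z else 0)" if JI: "J \<in> Pow I" for J
    proof (cases "J = ?J")
      case True
      have "(\<Prod>i\<in>J. indicator B (z i)) = (1::ennreal)" unfolding True by (rule prod.neutral) auto
      moreover have "(\<Prod>i\<in>I - J. indicator (space M - B) (z i)) = (1::ennreal)"
        using z unfolding True by (intro prod.neutral) (auto simp: space_PiM PiE_iff)
      ultimately show ?thesis using True by simp
    next
      case False
      then consider i where "i \<in> J" "z i \<notin> B" | i where "i \<in> I - J" "z i \<in> B" using JI by blast
      then have "(\<Prod>i\<in>J. indicator B (z i)) = (0::ennreal) \<or> (\<Prod>i\<in>I - J. indicator (space M - B) (z
          i)) = (0::ennreal)"
      proof cases
        case 1
        then show ?thesis
          using JI I by (intro disjI1 prod_zero bexI[of _ i]) (auto intro: finite_subset)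
      next
        case 2
        then show ?thesis using I by (intro disjI2 prod_zero bexI[of _ i]) auto
      qed
      then show ?thesis using False by auto
    qed
    then have "(\<Sum>J\<in>Pow I. ?g J z) = (\<Sum>J\<in>Pow I. if J = ?J then H J z else 0)" by (rule sum.cong[OF refl])
    also have "\<dots> = H ?J z" using I by (subst sum.delta) auto
    finally show ?thesis by simp
  qed
  then have "(\<integral>\<^sup>+z. H {i\<in>I. z i \<in> B} z \<partial>(\<Pi>\<^sub>M i\<in>I. M)) = (\<integral>\<^sup>+z. (\<Sum>J\<in>Pow I. ?g J z) \<partial>(\<Pi>\<^sub>M i\<in>I. M))"
    by (rule nn_integral_cong)
  also have "\<dots> = (\<Sum>J\<in>Pow I. \<integral>\<^sup>+z. ?g J z \<partial>(\<Pi>\<^sub>M i\<in>I. M))"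
    using g by (intro nn_integral_sum) auto
  also have "\<dots> = (\<Sum>J\<in>Pow I. emeasure M (space M - B) ^ card (I - J) *
      (\<integral>\<^sup>+z. (\<Prod>i\<in>J. indicator B (z i)) * H J z \<partial>(\<Pi>\<^sub>M i\<in>J. M)))"
  proof (rule sum.cong[OF refl])
    fix J assume "J \<in> Pow I"
    then have J: "J \<subseteq> I" "finite J" using I by (auto intro: finite_subset)
    have un: "J \<union> (I - J) = I" using J by auto
    note [measurable] = H[OF J(1)]
    have mJ: "(\<lambda>x. (\<Prod>i\<in>J. indicator B (x i)) * H J x) \<in> borel_measurable (\<Pi>\<^sub>M i\<in>J. M)"
      by (intro borel_measurable_times_ennreal borel_measurable_prod_ennreal H J)
        (auto intro!: measurable_compose[OF measurable_component_singleton])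
    have "(\<integral>\<^sup>+z. ?g J z \<partial>(\<Pi>\<^sub>M i\<in>I. M)) =
      (\<integral>\<^sup>+x. (\<integral>\<^sup>+y. ?g J (merge J (I - J) (x, y)) \<partial>(\<Pi>\<^sub>M i\<in>I - J. M)) \<partial>(\<Pi>\<^sub>M i\<in>J. M))"
      using P.product_nn_integral_fold[of J "I - J" "?g J"] J I g[OF J(1)] unfolding un by auto
    also have "\<dots> = (\<integral>\<^sup>+x. emeasure M (space M - B) ^ card (I - J) * ((\<Prod>i\<in>J. indicator B (x i)) * H J
        x) \<partial>(\<Pi>\<^sub>M i\<in>J. M))"
    proof (rule nn_integral_cong)
      fix x assume "x \<in> space (\<Pi>\<^sub>M i\<in>J. M)"
      have "?g J (merge J (I - J) (x, y)) = ((\<Prod>i\<in>J. indicator B (x i)) * H J x) * (\<Prod>i\<in>I - J.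
          indicator (space M - B) (y i))" for y
      proof -
        have "(\<Prod>i\<in>J. indicator B (merge J (I - J) (x, y) i) :: ennreal) = (\<Prod>i\<in>J. indicator B (x i))"
          by (rule prod.cong) auto
        moreover have "(\<Prod>i\<in>I - J. indicator (space M - B) (merge J (I - J) (x, y) i) :: ennreal) =
            (\<Prod>i\<in>I - J. indicator (space M - B) (y i))"
          by (rule prod.cong) auto
        moreover have "H J (merge J (I - J) (x, y)) = H J x" by (rule cong[OF J(1)]) simp
        ultimately show ?thesis by (simp add: mult_ac)
      qed
      then have "(\<integral>\<^sup>+y. ?g J (merge J (I - J) (x, y)) \<partial>(\<Pi>\<^sub>M i\<in>I - J. M)) =
         ((\<Prod>i\<in>J. indicator B (x i)) * H J x) * (\<integral>\<^sup>+y. (\<Prod>i\<in>I - J. indicator (space M - B) (y i))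
             \<partial>(\<Pi>\<^sub>M i\<in>I - J. M))"
        by (simp only:) (intro nn_integral_cmult borel_measurable_prod_ennreal, auto intro!:
            measurable_compose[OF measurable_component_singleton])
      also have "(\<integral>\<^sup>+y. (\<Prod>i\<in>I - J. indicator (space M - B) (y i)) \<partial>(\<Pi>\<^sub>M i\<in>I - J. M)) = emeasure M
          (space M - B) ^ card (I - J)"
        using I by (subst P.product_nn_integral_prod) auto
      finally show "(\<integral>\<^sup>+y. ?g J (merge J (I - J) (x, y)) \<partial>(\<Pi>\<^sub>M i\<in>I - J. M)) =
         emeasure M (space M - B) ^ card (I - J) * ((\<Prod>i\<in>J. indicator B (x i)) * H J x)"
        by (simp add: mult.commute)
    qed
    also have "\<dots> = emeasure M (space M - B) ^ card (I - J) *
      (\<integral>\<^sup>+z. (\<Prod>i\<in>J. indicator B (z i)) * H J z \<partial>(\<Pi>\<^sub>M i\<in>J. M))"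
      by (rule nn_integral_cmult[OF mJ])
    finally show "(\<integral>\<^sup>+z. ?g J z \<partial>(\<Pi>\<^sub>M i\<in>I. M)) = emeasure M (space M - B) ^ card (I - J) *
      (\<integral>\<^sup>+z. (\<Prod>i\<in>J. indicator B (z i)) * H J z \<partial>(\<Pi>\<^sub>M i\<in>J. M))" .
  qed
  finally show ?thesis .
qed

text \<open>If M restricted to B is c times the image of N under g, the same holds for finite
  powers, one coordinate at a time. In the application B is a small window, N the uniform law on a
  window of fixed size and g the rescaling map.\<close>

lemma nn_integral_PiM_change_of_variables:
  fixes F :: "('i \<Rightarrow> 'a) \<Rightarrow> ennreal"
  assumes M: "prob_space M" and N: "prob_space N" and g [measurable]: "g \<in> N \<rightarrow>\<^sub>M M"
    and B [measurable]: "B \<in> sets M"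
    and one: "\<And>f. f \<in> borel_measurable M \<Longrightarrow> (\<integral>\<^sup>+x. indicator B x * f x \<partial>M) = c * (\<integral>\<^sup>+x. f (g x) \<partial>N)"
    and J: "finite J" and F: "F \<in> borel_measurable (\<Pi>\<^sub>M i\<in>J. M)"
  shows "(\<integral>\<^sup>+z. (\<Prod>i\<in>J. indicator B (z i)) * F z \<partial>(\<Pi>\<^sub>M i\<in>J. M)) =
    c ^ card J * (\<integral>\<^sup>+z. F (\<lambda>i\<in>J. g (z i)) \<partial>(\<Pi>\<^sub>M i\<in>J. N))"
  using J F
proof (induction J arbitrary: F)
  case empty
  show ?case by (simp add: PiM_empty nn_integral_count_space_finite restrict_def)
next
  case (insert i J)
  interpret M: prob_space M by fact
  interpret N: prob_space N by fact
  interpret PM: product_sigma_finite "\<lambda>_::'i. M" by standard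
  interpret PN: product_sigma_finite "\<lambda>_::'i. N" by standard
  note F [measurable] = insert.prems
  have upd [measurable]: "(\<lambda>w. (snd w)(i := fst w)) \<in> M \<Otimes>\<^sub>M (\<Pi>\<^sub>M i\<in>J. M) \<rightarrow>\<^sub>M (\<Pi>\<^sub>M i\<in>insert i J. M)"
    using measurable_compose[OF measurable_Pair[OF measurable_snd measurable_fst]
        measurable_add_dim[of i J "\<lambda>_. M"]]
    by (simp add: case_prod_beta)
  have Fx: "(\<lambda>z. F (z(i := x))) \<in> borel_measurable (\<Pi>\<^sub>M i\<in>J. M)" if "x \<in> space M" for x
    using measurable_compose[OF measurable_Pair1'[OF that] measurable_compose[OF upd F]] by (simp
        only: fst_conv snd_conv)
  have resM: "(\<lambda>z. \<lambda>i\<in>J. g (z i)) \<in> (\<Pi>\<^sub>M i\<in>J. N) \<rightarrow>\<^sub>M (\<Pi>\<^sub>M i\<in>J. M)" for J :: "'i set"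
    by (intro measurable_restrict measurable_compose[OF _ g] measurable_component_singleton)
  have "(\<integral>\<^sup>+z. (\<Prod>i\<in>insert i J. indicator B (z i)) * F z \<partial>(\<Pi>\<^sub>M i\<in>insert i J. M)) =
    (\<integral>\<^sup>+x. (\<integral>\<^sup>+z. (\<Prod>k\<in>insert i J. indicator B ((z(i := x)) k)) * F (z(i := x)) \<partial>(\<Pi>\<^sub>M i\<in>J. M)) \<partial>M)"
    using insert.hyps by (intro PM.product_nn_integral_insert_rev borel_measurable_times_ennreal
        borel_measurable_prod_ennreal F)
       (auto intro!: measurable_compose[OF measurable_component_singleton])
  also have "\<dots> = (\<integral>\<^sup>+x. indicator B x * (c ^ card J * (\<integral>\<^sup>+z. F ((\<lambda>k\<in>J. g (z k))(i := x)) \<partial>(\<Pi>\<^sub>M i\<in>J.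
      N))) \<partial>M)"
  proof (rule nn_integral_cong)
    fix x assume x: "x \<in> space M"
    have "(\<Prod>k\<in>insert i J. indicator B ((z(i := x)) k)) * F (z(i := x)) =
       indicator B x * ((\<Prod>k\<in>J. indicator B (z k)) * F (z(i := x)))" for z
    proof -
      have "(\<Prod>k\<in>J. indicator B ((z(i := x)) k) :: ennreal) = (\<Prod>k\<in>J. indicator B (z k))"
        using insert.hyps by (intro prod.cong) auto
      then show ?thesis using insert.hyps by (simp add: mult_ac)
    qed
    then have "(\<integral>\<^sup>+z. (\<Prod>k\<in>insert i J. indicator B ((z(i := x)) k)) * F (z(i := x)) \<partial>(\<Pi>\<^sub>M i\<in>J. M)) =
       (\<integral>\<^sup>+z. indicator B x * ((\<Prod>k\<in>J. indicator B (z k)) * F (z(i := x))) \<partial>(\<Pi>\<^sub>M i\<in>J. M))"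
      by (simp only:)
    also have "\<dots> = indicator B x * (\<integral>\<^sup>+z. (\<Prod>k\<in>J. indicator B (z k)) * F (z(i := x)) \<partial>(\<Pi>\<^sub>M i\<in>J. M))"
      using Fx[OF x] by (intro nn_integral_cmult borel_measurable_times_ennreal
          borel_measurable_prod_ennreal)
       (auto intro!: measurable_compose[OF measurable_component_singleton])
    also have "(\<integral>\<^sup>+z. (\<Prod>k\<in>J. indicator B (z k)) * F (z(i := x)) \<partial>(\<Pi>\<^sub>M i\<in>J. M)) =
       c ^ card J * (\<integral>\<^sup>+z. F ((\<lambda>k\<in>J. g (z k))(i := x)) \<partial>(\<Pi>\<^sub>M i\<in>J. N))"
      by (rule insert.IH[OF Fx[OF x]])
    finally show "(\<integral>\<^sup>+z. (\<Prod>k\<in>insert i J. indicator B ((z(i := x)) k)) * F (z(i := x)) \<partial>(\<Pi>\<^sub>M i\<in>J. M)) =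
      indicator B x * (c ^ card J * (\<integral>\<^sup>+z. F ((\<lambda>k\<in>J. g (z k))(i := x)) \<partial>(\<Pi>\<^sub>M i\<in>J. N)))" .
  qed
  also have "\<dots> = c * (\<integral>\<^sup>+x. c ^ card J * (\<integral>\<^sup>+z. F ((\<lambda>k\<in>J. g (z k))(i := g x)) \<partial>(\<Pi>\<^sub>M i\<in>J. N)) \<partial>N)"
  proof (rule one)
    interpret PJ: prob_space "\<Pi>\<^sub>M i\<in>J. N" by (rule prob_space_PiM) (rule N)
    have "(\<lambda>(x, z). F ((\<lambda>k\<in>J. g (z k))(i := x))) \<in> borel_measurable (M \<Otimes>\<^sub>M (\<Pi>\<^sub>M i\<in>J. N))"
      using measurable_compose[OF measurable_compose[OF measurable_Pair[OF measurable_fst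
          measurable_compose[OF measurable_snd resM]] upd] F]
      by (simp add: case_prod_beta)
    then show "(\<lambda>x. c ^ card J * (\<integral>\<^sup>+z. F ((\<lambda>k\<in>J. g (z k))(i := x)) \<partial>(\<Pi>\<^sub>M i\<in>J. N))) \<in> borel_measurable M"
      by (intro borel_measurable_times_ennreal PJ.borel_measurable_nn_integral) auto
  qed
  also have "\<dots> = c * (\<integral>\<^sup>+x. c ^ card J * (\<integral>\<^sup>+z. F (\<lambda>k\<in>insert i J. g ((z(i := x)) k)) \<partial>(\<Pi>\<^sub>M i\<in>J. N)) \<partial>N)"
  proof -
    have "(\<lambda>k\<in>J. g (z k))(i := g x) = (\<lambda>k\<in>insert i J. g ((z(i := x)) k))" for x z
      using insert.hyps by (auto simp: fun_eq_iff)
    then show ?thesis by simp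
  qed
  also have "\<dots> = c * (c ^ card J * (\<integral>\<^sup>+x. (\<integral>\<^sup>+z. F (\<lambda>k\<in>insert i J. g ((z(i := x)) k)) \<partial>(\<Pi>\<^sub>M i\<in>J. N))
      \<partial>N))"
  proof (subst nn_integral_cmult)
    interpret PJ: prob_space "\<Pi>\<^sub>M i\<in>J. N" by (rule prob_space_PiM) (rule N)
    have updN: "(\<lambda>w. (snd w)(i := fst w)) \<in> N \<Otimes>\<^sub>M (\<Pi>\<^sub>M i\<in>J. N) \<rightarrow>\<^sub>M (\<Pi>\<^sub>M i\<in>insert i J. N)"
      using measurable_compose[OF measurable_Pair[OF measurable_snd measurable_fst]
          measurable_add_dim[of i J "\<lambda>_. N"]]
      by (simp add: case_prod_beta)
    have "(\<lambda>(x, z). F (\<lambda>k\<in>insert i J. g ((z(i := x)) k))) \<in> borel_measurable (N \<Otimes>\<^sub>M (\<Pi>\<^sub>M i\<in>J. N))"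
      using measurable_compose[OF measurable_compose[OF updN resM] F] by (simp only: split_beta')
    then show "(\<lambda>x. \<integral>\<^sup>+z. F (\<lambda>k\<in>insert i J. g ((z(i := x)) k)) \<partial>(\<Pi>\<^sub>M i\<in>J. N)) \<in> borel_measurable N"
      by (intro PJ.borel_measurable_nn_integral) auto
  qed simp
  also have "(\<integral>\<^sup>+x. (\<integral>\<^sup>+z. F (\<lambda>k\<in>insert i J. g ((z(i := x)) k)) \<partial>(\<Pi>\<^sub>M i\<in>J. N)) \<partial>N) =
     (\<integral>\<^sup>+z. F (\<lambda>k\<in>insert i J. g (z k)) \<partial>(\<Pi>\<^sub>M i\<in>insert i J. N))"
    using insert.hyps by (intro PN.product_nn_integral_insert_rev[symmetric] measurable_compose[OF
        resM F])
  finally show ?case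
    unfolding card_insert_disjoint[OF insert.hyps] power_Suc by (simp only: mult.assoc)
qed

lemma nn_integral_PiM_reindex:
  fixes F :: "('i \<Rightarrow> 'a) \<Rightarrow> ennreal"
  assumes N: "prob_space N" and p: "inj_on p J" and F: "F \<in> borel_measurable (\<Pi>\<^sub>M i\<in>J. N)"
  shows "(\<integral>\<^sup>+z. F (\<lambda>i\<in>J. z (p i)) \<partial>(\<Pi>\<^sub>M i\<in>p ` J. N)) = (\<integral>\<^sup>+z. F z \<partial>(\<Pi>\<^sub>M i\<in>J. N))"
proof -
  have m: "(\<lambda>z. \<lambda>i\<in>J. z (p i)) \<in> (\<Pi>\<^sub>M i\<in>p ` J. N) \<rightarrow>\<^sub>M (\<Pi>\<^sub>M i\<in>J. N)"
    by (intro measurable_restrict measurable_component_singleton) auto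
  have "(\<Pi>\<^sub>M i\<in>J. N) = distr (\<Pi>\<^sub>M i\<in>p ` J. N) (\<Pi>\<^sub>M i\<in>J. N) (\<lambda>z. \<lambda>i\<in>J. z (p i))"
    using distr_PiM_reindex[of "p ` J" "\<lambda>_. N" p J] N p by auto
  then have "(\<integral>\<^sup>+z. F z \<partial>(\<Pi>\<^sub>M i\<in>J. N)) = (\<integral>\<^sup>+z. F z \<partial>distr (\<Pi>\<^sub>M i\<in>p ` J. N) (\<Pi>\<^sub>M i\<in>J. N) (\<lambda>z. \<lambda>i\<in>J.
      z (p i)))"
    by simp
  also have "\<dots> = (\<integral>\<^sup>+z. F (\<lambda>i\<in>J. z (p i)) \<partial>(\<Pi>\<^sub>M i\<in>p ` J. N))"
    by (subst nn_integral_distr[OF m]) (simp_all add: F)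
  finally show ?thesis ..
qed

section \<open>Counting components by cells\<close>

lemma nn_integral_PiM_injection:
  assumes M: "prob_space M" and fin: "finite I" "finite S" and \<phi>: "inj_on \<phi> S" "\<phi> ` S \<subseteq> I"
    and B [measurable]: "B \<in> sets M" and f [measurable]: "f \<in> borel_measurable M"
  shows "(\<integral>\<^sup>+z. (\<Prod>i\<in>S. indicator B (z (\<phi> i))) * (\<Prod>l\<in>I - \<phi> ` S. f (z l)) \<partial>(\<Pi>\<^sub>M l\<in>I. M)) =
    emeasure M B ^ card S * (\<integral>\<^sup>+x. f x \<partial>M) ^ (card I - card S)"
proof -
  interpret prob_space M by fact
  interpret P: product_sigma_finite "\<lambda>_. M" by standard
  let ?h = "\<lambda>l x. if l \<in> \<phi> ` S then indicator B x else f x"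
  have split: "(\<Prod>l\<in>I. if l \<in> \<phi> ` S then a l else b l) = (\<Prod>i\<in>S. a (\<phi> i)) * (\<Prod>l\<in>I - \<phi> ` S. b l)"
    for a b :: "_ \<Rightarrow> ennreal"
  proof -
    have "(\<Prod>l\<in>I. if l \<in> \<phi> ` S then a l else b l) = prod a (I \<inter> \<phi> ` S) * prod b (I \<inter> - \<phi> ` S)"
      using fin by (simp add: prod.If_cases)
    also have "I \<inter> \<phi> ` S = \<phi> ` S" using \<phi> by blast
    also have "I \<inter> - \<phi> ` S = I - \<phi> ` S" by blast
    finally show ?thesis using \<phi> by (simp add: prod.reindex)
  qed
  have "(\<integral>\<^sup>+z. (\<Prod>i\<in>S. indicator B (z (\<phi> i))) * (\<Prod>l\<in>I - \<phi> ` S. f (z l)) \<partial>(\<Pi>\<^sub>M l\<in>I. M)) =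
     (\<integral>\<^sup>+z. (\<Prod>l\<in>I. ?h l (z l)) \<partial>(\<Pi>\<^sub>M l\<in>I. M))"
    by (simp only: split)
  also have "\<dots> = (\<Prod>l\<in>I. \<integral>\<^sup>+x. ?h l x \<partial>M)"
    using fin by (intro P.product_nn_integral_prod) auto
  also have "\<dots> = (\<Prod>l\<in>I. if l \<in> \<phi> ` S then emeasure M B else \<integral>\<^sup>+x. f x \<partial>M)"
    by (intro prod.cong) auto
  also have "\<dots> = emeasure M B ^ card S * (\<integral>\<^sup>+x. f x \<partial>M) ^ card (I - \<phi> ` S)"
    unfolding split by simp
  also have "card (I - \<phi> ` S) = card I - card S"
    using fin \<phi> by (simp add: card_Diff_subset card_image)
  finally show ?thesis .
qed

text \<open>Injectivity makes the chosen points independent. The weight f of the remaining points is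
  1 for expected counts, and the indicator of missing a colored cell when that cell is required not
  to be full.\<close>

lemma nn_integral_sum_injections:
  assumes M: "prob_space M" and fin: "finite I" "finite S"
    and B [measurable]: "B \<in> sets M" and f [measurable]: "f \<in> borel_measurable M"
  shows "(\<integral>\<^sup>+z. (\<Sum>\<phi> | \<phi> \<in> S \<rightarrow>\<^sub>E I \<and> inj_on \<phi> S.
      (\<Prod>i\<in>S. indicator B (z (\<phi> i))) * (\<Prod>l\<in>I - \<phi> ` S. f (z l))) \<partial>(\<Pi>\<^sub>M l\<in>I. M)) \<le>
    (of_nat (card I) * emeasure M B) ^ card S * (\<integral>\<^sup>+x. f x \<partial>M) ^ (card I - card S)"
proof -
  let ?A = "{\<phi>. \<phi> \<in> S \<rightarrow>\<^sub>E I \<and> inj_on \<phi> S}"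
  have finPiE: "finite (S \<rightarrow>\<^sub>E I)" using fin by (simp add: finite_PiE)
  have meas: "(\<lambda>z. (\<Prod>i\<in>S. indicator B (z (\<phi> i))) * (\<Prod>l\<in>I - \<phi> ` S. f (z l))) \<in> borel_measurable (\<Pi>\<^sub>M
      l\<in>I. M)"
    if "\<phi> \<in> ?A" for \<phi>
  proof (intro borel_measurable_times_ennreal borel_measurable_prod_ennreal)
    fix i assume "i \<in> S"
    then have "\<phi> i \<in> I" using that by auto
    then have "(\<lambda>z. z (\<phi> i)) \<in> (\<Pi>\<^sub>M l\<in>I. M) \<rightarrow>\<^sub>M M" by (rule measurable_component_singleton)
    then show "(\<lambda>z. indicator B (z (\<phi> i)) :: ennreal) \<in> borel_measurable (\<Pi>\<^sub>M l\<in>I. M)"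
      by (rule measurable_compose) simp
  next
    fix l assume "l \<in> I - \<phi> ` S"
    then have "(\<lambda>z. z l) \<in> (\<Pi>\<^sub>M l\<in>I. M) \<rightarrow>\<^sub>M M" by (intro measurable_component_singleton) auto
    then show "(\<lambda>z. f (z l)) \<in> borel_measurable (\<Pi>\<^sub>M l\<in>I. M)" by (rule measurable_compose) simp
  qed
  have "(\<integral>\<^sup>+z. (\<Sum>\<phi>\<in>?A. (\<Prod>i\<in>S. indicator B (z (\<phi> i))) * (\<Prod>l\<in>I - \<phi> ` S. f (z l))) \<partial>(\<Pi>\<^sub>M l\<in>I. M)) =
     (\<Sum>\<phi>\<in>?A. emeasure M B ^ card S * (\<integral>\<^sup>+x. f x \<partial>M) ^ (card I - card S))"
  proof (subst nn_integral_sum)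
    show "(\<Sum>\<phi>\<in>?A. \<integral>\<^sup>+z. (\<Prod>i\<in>S. indicator B (z (\<phi> i))) * (\<Prod>l\<in>I - \<phi> ` S. f (z l)) \<partial>(\<Pi>\<^sub>M l\<in>I. M)) =
       (\<Sum>\<phi>\<in>?A. emeasure M B ^ card S * (\<integral>\<^sup>+x. f x \<partial>M) ^ (card I - card S))"
      by (intro sum.cong refl nn_integral_PiM_injection M fin B f) auto
  qed (rule meas)
  also have "\<dots> = of_nat (card ?A) * (emeasure M B ^ card S * (\<integral>\<^sup>+x. f x \<partial>M) ^ (card I - card S))"
    by simp
  also have "\<dots> \<le> of_nat (card I ^ card S) * (emeasure M B ^ card S * (\<integral>\<^sup>+x. f x \<partial>M) ^ (card I - card S))"
  proof (intro mult_right_mono of_nat_mono)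
    have "card ?A \<le> card (S \<rightarrow>\<^sub>E I)" using finPiE by (intro card_mono) auto
    then show "card ?A \<le> card I ^ card S" using fin by (simp add: card_PiE)
  qed simp
  finally show ?thesis by (simp add: power_mult_distrib mult_ac)
qed

lemma card_eq_sum_prod_indicator:
  assumes "finite I" "finite S"
  shows "of_nat (card {\<phi> \<in> S \<rightarrow>\<^sub>E I. inj_on \<phi> S \<and> (\<forall>i\<in>S. z (\<phi> i) \<in> B)}) =
    (\<Sum>\<phi> | \<phi> \<in> S \<rightarrow>\<^sub>E I \<and> inj_on \<phi> S. \<Prod>i\<in>S. indicator B (z (\<phi> i)) :: ennreal)"
proof -
  let ?A = "{\<phi>. \<phi> \<in> S \<rightarrow>\<^sub>E I \<and> inj_on \<phi> S}"
  have fin: "finite ?A" by (rule finite_subset[of _ "S \<rightarrow>\<^sub>E I"]) (use assms in \<open>auto simp: finite_PiE\<close>)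
  have "(\<Prod>i\<in>S. indicator B (z (\<phi> i)) :: ennreal) = (if \<forall>i\<in>S. z (\<phi> i) \<in> B then 1 else 0)" for \<phi>
  proof (cases "\<forall>i\<in>S. z (\<phi> i) \<in> B")
    case False
    then obtain i where "i \<in> S" "z (\<phi> i) \<notin> B" by blast
    then have "(\<Prod>i\<in>S. indicator B (z (\<phi> i)) :: ennreal) = 0"
      using assms(2) by (intro prod_zero bexI[of _ i]) auto
    then show ?thesis using False by simp
  qed simp
  then have "(\<Sum>\<phi>\<in>?A. \<Prod>i\<in>S. indicator B (z (\<phi> i)) :: ennreal) = (\<Sum>\<phi>\<in>?A. if \<forall>i\<in>S. z (\<phi> i) \<in> B then 1
      else 0)"
    by simp
  also have "\<dots> = of_nat (card {\<phi>\<in>?A. \<forall>i\<in>S. z (\<phi> i) \<in> B})"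
    using fin by (simp add: sum.If_cases Int_def)
  also have "{\<phi>\<in>?A. \<forall>i\<in>S. z (\<phi> i) \<in> B} = {\<phi> \<in> S \<rightarrow>\<^sub>E I. inj_on \<phi> S \<and> (\<forall>i\<in>S. z (\<phi> i) \<in> B)}" by auto
  finally show ?thesis by simp
qed

section \<open>Colored points in the unit square\<close>

abbreviation unit_sample :: "nat \<Rightarrow> ((real^2) \<times> nat) measure" where
  "unit_sample s \<equiv> marked_uniform s (cbox 0 1)"

abbreviation sample :: "nat \<Rightarrow> nat set \<Rightarrow> config measure" where
  "sample s I \<equiv> (\<Pi>\<^sub>M l\<in>I. unit_sample s)"

lemma emeasure_unit_square: "emeasure lborel (cbox (0 :: real^2) 1) = 1"
  by (subst emeasure_cbox_vec2) auto

lemma prob_space_unit_sample: "prob_space (unit_sample s)"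
  by (rule prob_space_marked_uniform) simp

lemma emeasure_marked_uniform_Times:
  assumes "emeasure lborel B \<noteq> 0" "emeasure lborel B \<noteq> \<infinity>" "A \<in> sets borel"
  shows "emeasure (marked_uniform s B) (A \<times> C) =
    emeasure lborel (B \<inter> A) / emeasure lborel B * emeasure (measure_pmf (pmf_of_set {..s})) C"
proof (cases "B \<in> sets borel")
  case True
  show ?thesis
    unfolding marked_uniform_def using assms True
    by (subst measure_pmf.emeasure_pair_measure_Times) auto
next
  case False
  then show ?thesis using assms emeasure_notin_sets[of B lborel] by simp
qed

lemma emeasure_pmf_of_set_single:
  "c \<le> s \<Longrightarrow> emeasure (measure_pmf (pmf_of_set {..s})) {c} = ennreal (1 / real (Suc s))"
  by (simp add: emeasure_pmf_single pmf_of_set)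

lemma emeasure_unit_sample_le:
  fixes a b :: "real^2"
  assumes "\<And>i. a $ i \<le> b $ i"
  shows "emeasure (unit_sample s) (cbox a b \<times> C) \<le> ennreal ((b $ 1 - a $ 1) * (b $ 2 - a $ 2))"
proof -
  have "emeasure (unit_sample s) (cbox a b \<times> C) = emeasure lborel (cbox 0 1 \<inter> cbox a b) * emeasure
      (measure_pmf (pmf_of_set {..s})) C"
    by (subst emeasure_marked_uniform_Times) (auto simp: emeasure_unit_square divide_ennreal_def)
  also have "\<dots> \<le> emeasure lborel (cbox a b) * 1"
    by (intro mult_mono emeasure_mono measure_pmf.emeasure_le_1) auto
  finally show ?thesis using assms by (simp add: emeasure_cbox_vec2)
qed

lemma AE_unit_sample: "AE w in unit_sample s. fst w \<in> cbox 0 1"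
proof -
  interpret prob_space "unit_sample s" by (rule prob_space_unit_sample)
  have "emeasure (unit_sample s) (cbox 0 1 \<times> UNIV) = 1"
    by (subst emeasure_marked_uniform_Times) (auto simp: emeasure_unit_square)
  moreover have "cbox (0::real^2) 1 \<times> (UNIV :: nat set) \<in> sets (unit_sample s)" by measurable
  ultimately have "AE w in unit_sample s. w \<in> cbox 0 1 \<times> UNIV"
    by (subst prob_eq_1[symmetric]) (auto simp: emeasure_eq_measure)
  then show ?thesis by (rule AE_mp) auto
qed

lemma AE_PiM_unit_sample:
  assumes "finite I"
  shows "AE z in (sample s I). \<forall>l\<in>I. fst (z l) \<in> cbox 0 1"
  using assms by (intro AE_finite_allI AE_PiM_component prob_space_unit_sample AE_unit_sample)

text \<open>A closed cell of the m by m grid, widened by e on all sides: for e = 0 the cell in which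
  an enclosing circle is centered, for e = t / 2 the region that then holds the points of the
  simplex.\<close>

definition cell :: "nat \<Rightarrow> nat \<times> nat \<Rightarrow> real \<Rightarrow> (real^2) set" where
  "cell m q e = cbox (vector [real (fst q) / real m - e, real (snd q) / real m - e])
     (vector [(real (fst q) + 1) / real m + e, (real (snd q) + 1) / real m + e])"

lemma mem_cbox_vec2: "(x :: real^2) \<in> cbox a b \<longleftrightarrow> a $ 1 \<le> x $ 1 \<and> x $ 1 \<le> b $ 1 \<and> a $ 2 \<le> x $ 2 \<and> x $
    2 \<le> b $ 2"
  by (auto simp: mem_box_cart forall_2)

lemma dist_vec2: "dist (x :: real^2) y = sqrt ((x $ 1 - y $ 1)\<^sup>2 + (x $ 2 - y $ 2)\<^sup>2)"
  by (simp add: dist_vec_def L2_set_def UNIV_2 dist_real_def)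

lemma mem_cell_iff: "(x :: real^2) \<in> cell m q e \<longleftrightarrow>
    real (fst q) / real m - e \<le> x $ 1 \<and> x $ 1 \<le> (real (fst q) + 1) / real m + e \<and>
    real (snd q) / real m - e \<le> x $ 2 \<and> x $ 2 \<le> (real (snd q) + 1) / real m + e"
  by (auto simp: cell_def mem_cbox_vec2)

lemma exists_cell_coordinate:
  assumes "0 < m" "0 \<le> x" "x \<le> (1::real)"
  shows "\<exists>a<m. real a / real m \<le> x \<and> x \<le> (real a + 1) / real m"
proof (cases "x = 1")
  \<comment> \<open>At the right end the rounded index would be m, outside the grid; the last cell
    contains the point.\<close>
  case True
  then show ?thesis using assms by (intro exI[of _ "m - 1"]) (auto simp: of_nat_diff)
next
  case False
  define a where "a = nat \<lfloor>x * real m\<rfloor>"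
  have a: "real a \<le> x * real m" "x * real m < real a + 1"
    using assms by (auto simp: a_def of_nat_nat)
  have "x * real m < 1 * real m" using assms False by (intro mult_strict_right_mono) auto
  then have "a < m" using a by linarith
  then show ?thesis using a assms by (intro exI[of _ a]) (auto simp: field_simps)
qed

lemma exists_cell:
  assumes "0 < m" "x \<in> cbox (0::real^2) 1"
  shows "\<exists>q\<in>{..<m} \<times> {..<m}. x \<in> cell m q 0"
proof -
  obtain a b where "a < m" "real a / real m \<le> x $ 1" "x $ 1 \<le> (real a + 1) / real m"
    "b < m" "real b / real m \<le> x $ 2" "x $ 2 \<le> (real b + 1) / real m"
    using exists_cell_coordinate[OF assms(1), of "x $ 1"] exists_cell_coordinate[OF assms(1), of "x
        $ 2"] assms(2)
    by (auto simp: mem_cbox_vec2)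
  then show ?thesis by (intro bexI[of _ "(a, b)"]) (auto simp: mem_cell_iff)
qed

text \<open>3 / 2 is a rational bound for sqrt 2. Together with 3 / m <= t it puts all points of a
  cell within t / 2 of each other.\<close>

lemma cell_diameter:
  assumes "x \<in> cell m q 0" "y \<in> cell m q 0" "0 < m"
  shows "dist x y \<le> 3 / 2 / real m"
proof -
  have "\<bar>x $ 1 - y $ 1\<bar> \<le> 1 / real m" "\<bar>x $ 2 - y $ 2\<bar> \<le> 1 / real m"
    using assms by (auto simp: mem_cell_iff add_divide_distrib)
  then have "(x $ 1 - y $ 1)\<^sup>2 \<le> (1 / real m)\<^sup>2" "(x $ 2 - y $ 2)\<^sup>2 \<le> (1 / real m)\<^sup>2"
    by (simp_all add: abs_le_square_iff[symmetric])
  then have "(x $ 1 - y $ 1)\<^sup>2 + (x $ 2 - y $ 2)\<^sup>2 \<le> (3 / 2 / real m)\<^sup>2"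
  proof -
    have "(3 / 2 / real m)\<^sup>2 = 9 / 4 * (1 / real m)\<^sup>2" by (simp add: power_divide)
    moreover have "0 \<le> (1 / real m)\<^sup>2" by simp
    ultimately show ?thesis
      using \<open>(x $ 1 - y $ 1)\<^sup>2 \<le> (1 / real m)\<^sup>2\<close> \<open>(x $ 2 - y $ 2)\<^sup>2 \<le> (1 / real m)\<^sup>2\<close> by linarith
  qed
  then show ?thesis unfolding dist_vec2 by (intro real_le_lsqrt) auto
qed

lemma cell_enlarge:
  assumes "c \<in> cell m q 0" "dist c x \<le> e"
  shows "x \<in> cell m q e"
proof -
  have "\<bar>c $ i - x $ i\<bar> \<le> e" for i
    using order_trans[OF dist_vec_nth_le assms(2), of i] by (simp add: dist_real_def)
  from this[of 1] this[of 2] show ?thesis using assms(1) by (auto simp: mem_cell_iff)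
qed

text \<open>The enclosing circle can be centered inside the unit square, because projecting its center
  to the square does not increase the distances to points of the square.\<close>

lemma exists_center_in_square:
  assumes "finite X" "X \<noteq> {}" "X \<subseteq> cbox (0::real^2) 1" "sec_diameter X \<le> t"
  shows "\<exists>c\<in>cbox 0 1. X \<subseteq> cball c (t / 2)"
proof -
  have "0 \<le> t" using sec_diameter_nonneg[OF assms(1)] assms(4) by linarith
  then obtain c where c: "X \<subseteq> cball c (t / 2)" using sec_diameter_le_iff[of X t] assms by blast
  let ?S = "cbox (0::real^2) 1"
  have ne: "?S \<noteq> {}" using assms by blast
  have "dist (closest_point ?S c) x \<le> t / 2" if "x \<in> X" for x
  proof -
    have "dist (closest_point ?S c) (closest_point ?S x) \<le> dist c x"
      by (rule closest_point_lipschitz[OF convex_box(1) closed_cbox ne])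
    moreover have "closest_point ?S x = x" using assms that by (intro closest_point_self) auto
    ultimately show ?thesis using c that by fastforce
  qed
  then show ?thesis using closest_point_in_set[OF closed_cbox ne, of c]
    by (intro bexI[of _ "closest_point ?S c"]) auto
qed

text \<open>With B the cell widened by t / 2, a superset of the nodes centered in the cell. Colors
  are dropped to simplify expectations; injectivity, which colorful tuples always have, is kept so
  that the points of a tuple are independent.\<close>

definition near_simplices :: "nat \<Rightarrow> nat set \<Rightarrow> config \<Rightarrow> (real^2) set \<Rightarrow> (nat \<Rightarrow> nat) set" where
  "near_simplices s I z B = {\<phi> \<in> {..s} \<rightarrow>\<^sub>E I. inj_on \<phi> {..s} \<and> (\<forall>i\<in>{..s}. z (\<phi> i) \<in> B \<times> UNIV)}"

definition full_cell :: "nat \<Rightarrow> nat set \<Rightarrow> config \<Rightarrow> (real^2) set \<Rightarrow> bool" where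
  "full_cell s I z Q \<longleftrightarrow> (\<forall>i\<le>s. \<exists>l\<in>I. z l \<in> Q \<times> {i})"

lemma finite_near_simplices: "finite I \<Longrightarrow> finite (near_simplices s I z B)"
  unfolding near_simplices_def by (rule finite_subset[of _ "{..s} \<rightarrow>\<^sub>E I"]) (auto simp: finite_PiE)

lemma inj_on_simplex_indices: "\<phi> \<in> simplex_indices s I z \<Longrightarrow> inj_on \<phi> {..s}"
  by (auto simp: simplex_indices_def inj_on_def) metis

lemma node_cell:
  assumes "\<phi> \<in> Domain (lune_graph s I z t)" and pts: "\<And>l. l \<in> I \<Longrightarrow> fst (z l) \<in> cbox 0 1" and m: "0 < m"
  shows "\<exists>q\<in>{..<m} \<times> {..<m}. \<exists>c\<in>cell m q 0. simplex_points s z \<phi> \<subseteq> cball c (t / 2)"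
proof -
  have "\<phi> \<in> {..s} \<rightarrow>\<^sub>E I" "sec_diameter (simplex_points s z \<phi>) \<le> t"
    using assms(1) by (auto simp: Domain_lune_graph simplex_indices_def)
  moreover from this have "simplex_points s z \<phi> \<subseteq> cbox 0 1"
    using pts by (auto simp: simplex_points_def PiE_iff)
  ultimately obtain c where "c \<in> cbox 0 1" "simplex_points s z \<phi> \<subseteq> cball c (t / 2)"
    using exists_center_in_square[of "simplex_points s z \<phi>" t] by auto
  then show ?thesis using exists_cell[OF m, of c] by blast
qed

lemma node_near_cell:
  assumes "\<phi> \<in> Domain (lune_graph s I z t)" "c \<in> cell m q 0" "simplex_points s z \<phi> \<subseteq> cball c (t / 2)"
  shows "\<phi> \<in> near_simplices s I z (cell m q (t / 2))"
proof -
  have \<phi>: "\<phi> \<in> simplex_indices s I z" using assms(1) by (auto simp: Domain_lune_graph)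
  have "z (\<phi> i) \<in> cell m q (t / 2) \<times> UNIV" if "i \<in> {..s}" for i
    using cell_enlarge[OF assms(2), of "fst (z (\<phi> i))" "t / 2"] assms(3) that
    by (cases "z (\<phi> i)") (force simp: simplex_points_def)
  then show ?thesis
    using \<phi> inj_on_simplex_indices[OF \<phi>] by (auto simp: near_simplices_def simplex_indices_def)
qed

lemma card_Domain_le:
  assumes fin: "finite I" and pts: "\<And>l. l \<in> I \<Longrightarrow> fst (z l) \<in> cbox 0 1" and m: "0 < m"
  shows "card (Domain (lune_graph s I z t)) \<le> (\<Sum>q\<in>{..<m} \<times> {..<m}. card (near_simplices s I z (cell
      m q (t / 2))))"
proof -
  have "Domain (lune_graph s I z t) \<subseteq> (\<Union>q\<in>{..<m} \<times> {..<m}. near_simplices s I z (cell m q (t / 2)))"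
  proof
    fix \<phi> assume a: "\<phi> \<in> Domain (lune_graph s I z t)"
    have "\<exists>q\<in>{..<m} \<times> {..<m}. \<exists>c\<in>cell m q 0. simplex_points s z \<phi> \<subseteq> cball c (t / 2)"
      by (rule node_cell[OF a pts m])
    then show "\<phi> \<in> (\<Union>q\<in>{..<m} \<times> {..<m}. near_simplices s I z (cell m q (t / 2)))"
      using node_near_cell[OF a] by blast
  qed
  then have "card (Domain (lune_graph s I z t)) \<le> card (\<Union>q\<in>{..<m} \<times> {..<m}. near_simplices s I z
      (cell m q (t / 2)))"
    using finite_near_simplices[OF fin] by (intro card_mono) auto
  also have "\<dots> \<le> (\<Sum>q\<in>{..<m} \<times> {..<m}. card (near_simplices s I z (cell m q (t / 2))))"
    by (rule card_UN_le) simp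
  finally show ?thesis .
qed

text \<open>All simplices whose lunes meet a fixed full cell lie in one component, since the cell is
  contained in the lune of a simplex with all its points in the cell.\<close>

lemma num_components_le_cells:
  assumes fin: "finite I" and pts: "\<And>l. l \<in> I \<Longrightarrow> fst (z l) \<in> cbox 0 1"
    and m: "0 < m" "3 / real m \<le> t"
  shows "num_components (lune_graph s I z t) \<le>
    (\<Sum>q\<in>{..<m} \<times> {..<m}. 1 + (if full_cell s I z (cell m q 0) then 0 else card (near_simplices s I z
        (cell m q (t / 2)))))"
proof -
  let ?r = "lune_graph s I z t" and ?QQ = "{..<m} \<times> {..<m}"
  \<comment> \<open>A node is listed under every cell that contains a center of an enclosing disk of
    radius t / 2; the lists cover the nodes and may overlap, so a union bound follows.\<close>
  let ?P = "\<lambda>q. {\<phi> \<in> Domain ?r. \<exists>c\<in>cell m q 0. simplex_points s z \<phi> \<subseteq> cball c (t / 2)}"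
  have finD: "finite (Domain ?r)" by (rule finite_Domain_lune_graph[OF fin])
  have "Domain ?r \<subseteq> (\<Union>q\<in>?QQ. ?P q)"
  proof
    fix \<phi> assume a: "\<phi> \<in> Domain ?r"
    have "\<exists>q\<in>?QQ. \<exists>c\<in>cell m q 0. simplex_points s z \<phi> \<subseteq> cball c (t / 2)"
      by (rule node_cell[OF a pts m(1)])
    then show "\<phi> \<in> (\<Union>q\<in>?QQ. ?P q)" using a by blast
  qed
  then have "rel_components (Domain ?r) ?r \<subseteq> rel_components (\<Union>q\<in>?QQ. ?P q) ?r"
    unfolding rel_components_def by (rule image_mono)
  then have "rel_components (Domain ?r) ?r \<subseteq> (\<Union>q\<in>?QQ. rel_components (?P q) ?r)"
    unfolding rel_components_def image_UN .
  then have "num_components ?r \<le> card (\<Union>q\<in>?QQ. rel_components (?P q) ?r)"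
    using finD by (intro card_mono) (auto simp: rel_components_def)
  also have "\<dots> \<le> (\<Sum>q\<in>?QQ. card (rel_components (?P q) ?r))"
    by (rule card_UN_le) simp
  also have "\<dots> \<le> (\<Sum>q\<in>?QQ. 1 + (if full_cell s I z (cell m q 0) then 0 else card (near_simplices s I
      z (cell m q (t / 2)))))"
  proof (rule sum_mono)
    fix q assume "q \<in> ?QQ"
    show "card (rel_components (?P q) ?r) \<le> 1 + (if full_cell s I z (cell m q 0) then 0 else card
        (near_simplices s I z (cell m q (t / 2))))"
    proof (cases "full_cell s I z (cell m q 0)")
      case True
      then have "\<forall>i\<in>{..s}. \<exists>l. l \<in> I \<and> z l \<in> cell m q 0 \<times> {i}"
        unfolding full_cell_def Bex_def atMost_iff Ball_def .
      then obtain g where g: "\<forall>i\<in>{..s}. g i \<in> I \<and> z (g i) \<in> cell m q 0 \<times> {i}" by metis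
      define \<psi> where "\<psi> = restrict g {..s}"
      have \<psi>: "\<psi> \<in> simplex_indices s I z" using g by (auto simp: \<psi>_def simplex_indices_def mem_Times_iff)
      have \<psi>pts: "simplex_points s z \<psi> \<subseteq> cell m q 0" using g by (auto simp: \<psi>_def simplex_points_def
          mem_Times_iff)
      have t0: "0 \<le> t" using m by (meson divide_nonneg_nonneg of_nat_0_le_iff order_trans
          zero_le_numeral)
      have adj: "(\<phi>, \<psi>) \<in> ?r" if \<phi>P: "\<phi> \<in> ?P q" for \<phi>
      proof -
        \<comment> \<open>The center found for one simplex serves for both: it lies in the cell, and
          every point of the cell is within 3 / (2 m) <= t / 2 of it.\<close>
        obtain c where c: "c \<in> cell m q 0" "simplex_points s z \<phi> \<subseteq> cball c (t / 2)" using \<phi>P by blast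
        have "simplex_points s z \<psi> \<subseteq> cball c (t / 2)"
        proof
          fix x assume "x \<in> simplex_points s z \<psi>"
          then have "dist c x \<le> 3 / 2 / real m" using cell_diameter[OF c(1) _ m(1)] \<psi>pts by blast
          then show "x \<in> cball c (t / 2)" using m(2) by simp
        qed
        then have "sec_diameter (simplex_points s z \<phi> \<union> simplex_points s z \<psi>) \<le> t"
          using c t0 by (subst sec_diameter_le_iff) (auto intro!: exI[of _ c])
        then show ?thesis using \<phi>P \<psi> by (auto simp: lune_graph_def Domain_lune_graph)
      qed
      have "rel_components (?P q) ?r \<subseteq> {?r\<^sup>* `` {\<psi>}}"
      proof -
        have "?r\<^sup>* `` {\<phi>} = ?r\<^sup>* `` {\<psi>}" if "\<phi> \<in> ?P q" for \<phi>
          using adj[OF that] component_eq_iff[of ?r \<phi> \<psi>] tolerance_lune_graph[of s I z t]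
          by (auto simp: tolerance_def)
        then show ?thesis unfolding rel_components_def by blast
      qed
      then have "card (rel_components (?P q) ?r) \<le> card {?r\<^sup>* `` {\<psi>}}" by (intro card_mono) auto
      then show ?thesis by simp
    next
      case False
      have "?P q \<subseteq> near_simplices s I z (cell m q (t / 2))" using node_near_cell by blast
      then have "card (?P q) \<le> card (near_simplices s I z (cell m q (t / 2)))"
        using finite_near_simplices[OF fin] by (intro card_mono)
      moreover have "card (rel_components (?P q) ?r) \<le> card (?P q)"
        unfolding rel_components_def using finD by (intro card_image_le) auto
      ultimately show ?thesis using False by simp
    qed
  qed
  finally show ?thesis .
qed

text \<open>From t = 3 on, the corner 0 is within t / 2 of every point of the square and is a common
  center for any two simplices. This ends the range of thresholds that contribute to the
  cost.\<close>

lemma num_components_le_1: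
  assumes fin: "finite I" and pts: "\<And>l. l \<in> I \<Longrightarrow> fst (z l) \<in> cbox 0 1" and t: "3 \<le> t"
  shows "num_components (lune_graph s I z t) \<le> 1"
proof -
  let ?r = "lune_graph s I z t"
  have c0: "cell 1 (0, 0) 0 = cbox 0 1" by (auto simp: mem_cell_iff mem_cbox_vec2)
  have adj: "(\<phi>, \<psi>) \<in> ?r" if "\<phi> \<in> simplex_indices s I z" "\<psi> \<in> simplex_indices s I z" for \<phi> \<psi>
  proof -
    have "dist 0 x \<le> t / 2" if "x \<in> cbox 0 1" for x :: "real^2"
      using cell_diameter[of 0 1 "(0, 0)" x] that t unfolding c0 by (simp add: mem_cbox_vec2)
    then have "cbox (0 :: real^2) 1 \<subseteq> cball 0 (t / 2)" by auto
    moreover have "simplex_points s z \<phi> \<union> simplex_points s z \<psi> \<subseteq> cbox 0 1"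
      using that pts by (auto simp: simplex_points_def simplex_indices_def PiE_iff)
    ultimately have "sec_diameter (simplex_points s z \<phi> \<union> simplex_points s z \<psi>) \<le> t"
      using t by (subst sec_diameter_le_iff) (auto intro!: exI[of _ 0])
    then show ?thesis using that by (simp add: lune_graph_def)
  qed
  show ?thesis
  proof (cases "Domain ?r = {}")
    case False
    have "(\<phi>, \<psi>) \<in> ?r\<^sup>*" if "\<phi> \<in> Domain ?r" "\<psi> \<in> Domain ?r" for \<phi> \<psi>
      using adj that by (auto simp: Domain_lune_graph)
    then show ?thesis
      using components_connected[OF False] tolerance_lune_graph[of s I z t] by (simp add: tolerance_def)
  qed (simp add: rel_components_def)
qed

section \<open>Domination\<close>

lemma power_le_fact_exp:
  fixes u :: real
  assumes "0 \<le> u"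
  shows "u ^ k \<le> fact k * exp u"
proof -
  have "(\<Sum>n\<in>{k}. inverse (fact n) * u ^ n) \<le> (\<Sum>n. inverse (fact n) * u ^ n)"
    using assms summable_exp[of u] by (intro sum_le_suminf) auto
  then have "inverse (fact k) * u ^ k \<le> exp u" by (simp add: exp_def)
  then show ?thesis by (simp add: field_simps)
qed

lemma nn_integral_near_simplices:
  assumes fin: "finite I" and B: "B \<in> sets borel"
  shows "(\<integral>\<^sup>+z. of_nat (card (near_simplices s I z B)) \<partial>(sample s I)) \<le>
    (of_nat (card I) * emeasure (unit_sample s) (B \<times> UNIV)) ^ Suc s"
proof -
  interpret prob_space "unit_sample s" by (rule prob_space_unit_sample)
  have BM: "B \<times> UNIV \<in> sets (unit_sample s)" using B by measurable
  have "of_nat (card (near_simplices s I z B)) =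
    (\<Sum>\<phi> | \<phi> \<in> {..s} \<rightarrow>\<^sub>E I \<and> inj_on \<phi> {..s}. (\<Prod>i\<in>{..s}. indicator (B \<times> UNIV) (z (\<phi> i))) * (\<Prod>l\<in>I - \<phi> `
        {..s}. 1) :: ennreal)" for z
    unfolding near_simplices_def using card_eq_sum_prod_indicator[OF fin, of "{..s}" z "B \<times> UNIV"]
        by simp
  then show ?thesis
    using nn_integral_sum_injections[OF prob_space_unit_sample fin, of "{..s}" "B \<times> UNIV" s "\<lambda>_. 1"]
        BM emeasure_space_1
    by simp
qed

text \<open>A cell that is not full misses some color i, hence so do the points outside the tuple.
  Forgetting the points of the tuple makes this event independent of where they lie, at the price of
  Suc s in the exponent; the sum over i gives the leading factor.\<close>

lemma nn_integral_near_simplices_not_full: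
  assumes fin: "finite I" and B: "B \<in> sets borel" and Q: "Q \<in> sets borel"
    and le: "\<And>i. i \<le> s \<Longrightarrow> emeasure (unit_sample s) (UNIV - Q \<times> {i}) \<le> e"
  shows "(\<integral>\<^sup>+z. (if full_cell s I z Q then 0 else of_nat (card (near_simplices s I z B))) \<partial>(sample s
      I)) \<le>
    of_nat (Suc s) * ((of_nat (card I) * emeasure (unit_sample s) (B \<times> UNIV)) ^ Suc s * e ^ (card I
        - Suc s))"
proof -
  let ?f = "\<lambda>i w. indicator (UNIV - Q \<times> {i}) w :: ennreal"
  let ?M = "sample s I"
  let ?A = "{\<phi>. \<phi> \<in> {..s} \<rightarrow>\<^sub>E I \<and> inj_on \<phi> {..s}}"
  let ?S = "\<lambda>i z. (\<Sum>\<phi>\<in>?A. (\<Prod>i\<in>{..s}. indicator (B \<times> UNIV) (z (\<phi> i))) * (\<Prod>l\<in>I - \<phi> ` {..s}. ?f i (z l)))"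
  have BM: "B \<times> UNIV \<in> sets (unit_sample s)" using B by measurable
  have QM: "UNIV - Q \<times> {i} \<in> sets (unit_sample s)" for i
  proof -
    have "Q \<times> {i} \<in> sets (unit_sample s)" using Q by measurable
    then show ?thesis using sets.compl_sets[of "Q \<times> {i}" "unit_sample s"] by simp
  qed
  have finA: "finite ?A" by (rule finite_subset[of _ "{..s} \<rightarrow>\<^sub>E I"]) (use fin in \<open>auto simp: finite_PiE\<close>)
  have meas: "?S i \<in> borel_measurable ?M" for i
  proof (intro borel_measurable_sum borel_measurable_times_ennreal borel_measurable_prod_ennreal)
    fix \<phi> k assume "\<phi> \<in> ?A" "k \<in> {..s}"
    then have "\<phi> k \<in> I" by auto
    then have "(\<lambda>z. z (\<phi> k)) \<in> ?M \<rightarrow>\<^sub>M unit_sample s" by (rule measurable_component_singleton)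
    then show "(\<lambda>z. indicator (B \<times> UNIV) (z (\<phi> k)) :: ennreal) \<in> borel_measurable ?M"
      by (rule measurable_compose) (use BM in simp)
  next
    fix \<phi> l assume "l \<in> I - \<phi> ` {..s}"
    then have "(\<lambda>z. z l) \<in> ?M \<rightarrow>\<^sub>M unit_sample s" by (intro measurable_component_singleton) auto
    then show "(\<lambda>z. ?f i (z l)) \<in> borel_measurable ?M" by (rule measurable_compose) (use QM in simp)
  qed
  have "(if full_cell s I z Q then 0 else of_nat (card (near_simplices s I z B))) \<le> (\<Sum>i\<le>s. ?S i z)" for z
  proof (cases "full_cell s I z Q")
    case False
    then obtain i where i: "i \<le> s" "\<forall>l\<in>I. z l \<notin> Q \<times> {i}" by (auto simp: full_cell_def)
    have "of_nat (card (near_simplices s I z B)) = ?S i z"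
    proof -
      have "(\<Prod>l\<in>I - \<phi> ` {..s}. ?f i (z l)) = 1" for \<phi> :: "nat \<Rightarrow> nat"
        using i by (intro prod.neutral) auto
      then show ?thesis unfolding near_simplices_def
        using card_eq_sum_prod_indicator[OF fin, of "{..s}" z "B \<times> UNIV"] by simp
    qed
    also have "\<dots> \<le> (\<Sum>i\<le>s. ?S i z)" using i by (intro member_le_sum) auto
    finally show ?thesis using False by simp
  qed simp
  then have "(\<integral>\<^sup>+z. (if full_cell s I z Q then 0 else of_nat (card (near_simplices s I z B))) \<partial>?M) \<le>
     (\<integral>\<^sup>+z. (\<Sum>i\<le>s. ?S i z) \<partial>?M)" by (rule nn_integral_mono)
  also have "\<dots> = (\<Sum>i\<le>s. \<integral>\<^sup>+z. ?S i z \<partial>?M)"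
    by (rule nn_integral_sum) (rule meas)
  also have "\<dots> \<le> (\<Sum>i\<le>s. (of_nat (card I) * emeasure (unit_sample s) (B \<times> UNIV)) ^ Suc s * e ^ (card
      I - Suc s))"
  proof (rule sum_mono)
    fix i assume "i \<in> {..s}"
    have "(\<integral>\<^sup>+z. ?S i z \<partial>?M) \<le>
      (of_nat (card I) * emeasure (unit_sample s) (B \<times> UNIV)) ^ Suc s * (\<integral>\<^sup>+w. ?f i w \<partial>unit_sample
          s) ^ (card I - Suc s)"
      using nn_integral_sum_injections[OF prob_space_unit_sample fin finite_atMost BM, of "?f i" s]
          QM by simp
    also have "\<dots> \<le> (of_nat (card I) * emeasure (unit_sample s) (B \<times> UNIV)) ^ Suc s * e ^ (card I -
        Suc s)"
      using le[of i] QM \<open>i \<in> {..s}\<close> by (intro mult_left_mono power_mono) auto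
    finally show "(\<integral>\<^sup>+z. ?S i z \<partial>?M) \<le> \<dots>" .
  qed
  finally show ?thesis by simp
qed

lemma cell_borel [measurable]: "cell m q e \<in> sets borel"
  by (simp add: cell_def)

text \<open>The widened cell has side 1 / m + t, and 1 / m <= t / 3, so its side is at most 2
  t.\<close>

lemma emeasure_cell_le:
  assumes "0 < m" "3 / real m \<le> t"
  shows "emeasure (unit_sample s) (cell m q (t / 2) \<times> UNIV) \<le> ennreal (4 * t\<^sup>2)"
proof -
  have t: "1 / real m \<le> t / 3" using assms(2) by (simp add: field_simps)
  moreover have "0 \<le> 1 / real m" by simp
  ultimately have t0: "0 \<le> t" by linarith
  let ?a = "vector [real (fst q) / real m - t / 2, real (snd q) / real m - t / 2] :: real^2"
  let ?b = "vector [(real (fst q) + 1) / real m + t / 2, (real (snd q) + 1) / real m + t / 2] :: real^2"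
  have "?a $ i \<le> ?b $ i" for i
    using exhaust_2[of i] t0 by (auto simp: add_divide_distrib)
  then have "emeasure (unit_sample s) (cell m q (t / 2) \<times> UNIV) \<le> ennreal ((?b $ 1 - ?a $ 1) * (?b $
      2 - ?a $ 2))"
    unfolding cell_def by (rule emeasure_unit_sample_le)
  also have "(?b $ 1 - ?a $ 1) * (?b $ 2 - ?a $ 2) = (1 / real m + t)\<^sup>2"
    by (simp add: add_divide_distrib power2_eq_square)
  also have "\<dots> \<le> (2 * t)\<^sup>2" using t t0 by (intro power_mono) auto
  finally show ?thesis by (simp add: power_mult_distrib ennreal_leI)
qed

lemma emeasure_compl_cell:
  assumes "0 < m" "q \<in> {..<m} \<times> {..<m}" "i \<le> s"
  shows "emeasure (unit_sample s) (UNIV - cell m q 0 \<times> {i}) = ennreal (1 - 1 / (real m ^ 2 * real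
      (Suc s)))"
proof -
  interpret prob_space "unit_sample s" by (rule prob_space_unit_sample)
  have sub: "cell m q 0 \<subseteq> cbox 0 1"
  proof
    fix x assume x: "x \<in> cell m q 0"
    have "0 \<le> real (fst q) / real m" "0 \<le> real (snd q) / real m"
      "(real (fst q) + 1) / real m \<le> 1" "(real (snd q) + 1) / real m \<le> 1"
      using assms by (auto simp: mem_Times_iff divide_le_eq_1)
    then show "x \<in> cbox 0 1" using x unfolding mem_cell_iff mem_cbox_vec2 zero_index one_index by
        linarith
  qed
  have vol: "emeasure lborel (cell m q 0) = ennreal (1 / real m ^ 2)"
  proof -
    have "vector [real (fst q) / real m - 0, real (snd q) / real m - 0] $ i \<le>
      (vector [(real (fst q) + 1) / real m + 0, (real (snd q) + 1) / real m + 0] :: real^2) $ i" for i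
      using exhaust_2[of i] by (auto simp: add_divide_distrib)
    from emeasure_cbox_vec2[OF this] show ?thesis
      unfolding cell_def by (simp add: add_divide_distrib power2_eq_square)
  qed
  have "emeasure (unit_sample s) (cell m q 0 \<times> {i}) = ennreal (1 / real m ^ 2) * ennreal (1 / real
      (Suc s))"
    using sub assms(3)
    by (subst emeasure_marked_uniform_Times)
       (auto simp: emeasure_unit_square divide_ennreal_def emeasure_pmf_of_set_single Int_absorb1 vol)
  also have "\<dots> = ennreal (1 / (real m ^ 2 * real (Suc s)))"
    by (subst ennreal_mult[symmetric]) auto
  finally have e: "emeasure (unit_sample s) (cell m q 0 \<times> {i}) = ennreal (1 / (real m ^ 2 * real
      (Suc s)))" .
  have "cell m q 0 \<times> {i} \<in> sets (unit_sample s)" by measurable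
  then have "emeasure (unit_sample s) (space (unit_sample s) - cell m q 0 \<times> {i}) = 1 - emeasure
      (unit_sample s) (cell m q 0 \<times> {i})"
    using emeasure_space_1 by (subst emeasure_compl) auto
  then show ?thesis unfolding e by (simp add: ennreal_minus flip: ennreal_1)
qed

text \<open>The sample measure lives on the whole plane and its points lie in the unit square only
  almost surely, so the geometric bounds carry over as statements almost everywhere.\<close>

lemma AE_card_Domain_le:
  assumes "0 < m"
  shows "AE z in (sample s {..<n}).
     card (Domain (lune_graph s {..<n} z t)) \<le> (\<Sum>q\<in>{..<m} \<times> {..<m}. card (near_simplices s {..<n} z
         (cell m q (t / 2))))"
  using AE_PiM_unit_sample[OF finite_lessThan]
  by (rule AE_mp) (intro AE_I2 impI card_Domain_le assms, auto)

lemma AE_num_components_le_cells: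
  assumes "0 < m" "3 / real m \<le> t"
  shows "AE z in (sample s {..<n}). num_components (lune_graph s {..<n} z t) \<le>
    (\<Sum>q\<in>{..<m} \<times> {..<m}. 1 + (if full_cell s {..<n} z (cell m q 0) then 0 else card (near_simplices
        s {..<n} z (cell m q (t / 2)))))"
  using AE_PiM_unit_sample[OF finite_lessThan]
  by (rule AE_mp) (intro AE_I2 impI num_components_le_cells assms, auto)

lemma AE_num_components_le_1:
  assumes "3 \<le> t"
  shows "AE z in (sample s {..<n}). num_components (lune_graph s {..<n} z t) \<le> 1"
  using AE_PiM_unit_sample[OF finite_lessThan]
  by (rule AE_mp) (intro AE_I2 impI num_components_le_1 assms, auto)

lemma measurable_card_near_simplices:
  assumes fin: "finite I" and B: "B \<in> sets borel" and Q: "Q \<in> sets borel"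
  shows "(\<lambda>z. of_nat (card (near_simplices s I z B)) :: ennreal) \<in> borel_measurable (sample s I)"
    and "Measurable.pred (sample s I) (\<lambda>z. full_cell s I z Q)"
proof -
  let ?M = "sample s I"
  have comp: "(\<lambda>z. z l) \<in> ?M \<rightarrow>\<^sub>M unit_sample s" if "l \<in> I" for l
    using that by (rule measurable_component_singleton)
  have BM: "B \<times> UNIV \<in> sets (unit_sample s)" using B by measurable
  have QM: "Q \<times> {i} \<in> sets (unit_sample s)" for i using Q by measurable
  have 1: "of_nat (card (near_simplices s I z B)) =
    (\<Sum>\<phi> | \<phi> \<in> {..s} \<rightarrow>\<^sub>E I \<and> inj_on \<phi> {..s}. (\<Prod>i\<in>{..s}. indicator (B \<times> UNIV) (z (\<phi> i))) :: ennreal)" for z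
    unfolding near_simplices_def using card_eq_sum_prod_indicator[OF fin, of "{..s}" z "B \<times> UNIV"]
        by simp
  show "(\<lambda>z. of_nat (card (near_simplices s I z B)) :: ennreal) \<in> borel_measurable ?M"
    unfolding 1
  proof (intro borel_measurable_sum borel_measurable_prod_ennreal)
    fix \<phi> i assume "\<phi> \<in> {\<phi>. \<phi> \<in> {..s} \<rightarrow>\<^sub>E I \<and> inj_on \<phi> {..s}}" "i \<in> {..s}"
    then have "\<phi> i \<in> I" by auto
    then show "(\<lambda>z. indicator (B \<times> UNIV) (z (\<phi> i)) :: ennreal) \<in> borel_measurable ?M"
      using measurable_compose[OF comp, of "\<phi> i" "indicator (B \<times> UNIV)"] BM by simp
  qed
  have "Measurable.pred ?M (\<lambda>z. \<forall>i\<in>{..s}. \<exists>l\<in>I. z l \<in> Q \<times> {i})"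
  proof (intro pred_intros_finite fin)
    fix i l assume "l \<in> I"
    show "Measurable.pred ?M (\<lambda>z. z l \<in> Q \<times> {i})"
      using comp[OF \<open>l \<in> I\<close>] QM by measurable
  qed simp
  then show "Measurable.pred ?M (\<lambda>z. full_cell s I z Q)"
    unfolding full_cell_def Ball_def atMost_iff .
qed

lemma nn_integral_card_Domain_le_cells:
  assumes "0 < m" "3 / real m \<le> t"
  shows "(\<integral>\<^sup>+z. of_nat (card (Domain (lune_graph s {..<n} z t))) \<partial>(sample s {..<n})) \<le>
    ennreal (real m ^ 2 * (4 * real n * t\<^sup>2) ^ Suc s)"
proof -
  let ?M = "sample s {..<n}" and ?QQ = "{..<m} \<times> {..<m}"
  have "(\<integral>\<^sup>+z. of_nat (card (Domain (lune_graph s {..<n} z t))) \<partial>?M) \<le>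
     (\<integral>\<^sup>+z. (\<Sum>q\<in>?QQ. of_nat (card (near_simplices s {..<n} z (cell m q (t / 2))))) \<partial>?M)"
  proof (rule nn_integral_mono_AE)
    show "AE z in ?M. (of_nat (card (Domain (lune_graph s {..<n} z t))) :: ennreal) \<le>
      (\<Sum>q\<in>?QQ. of_nat (card (near_simplices s {..<n} z (cell m q (t / 2)))))"
      using AE_card_Domain_le[OF assms(1), where n = n and s = s and t = t]
    proof eventually_elim
      case (elim z)
      then have "(of_nat (card (Domain (lune_graph s {..<n} z t))) :: ennreal) \<le>
         of_nat (\<Sum>q\<in>?QQ. card (near_simplices s {..<n} z (cell m q (t / 2))))" by (rule of_nat_mono)
      then show ?case by simp
    qed
  qed
  also have "\<dots> = (\<Sum>q\<in>?QQ. \<integral>\<^sup>+z. of_nat (card (near_simplices s {..<n} z (cell m q (t / 2)))) \<partial>?M)"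
    by (intro nn_integral_sum measurable_card_near_simplices) auto
  also have "\<dots> \<le> (\<Sum>q\<in>?QQ. ennreal ((4 * real n * t\<^sup>2) ^ Suc s))"
  proof (rule sum_mono)
    fix q
    have "(\<integral>\<^sup>+z. of_nat (card (near_simplices s {..<n} z (cell m q (t / 2)))) \<partial>?M) \<le>
      (of_nat (card {..<n}) * emeasure (unit_sample s) (cell m q (t / 2) \<times> UNIV)) ^ Suc s"
      by (rule nn_integral_near_simplices) auto
    also have "\<dots> \<le> (of_nat n * ennreal (4 * t\<^sup>2)) ^ Suc s"
      using emeasure_cell_le[OF assms] by (intro power_mono mult_mono) auto
    also have "\<dots> = ennreal ((4 * real n * t\<^sup>2) ^ Suc s)"
      by (simp only: ennreal_of_nat_eq_real_of_nat) (simp only: ennreal_mult[symmetric]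
          ennreal_power zero_le_power2 of_nat_0_le_iff mult_nonneg_nonneg zero_le_numeral mult.assoc
          mult.left_commute)
    finally show "(\<integral>\<^sup>+z. of_nat (card (near_simplices s {..<n} z (cell m q (t / 2)))) \<partial>?M) \<le> \<dots>" .
  qed
  also have "\<dots> = ennreal (real m ^ 2 * (4 * real n * t\<^sup>2) ^ Suc s)"
    by (simp add: ennreal_of_nat_eq_real_of_nat ennreal_mult power2_eq_square flip: ennreal_mult)
  finally show ?thesis .
qed

lemma nn_integral_num_components_le_cells:
  assumes "0 < m" "3 / real m \<le> t"
  shows "(\<integral>\<^sup>+z. of_nat (num_components (lune_graph s {..<n} z t)) \<partial>(sample s {..<n})) \<le>
    ennreal (real m ^ 2 * (1 + real (Suc s) * ((4 * real n * t\<^sup>2) ^ Suc s * (1 - 1 / (real m ^ 2 *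
        real (Suc s))) ^ (n - Suc s))))"
proof -
  let ?M = "sample s {..<n}" and ?QQ = "{..<m} \<times> {..<m}"
  let ?b = "\<lambda>q z. if full_cell s {..<n} z (cell m q 0) then 0 else of_nat (card (near_simplices s
      {..<n} z (cell m q (t / 2)))) :: ennreal"
  let ?x = "1 - 1 / (real m ^ 2 * real (Suc s))"
  have "1 / (real m ^ 2 * real (Suc s)) \<le> 1"
  proof -
    have "1 * 1 \<le> real m ^ 2 * real (Suc s)" using assms(1) by (intro mult_mono) (auto simp: Suc_le_eq)
    then show ?thesis by simp
  qed
  then have x0: "0 \<le> ?x" by simp
  interpret P: prob_space ?M by (intro prob_space_PiM prob_space_unit_sample)
  have meas: "?b q \<in> borel_measurable ?M" for q
    using measurable_card_near_simplices[of "{..<n}" "cell m q (t / 2)" "cell m q 0" s] by simp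
  have "(\<integral>\<^sup>+z. of_nat (num_components (lune_graph s {..<n} z t)) \<partial>?M) \<le>
     (\<integral>\<^sup>+z. (\<Sum>q\<in>?QQ. 1 + ?b q z) \<partial>?M)"
  proof (rule nn_integral_mono_AE)
    show "AE z in ?M. (of_nat (num_components (lune_graph s {..<n} z t)) :: ennreal) \<le> (\<Sum>q\<in>?QQ. 1 +
        ?b q z)"
      using AE_num_components_le_cells[OF assms, where n = n and s = s]
    proof eventually_elim
      case (elim z)
      then have "(of_nat (num_components (lune_graph s {..<n} z t)) :: ennreal) \<le>
         of_nat (\<Sum>q\<in>?QQ. 1 + (if full_cell s {..<n} z (cell m q 0) then 0 else card (near_simplices
             s {..<n} z (cell m q (t / 2)))))"
        by (rule of_nat_mono)
      also have "\<dots> = (\<Sum>q\<in>?QQ. 1 + ?b q z)" unfolding of_nat_sum by (intro sum.cong) auto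
      finally show ?case .
    qed
  qed
  also have "\<dots> = (\<Sum>q\<in>?QQ. \<integral>\<^sup>+z. 1 + ?b q z \<partial>?M)"
    using meas by (intro nn_integral_sum) auto
  also have "\<dots> \<le> (\<Sum>q\<in>?QQ. ennreal (1 + real (Suc s) * ((4 * real n * t\<^sup>2) ^ Suc s * ?x ^ (n - Suc s))))"
  proof (rule sum_mono)
    fix q assume q: "q \<in> ?QQ"
    have "(\<integral>\<^sup>+z. ?b q z \<partial>?M) \<le>
      of_nat (Suc s) * ((of_nat (card {..<n}) * emeasure (unit_sample s) (cell m q (t / 2) \<times> UNIV))
          ^ Suc s * ennreal ?x ^ (card {..<n} - Suc s))"
      using emeasure_compl_cell[OF assms(1) q] by (intro nn_integral_near_simplices_not_full) auto
    also have "\<dots> \<le> of_nat (Suc s) * ((of_nat n * ennreal (4 * t\<^sup>2)) ^ Suc s * ennreal ?x ^ (n - Suc s))"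
      using emeasure_cell_le[OF assms] by (intro mult_left_mono mult_right_mono power_mono
          mult_mono) auto
    also have "\<dots> = ennreal (real (Suc s)) * ((ennreal (real n) * ennreal (4 * t\<^sup>2)) ^ Suc s *
        ennreal ?x ^ (n - Suc s))"
      by (simp only: ennreal_of_nat_eq_real_of_nat)
    also have "\<dots> = ennreal (real (Suc s) * ((real n * (4 * t\<^sup>2)) ^ Suc s * ?x ^ (n - Suc s)))"
      using x0 by (simp only: ennreal_mult[symmetric] ennreal_power zero_le_power2 of_nat_0_le_iff
          mult_nonneg_nonneg zero_le_numeral zero_le_power)
    also have "real n * (4 * t\<^sup>2) = 4 * real n * t\<^sup>2" by simp
    finally have "(\<integral>\<^sup>+z. ?b q z \<partial>?M) \<le> ennreal (real (Suc s) * ((4 * real n * t\<^sup>2) ^ Suc s * ?x ^ (n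
        - Suc s)))" .
    moreover have "(\<integral>\<^sup>+z. 1 + ?b q z \<partial>?M) = 1 + (\<integral>\<^sup>+z. ?b q z \<partial>?M)"
      using meas by (subst nn_integral_add) (auto simp: P.emeasure_space_1)
    ultimately show "(\<integral>\<^sup>+z. 1 + ?b q z \<partial>?M) \<le> ennreal (1 + real (Suc s) * ((4 * real n * t\<^sup>2) ^ Suc
        s * ?x ^ (n - Suc s)))"
      using x0 by (subst ennreal_plus) (auto simp del: of_nat_Suc intro!: add_left_mono
          mult_nonneg_nonneg zero_le_power)
  qed
  also have "\<dots> = of_nat (m * m) * ennreal (1 + real (Suc s) * ((4 * real n * t\<^sup>2) ^ Suc s * ?x ^ (n
      - Suc s)))"
    by (simp only: sum_constant card_cartesian_product card_lessThan)
  also have "\<dots> = ennreal (real m ^ 2 * (1 + real (Suc s) * ((4 * real n * t\<^sup>2) ^ Suc s * ?x ^ (n -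
      Suc s))))"
    using x0 by (simp only: ennreal_of_nat_eq_real_of_nat, subst ennreal_mult)
      (auto simp: power2_eq_square simp del: of_nat_Suc intro!: add_nonneg_nonneg mult_nonneg_nonneg
          zero_le_power)
  finally show ?thesis .
qed

text \<open>Rounding 3 / t up at most doubles it, because 3 / t >= 1. Hence m <= 6 / t, the source
  of the constant 36.\<close>

lemma grid_size:
  assumes "0 < t" "t \<le> (3 :: real)"
  shows "\<exists>m>0. 3 / real m \<le> t \<and> real m ^ 2 \<le> 36 / t\<^sup>2"
proof -
  define m where "m = nat \<lceil>3 / t\<rceil>"
  have m: "3 / t \<le> real m" "real m \<le> 3 / t + 1" using assms by (auto simp: m_def of_nat_ceiling)
  have "1 \<le> 3 / t" using assms by simp
  then have "0 < m" "real m \<le> 6 / t" using m by auto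
  then have "real m ^ 2 \<le> (6 / t) ^ 2" by (intro power_mono) auto
  moreover have "3 / real m \<le> t" using m(1) assms \<open>0 < m\<close> by (simp add: field_simps)
  ultimately show ?thesis using \<open>0 < m\<close> by (intro exI[of _ m]) (simp add: power_divide)
qed

lemma nn_integral_card_Domain_le:
  assumes "0 < t" "t \<le> 3"
  shows "(\<integral>\<^sup>+z. of_nat (card (Domain (lune_graph s {..<n} z t))) \<partial>(sample s {..<n})) \<le>
    ennreal (36 / t\<^sup>2 * (4 * real n * t\<^sup>2) ^ Suc s)"
proof -
  obtain m where m: "0 < m" "3 / real m \<le> t" "real m ^ 2 \<le> 36 / t\<^sup>2" using grid_size[OF assms] by blast
  have "ennreal (real m ^ 2 * (4 * real n * t\<^sup>2) ^ Suc s) \<le> ennreal (36 / t\<^sup>2 * (4 * real n * t\<^sup>2) ^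
      Suc s)"
    using m(3) by (intro ennreal_leI mult_right_mono) auto
  then show ?thesis using nn_integral_card_Domain_le_cells[OF m(1,2), where n = n and s = s] by
      (rule order_trans[rotated])
qed

lemma nn_integral_num_components_le:
  assumes "0 < t" "t \<le> 3"
  shows "(\<integral>\<^sup>+z. of_nat (num_components (lune_graph s {..<n} z t)) \<partial>(sample s {..<n})) \<le>
    ennreal (36 / t\<^sup>2 * (1 + real (Suc s) * ((4 * real n * t\<^sup>2) ^ Suc s * (3 * exp (- (real n * t\<^sup>2)
        / (36 * real (Suc s)))))))"
proof -
  obtain m where m: "0 < m" "3 / real m \<le> t" "real m ^ 2 \<le> 36 / t\<^sup>2" using grid_size[OF assms] by blast
  let ?x = "1 / (real m ^ 2 * real (Suc s))" and ?y = "t\<^sup>2 / (36 * real (Suc s))"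
  have m2: "1 \<le> real m ^ 2" using m(1) by (simp add: Suc_le_eq)
  have "1 * 1 \<le> real m ^ 2 * real (Suc s)" using m2 by (intro mult_mono) auto
  then have x1: "?x \<le> 1" by simp
  have "real m ^ 2 * t\<^sup>2 \<le> 36" using m(3) assms by (simp add: field_simps)
  then have "(real m ^ 2 * t\<^sup>2) * real (Suc s) \<le> 36 * real (Suc s)" by (intro mult_right_mono) auto
  then have yx: "?y \<le> ?x" using m(1) by (simp add: field_simps del: of_nat_Suc)
  \<comment> \<open>After 1 - u <= exp (- u), the comparison of \<open>?x\<close> with
    \<open>?y\<close> removes m and leaves a function of n t^2 up to a bounded factor.\<close>
  have "(1 - ?x) ^ (n - Suc s) \<le> exp (- ?x) ^ (n - Suc s)"
    using x1 exp_ge_add_one_self[of "- ?x"] by (intro power_mono) auto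
  also have "\<dots> = exp (- (?x * real (n - Suc s)))" by (simp add: exp_of_nat_mult[symmetric] mult.commute)
  also have "\<dots> \<le> exp (- (?y * real (n - Suc s)))"
    using mult_right_mono[OF yx, of "real (n - Suc s)"] by (simp only: exp_le_cancel_iff
        neg_le_iff_le of_nat_0_le_iff)
  \<comment> \<open>The truncated difference is at least the real one, also when n < Suc s.
    Replacing n - Suc s by n costs the factor exp (t^2 / 36), at most 3 because t <= 3.\<close>
  also have "\<dots> \<le> exp (- (?y * (real n - real (Suc s))))"
  proof -
    have "real n - real (Suc s) \<le> real (n - Suc s)" by linarith
    then have "?y * (real n - real (Suc s)) \<le> ?y * real (n - Suc s)" by (intro mult_left_mono) auto
    then show ?thesis by simp
  qed
  also have "- (?y * (real n - real (Suc s))) = t\<^sup>2 / 36 + - (real n * t\<^sup>2) / (36 * real (Suc s))"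
    by (simp add: field_simps del: of_nat_Suc)
  also have "exp \<dots> = exp (t\<^sup>2 / 36) * exp (- (real n * t\<^sup>2) / (36 * real (Suc s)))"
    by (rule exp_add)
  also have "\<dots> \<le> 3 * exp (- (real n * t\<^sup>2) / (36 * real (Suc s)))"
  proof (rule mult_right_mono)
    have "t\<^sup>2 \<le> 3\<^sup>2" using assms by (intro power_mono) auto
    then have "exp (t\<^sup>2 / 36) \<le> exp 1" by simp
    also have "\<dots> \<le> 3" by (rule exp_le)
    finally show "exp (t\<^sup>2 / 36) \<le> 3" .
  qed simp
  finally have p: "(1 - ?x) ^ (n - Suc s) \<le> 3 * exp (- (real n * t\<^sup>2) / (36 * real (Suc s)))" .
  have "real m ^ 2 * (1 + real (Suc s) * ((4 * real n * t\<^sup>2) ^ Suc s * (1 - ?x) ^ (n - Suc s))) \<le>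
    36 / t\<^sup>2 * (1 + real (Suc s) * ((4 * real n * t\<^sup>2) ^ Suc s * (3 * exp (- (real n * t\<^sup>2) / (36 *
        real (Suc s))))))"
    using p x1 m(3) by (intro mult_mono add_left_mono mult_left_mono)
      (auto intro!: add_nonneg_nonneg mult_nonneg_nonneg simp del: of_nat_Suc)
  then show ?thesis
    using nn_integral_num_components_le_cells[OF m(1,2), where n = n and s = s] by (meson
        ennreal_leI order_trans)
qed

text \<open>Three regimes: for t >= 3 the truncated k - 1 vanishes; for \<rho> >= 1 the exponential
  absorbs the power of \<rho> and the number of cells remains; for \<rho> < 1 components are bounded
  by nodes.\<close>

lemma expected_num_components_dominated:
  shows "\<exists>C\<ge>0. \<forall>n>0. \<forall>\<rho>>0.
    (\<integral>\<^sup>+z. of_nat (num_components (lune_graph s {..<n} z (\<rho> / sqrt (real n))) - 1) \<partial>(sample s {..<n})) \<le>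
    ennreal (real n * (C / (1 + \<rho>\<^sup>2)))"
proof -
  define k where "k = Suc s"
  \<comment> \<open>With u = \<rho>^2 / (36 k) one has 4 \<rho>^2 = 144 k u, and u^k exp (- u) <=
    k!. So G bounds the power times the exponential for all \<rho>.\<close>
  define G where "G = (144 * real k) ^ k * fact k"
  \<comment> \<open>The two summands serve \<rho> >= 1 and \<rho> < 1. The 36 of the grid is doubled
    because 1 / \<rho>^2 <= 2 / (1 + \<rho>^2) in the first range and 1 <= 2 / (1 + \<rho>^2) in the
    second.\<close>
  define C where "C = 72 * (1 + real k * (3 * G)) + 72 * 4 ^ k"
  have k0: "0 < real k" by (simp add: k_def)
  have G0: "0 \<le> G" by (simp add: G_def)
  have C: "72 * (1 + real k * (3 * G)) \<le> C" "72 * 4 ^ k \<le> C" "0 \<le> C"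
    using G0 by (auto simp: C_def)
  have "(\<integral>\<^sup>+z. of_nat (num_components (lune_graph s {..<n} z (\<rho> / sqrt (real n))) - 1) \<partial>(sample s
      {..<n})) \<le>
    ennreal (real n * (C / (1 + \<rho>\<^sup>2)))" if n: "0 < n" and \<rho>: "0 < \<rho>" for n and \<rho> :: real
  proof -
    let ?M = "sample s {..<n}"
    define t where "t = \<rho> / sqrt (real n)"
    let ?nc = "\<lambda>z. num_components (lune_graph s {..<n} z t)"
    have t0: "0 < t" using n \<rho> by (simp add: t_def)
    have nt: "real n * t\<^sup>2 = \<rho>\<^sup>2" using n by (simp add: t_def power_divide)
    have t2: "36 / t\<^sup>2 = real n * (36 / \<rho>\<^sup>2)" using n \<rho> by (simp add: t_def power_divide)
    have nt4: "4 * real n * t\<^sup>2 = 4 * \<rho>\<^sup>2" using nt by simp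
    show ?thesis unfolding t_def[symmetric]
    proof (cases "3 \<le> t")
      case True
      have "AE z in ?M. (of_nat (?nc z - 1) :: ennreal) = 0"
        using AE_num_components_le_1[OF True, where n = n and s = s] by (auto elim!: eventually_mono)
      then have "(\<integral>\<^sup>+z. of_nat (?nc z - 1) \<partial>?M) = (\<integral>\<^sup>+z. 0 \<partial>?M)" by (rule nn_integral_cong_AE)
      then show "(\<integral>\<^sup>+z. of_nat (?nc z - 1) \<partial>?M) \<le> ennreal (real n * (C / (1 + \<rho>\<^sup>2)))" by simp
    next
      case False
      then have t3: "t \<le> 3" by simp
      have le1: "(\<integral>\<^sup>+z. of_nat (?nc z - 1) \<partial>?M) \<le> (\<integral>\<^sup>+z. of_nat (?nc z) \<partial>?M)"
        by (intro nn_integral_mono of_nat_mono) simp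
      show "(\<integral>\<^sup>+z. of_nat (?nc z - 1) \<partial>?M) \<le> ennreal (real n * (C / (1 + \<rho>\<^sup>2)))"
      proof (cases "1 \<le> \<rho>")
        case True
        define u where "u = \<rho>\<^sup>2 / (36 * real k)"
        have "(4 * \<rho>\<^sup>2) ^ k * exp (- \<rho>\<^sup>2 / (36 * real k)) = (144 * real k) ^ k * (u ^ k * exp (- u))"
        proof -
          have "4 * \<rho>\<^sup>2 = 144 * real k * u" using k0 by (simp add: u_def)
          then show ?thesis by (simp only: u_def power_mult_distrib mult.assoc minus_divide_left)
        qed
        also have "\<dots> \<le> (144 * real k) ^ k * fact k"
          using power_le_fact_exp[of u k] k0 by (intro mult_left_mono) (auto simp: u_def exp_minus
              field_simps)
        finally have G: "(4 * \<rho>\<^sup>2) ^ k * exp (- \<rho>\<^sup>2 / (36 * real k)) \<le> G" by (simp add: G_def)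
        have "(\<integral>\<^sup>+z. of_nat (?nc z) \<partial>?M) \<le> ennreal (36 / t\<^sup>2 * (1 + real k * ((4 * \<rho>\<^sup>2) ^ k * (3 *
            exp (- \<rho>\<^sup>2 / (36 * real k))))))"
          using nn_integral_num_components_le[OF t0 t3, where n = n and s = s] unfolding nt4 nt
              k_def[symmetric] .
        also have "\<dots> \<le> ennreal (real n * (C / (1 + \<rho>\<^sup>2)))"
        proof (rule ennreal_leI)
          have "36 / t\<^sup>2 * (1 + real k * ((4 * \<rho>\<^sup>2) ^ k * (3 * exp (- \<rho>\<^sup>2 / (36 * real k))))) \<le> 36 /
              t\<^sup>2 * (1 + real k * (3 * G))"
            using G k0 by (intro mult_left_mono add_left_mono) auto
          also have "\<dots> = real n * (36 / \<rho>\<^sup>2 * (1 + real k * (3 * G)))" by (simp add: t2)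
          also have "\<dots> \<le> real n * (C / (1 + \<rho>\<^sup>2))"
          proof (rule mult_left_mono)
            have "1 \<le> \<rho>\<^sup>2" using True by simp
            then have "36 / \<rho>\<^sup>2 \<le> 72 / (1 + \<rho>\<^sup>2)"
              by (subst frac_le_eq) (auto simp: field_simps intro!: divide_nonpos_nonneg)
            then have "36 / \<rho>\<^sup>2 * (1 + real k * (3 * G)) \<le> 72 / (1 + \<rho>\<^sup>2) * (1 + real k * (3 * G))"
              using G0 k0 by (intro mult_right_mono) auto
            also have "\<dots> = (72 * (1 + real k * (3 * G))) / (1 + \<rho>\<^sup>2)" by simp
            also have "\<dots> \<le> C / (1 + \<rho>\<^sup>2)" using C(1) by (intro divide_right_mono) auto
            finally show "36 / \<rho>\<^sup>2 * (1 + real k * (3 * G)) \<le> C / (1 + \<rho>\<^sup>2)" .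
          qed simp
          finally show "36 / t\<^sup>2 * (1 + real k * ((4 * \<rho>\<^sup>2) ^ k * (3 * exp (- \<rho>\<^sup>2 / (36 * real
              k))))) \<le> real n * (C / (1 + \<rho>\<^sup>2))" .
        qed
        finally show ?thesis using le1 by (rule order_trans[rotated])
      next
        \<comment> \<open>One factor \<rho>^2 of the node bound cancels against the number of cells,
          and \<rho>^(2 s) <= 1 remains; this is bounded near 0 also for s = 0.\<close>
        case False
        have \<rho>1: "\<rho>\<^sup>2 \<le> 1" using False \<rho> by (simp add: power_le_one)
        have "(\<integral>\<^sup>+z. of_nat (?nc z) \<partial>?M) \<le> (\<integral>\<^sup>+z. of_nat (card (Domain (lune_graph s {..<n} z t))) \<partial>?M)"
          by (intro nn_integral_mono of_nat_mono) (simp add: rel_components_def card_image_le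
              finite_Domain_lune_graph)
        also have "\<dots> \<le> ennreal (36 / t\<^sup>2 * (4 * \<rho>\<^sup>2) ^ k)"
          using nn_integral_card_Domain_le[OF t0 t3, where n = n and s = s] unfolding nt4
              k_def[symmetric] .
        also have "\<dots> \<le> ennreal (real n * (C / (1 + \<rho>\<^sup>2)))"
        proof (rule ennreal_leI)
          have "36 / t\<^sup>2 * (4 * \<rho>\<^sup>2) ^ k = real n * (36 * 4 ^ k * (\<rho>\<^sup>2) ^ s)"
            using \<rho> by (simp add: t2 k_def power_mult_distrib)
          also have "\<dots> \<le> real n * (C / (1 + \<rho>\<^sup>2))"
          proof (rule mult_left_mono)
            have "36 * 4 ^ k * (\<rho>\<^sup>2) ^ s \<le> 36 * 4 ^ k * 1"
              using power_le_one[OF zero_le_power2 \<rho>1, of s] by (intro mult_left_mono) auto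
            also have "\<dots> \<le> (72 * 4 ^ k) / (1 + \<rho>\<^sup>2)"
            proof -
              have "0 < 1 + \<rho>\<^sup>2" by (simp add: add_pos_nonneg)
              moreover have "36 * 4 ^ k * (1 + \<rho>\<^sup>2) \<le> 36 * 4 ^ k * (2::real)"
                using \<rho>1 by (intro mult_left_mono) auto
              ultimately show ?thesis by (simp add: pos_le_divide_eq)
            qed
            also have "\<dots> \<le> C / (1 + \<rho>\<^sup>2)" using C(2) by (intro divide_right_mono) auto
            finally show "36 * 4 ^ k * (\<rho>\<^sup>2) ^ s \<le> C / (1 + \<rho>\<^sup>2)" .
          qed simp
          finally show "36 / t\<^sup>2 * (4 * \<rho>\<^sup>2) ^ k \<le> real n * (C / (1 + \<rho>\<^sup>2))" .
        qed
        finally show ?thesis using le1 by (rule order_trans[rotated])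
      qed
    qed
  qed
  then show ?thesis using C(3) by blast
qed

section \<open>The local functional and its Poisson limit\<close>

lemma nn_integral_marked_uniform:
  assumes "\<And>i. a $ i < b $ i" and f: "f \<in> borel_measurable (borel \<Otimes>\<^sub>M count_space UNIV)"
  shows "(\<integral>\<^sup>+w. f w \<partial>marked_uniform s (cbox a b)) =
    (\<integral>\<^sup>+c. (\<integral>\<^sup>+x. f (x, c) * indicator (cbox a b) x \<partial>lborel) / emeasure lborel (cbox a b)
        \<partial>measure_pmf (pmf_of_set {..s}))"
proof -
  have "0 < (b $ 1 - a $ 1) * (b $ 2 - a $ 2)" using assms(1) by simp
  then have "prob_space (uniform_measure lborel (cbox a b))"
    using emeasure_cbox_vec2[of a b, OF less_imp_le[OF assms(1)]]
    by (intro prob_space_uniform_measure) (simp_all only: ennreal_eq_0_iff not_le, auto)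
  then interpret U: prob_space "uniform_measure lborel (cbox a b)" .
  interpret pair_sigma_finite "uniform_measure lborel (cbox a b)" "measure_pmf (pmf_of_set {..s})"
    by unfold_locales
  have f': "f \<in> borel_measurable (uniform_measure lborel (cbox a b) \<Otimes>\<^sub>M measure_pmf (pmf_of_set {..s}))"
  proof -
    have "sets (uniform_measure lborel (cbox a b) \<Otimes>\<^sub>M measure_pmf (pmf_of_set {..s})) = sets (borel
        \<Otimes>\<^sub>M count_space UNIV)"
      by (intro sets_pair_measure_cong) auto
    then show ?thesis using f by (simp cong: measurable_cong_sets)
  qed
  have fc: "(\<lambda>x. f (x, c)) \<in> borel_measurable borel" for c
    using measurable_compose[OF measurable_Pair2' f, of c] by simp
  have "(\<integral>\<^sup>+w. f w \<partial>marked_uniform s (cbox a b)) =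
      (\<integral>\<^sup>+c. (\<integral>\<^sup>+x. f (x, c) \<partial>uniform_measure lborel (cbox a b)) \<partial>measure_pmf (pmf_of_set {..s}))"
    unfolding marked_uniform_def by (rule nn_integral_snd[OF f', symmetric])
  then show ?thesis using fc by (simp add: nn_integral_uniform_measure)
qed

text \<open>The ball of radius r in the maximum norm: it contains the Euclidean ball, and its area
  and its images under scaling are explicit.\<close>

definition square :: "real^2 \<Rightarrow> real \<Rightarrow> (real^2) set" where
  "square y r = cbox (y - r *\<^sub>R 1) (y + r *\<^sub>R 1)"

lemma mem_square_iff: "x \<in> square y r \<longleftrightarrow> \<bar>x $ 1 - y $ 1\<bar> \<le> r \<and> \<bar>x $ 2 - y $ 2\<bar> \<le> r"
  by (auto simp: square_def mem_cbox_vec2)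

lemma square_borel [measurable]: "square y r \<in> sets borel"
  by (simp add: square_def)

lemma emeasure_square: "0 \<le> r \<Longrightarrow> emeasure lborel (square y r) = ennreal ((2 * r)\<^sup>2)"
  unfolding square_def by (subst emeasure_cbox_vec2) (auto simp: power2_eq_square)

lemma dist_le_imp_square: "dist x y \<le> r \<Longrightarrow> x \<in> square y r"
  using order_trans[OF dist_vec_nth_le, of x y r 1] order_trans[OF dist_vec_nth_le, of x y r 2]
  by (simp add: mem_square_iff dist_real_def)

text \<open>A sample point that falls into the window is uniform there, with independent color;
  rescaled by 1 / l it is a marked uniform point of a window whose size is free of n. This supplies
  the hypothesis \<open>one\<close> of \<open>nn_integral_PiM_change_of_variables\<close>, with the
  window area as c.\<close>

lemma nn_integral_square_affine:
  fixes f :: "(real^2) \<times> nat \<Rightarrow> ennreal"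
  assumes K: "0 < K" and l: "0 < l" and sub: "square y (l * K) \<subseteq> cbox 0 1"
    and f: "f \<in> borel_measurable (borel \<Otimes>\<^sub>M count_space UNIV)"
  shows "(\<integral>\<^sup>+w. indicator (square y (l * K) \<times> UNIV) w * f w \<partial>unit_sample s) =
    ennreal ((2 * (l * K))\<^sup>2) * (\<integral>\<^sup>+w. f (y + l *\<^sub>R fst w, snd w) \<partial>marked_uniform s (square 0 K))"
proof -
  let ?B = "square y (l * K)" and ?Sq = "square 0 K"
  let ?C = "measure_pmf (pmf_of_set {..s})"
  have fc: "(\<lambda>x. f (x, c)) \<in> borel_measurable borel" for c
    using measurable_compose[OF measurable_Pair2' f, of c] by simp
  have g: "(\<lambda>w. (y + l *\<^sub>R fst w, snd w)) \<in> borel \<Otimes>\<^sub>M count_space UNIV \<rightarrow>\<^sub>M borel \<Otimes>\<^sub>M count_space UNIV"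
    by measurable
  have m1: "(\<lambda>w. indicator (?B \<times> UNIV) w * f w) \<in> borel_measurable (borel \<Otimes>\<^sub>M count_space UNIV)"
    using f by measurable
  have B0: "(-1 * (K *\<^sub>R 1) :: real^2) $ i < (K *\<^sub>R 1 :: real^2) $ i" for i using K by simp
  have sq0: "square 0 K = cbox (- (K *\<^sub>R 1)) (K *\<^sub>R 1)" by (simp add: square_def)
  have step: "(\<integral>\<^sup>+x. indicator (?B \<times> UNIV) (x, c) * f (x, c) * indicator (cbox 0 1) x \<partial>lborel) =
     ennreal (l\<^sup>2) * (\<integral>\<^sup>+x. f (y + l *\<^sub>R x, c) * indicator ?Sq x \<partial>lborel)" for c
  proof -
    let ?h = "\<lambda>x. indicator ?B x * f (x, c)"
    note [measurable] = fc[of c]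
    have "(\<integral>\<^sup>+x. indicator (?B \<times> UNIV) (x, c) * f (x, c) * indicator (cbox 0 1) x \<partial>lborel) = (\<integral>\<^sup>+x.
        ?h x \<partial>lborel)"
      using sub by (intro nn_integral_cong) (auto simp: indicator_def)
    also have "\<dots> = (\<integral>\<^sup>+x. ?h x \<partial>density (distr lborel borel (\<lambda>x. y + l *\<^sub>R x)) (\<lambda>_. ennreal (\<bar>l\<bar> ^
        DIM(real^2))))"
      using lborel_affine[of l y] l by simp
    also have "\<dots> = (\<integral>\<^sup>+x. ennreal (l\<^sup>2) * ?h (y + l *\<^sub>R x) \<partial>lborel)"
      by (simp add: nn_integral_density nn_integral_distr)
    also have "\<dots> = ennreal (l\<^sup>2) * (\<integral>\<^sup>+x. ?h (y + l *\<^sub>R x) \<partial>lborel)"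
      by (rule nn_integral_cmult) measurable
    also have "(\<integral>\<^sup>+x. ?h (y + l *\<^sub>R x) \<partial>lborel) = (\<integral>\<^sup>+x. f (y + l *\<^sub>R x, c) * indicator ?Sq x \<partial>lborel)"
    proof -
      have "y + l *\<^sub>R x \<in> ?B \<longleftrightarrow> x \<in> ?Sq" for x
        using l by (simp add: mem_square_iff abs_mult)
      then show ?thesis by (intro nn_integral_cong) (simp add: indicator_def mult.commute)
    qed
    finally show ?thesis .
  qed
  have "(\<integral>\<^sup>+w. indicator (?B \<times> UNIV) w * f w \<partial>unit_sample s) =
     (\<integral>\<^sup>+c. ennreal (l\<^sup>2) * (\<integral>\<^sup>+x. f (y + l *\<^sub>R x, c) * indicator ?Sq x \<partial>lborel) \<partial>?C)"
    using nn_integral_marked_uniform[of 0 1, OF _ m1, of s]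
    by (simp add: emeasure_unit_square step divide_ennreal_def)
  also have "\<dots> = (\<integral>\<^sup>+c. ennreal ((2 * (l * K))\<^sup>2) * ((\<integral>\<^sup>+x. f (y + l *\<^sub>R x, c) * indicator ?Sq x
      \<partial>lborel) / emeasure lborel ?Sq) \<partial>?C)"
  proof (rule nn_integral_cong)
    fix c
    let ?X = "\<integral>\<^sup>+x. f (y + l *\<^sub>R x, c) * indicator ?Sq x \<partial>lborel"
    have "ennreal ((2 * (l * K))\<^sup>2) = ennreal (l\<^sup>2) * ennreal ((2 * K)\<^sup>2)"
      by (simp add: power_mult_distrib mult_ac flip: ennreal_mult)
    moreover have "emeasure lborel ?Sq = ennreal ((2 * K)\<^sup>2)" using K by (simp add: emeasure_square)
    moreover have "ennreal ((2 * K)\<^sup>2) * (?X / ennreal ((2 * K)\<^sup>2)) = ?X"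
    proof -
      have "ennreal ((2 * K)\<^sup>2) \<noteq> 0" using K by (auto simp: ennreal_eq_0_iff)
      then have "?X * ennreal ((2 * K)\<^sup>2) / ennreal ((2 * K)\<^sup>2) = ?X" by (rule
          mult_divide_eq_ennreal) simp
      then show ?thesis by (simp add: ennreal_times_divide mult.commute)
    qed
    ultimately show "ennreal (l\<^sup>2) * ?X = ennreal ((2 * (l * K))\<^sup>2) * (?X / emeasure lborel ?Sq)"
      by (simp only: mult.assoc)
  qed
  also have "\<dots> = ennreal ((2 * (l * K))\<^sup>2) * (\<integral>\<^sup>+c. (\<integral>\<^sup>+x. f (y + l *\<^sub>R x, c) * indicator ?Sq x
      \<partial>lborel) / emeasure lborel ?Sq \<partial>?C)"
    by (rule nn_integral_cmult) simp
  also have "(\<integral>\<^sup>+c. (\<integral>\<^sup>+x. f (y + l *\<^sub>R x, c) * indicator ?Sq x \<partial>lborel) / emeasure lborel ?Sq \<partial>?C) =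
     (\<integral>\<^sup>+w. f (y + l *\<^sub>R fst w, snd w) \<partial>marked_uniform s ?Sq)"
    unfolding sq0 using B0 by (subst nn_integral_marked_uniform[OF _ measurable_compose[OF g f]]) auto
  finally show ?thesis .
qed

section \<open>The expected local count as a binomial mean\<close>

lemma sum_Pow_card:
  fixes h :: "nat \<Rightarrow> 'b :: comm_semiring_1"
  assumes "finite I"
  shows "(\<Sum>J\<in>Pow I. h (card J)) = (\<Sum>m\<le>card I. of_nat (card I choose m) * h m)"
proof -
  have "(\<Sum>J\<in>Pow I. h (card J)) = (\<Sum>m\<le>card I. \<Sum>J | J \<in> Pow I \<and> card J = m. h (card J))"
    using assms by (intro sum.group[symmetric]) (auto intro: card_mono)
  also have "\<dots> = (\<Sum>m\<le>card I. of_nat (card I choose m) * h m)"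
  proof (rule sum.cong[OF refl])
    fix m
    have "(\<Sum>J | J \<in> Pow I \<and> card J = m. h (card J)) = (\<Sum>J | J \<in> Pow I \<and> card J = m. h m)"
      by (rule sum.cong) auto
    then show "(\<Sum>J | J \<in> Pow I \<and> card J = m. h (card J)) = of_nat (card I choose m) * h m"
      using n_subsets[OF assms, of m] by simp
  qed
  finally show ?thesis .
qed

text \<open>The expected share of a point of color 0 at the origin, placed under index m, given that
  exactly m other points lie in the window. The sample size has disappeared.\<close>

definition window_mean :: "nat \<Rightarrow> nat \<Rightarrow> real \<Rightarrow> real \<Rightarrow> nat \<Rightarrow> ennreal" where
  "window_mean s M \<rho> K m =
     (\<integral>\<^sup>+z. ennreal (local_count s M {..m} (z(m := (0, 0))) \<rho> m) \<partial>(\<Pi>\<^sub>M l\<in>{..<m}. marked_uniform s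
         (square 0 K)))"

lemma prob_space_marked_square: "0 < K \<Longrightarrow> prob_space (marked_uniform s (square y K))"
  unfolding square_def by (rule prob_space_marked_uniform) simp

lemma measurable_local_count_upd:
  assumes "finite J" "j \<notin> J"
  shows "(\<lambda>z. ennreal (local_count s M (insert j J) (z(j := w)) t j)) \<in> borel_measurable (\<Pi>\<^sub>M l\<in>J.
      marked_uniform s B)"
proof -
  have "(\<lambda>z. z(j := w)) \<in> (\<Pi>\<^sub>M l\<in>J. marked_uniform s B) \<rightarrow>\<^sub>M (\<Pi>\<^sub>M l\<in>insert j J. marked_uniform s B)"
    by (rule measurable_fun_upd) auto
  moreover have "(\<lambda>z. local_count s M (insert j J) z t j) \<in> borel_measurable (\<Pi>\<^sub>M l\<in>insert j J.
      marked_uniform s B)"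
    by (subst measurable_cong_sets[OF sets_PiM_marked refl], rule measurable_local_count) (use assms
        in simp)
  ultimately have "(\<lambda>z. local_count s M (insert j J) (z(j := w)) t j) \<in> borel_measurable (\<Pi>\<^sub>M l\<in>J.
      marked_uniform s B)"
    by (rule measurable_compose)
  then show ?thesis by measurable
qed

text \<open>The points in the window are independent with one common law, so their index set matters
  only through its size.\<close>

lemma window_mean_reindex:
  assumes K: "0 < K" and J: "finite J" "j \<notin> J"
  shows "(\<integral>\<^sup>+z. ennreal (local_count s M (insert j J) (z(j := (0, 0))) \<rho> j) \<partial>(\<Pi>\<^sub>M l\<in>J.
      marked_uniform s (square 0 K))) =
    window_mean s M \<rho> K (card J)"
proof -
  define m where "m = card J"
  obtain p where p: "bij_betw p {..<m} J"
    using ex_bij_betw_nat_finite[OF J(1)] by (auto simp: m_def atLeast0LessThan)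
  \<comment> \<open>Extends the enumeration of J so that the distinguished index m of
    \<open>window_mean\<close> corresponds to j.\<close>
  define q where "q = p(m := j)"
  have injp: "inj_on p {..<m}" and imp: "p ` {..<m} = J" using p by (auto simp: bij_betw_def)
  have atm: "{..m} = insert m {..<m}" by auto
  have imq: "q ` {..m} = insert j J" using imp unfolding atm by (auto simp: q_def)
  have injq: "inj_on q {..m}"
    unfolding atm using injp imp J(2) by (subst inj_on_insert) (auto simp: q_def inj_on_def)
  let ?G = "\<lambda>z. ennreal (local_count s M {..m} (z(m := (0, 0))) \<rho> m)"
  have "local_count s M (insert j J) (z(j := (0, 0))) \<rho> j = local_count s M {..m} ((\<lambda>i\<in>{..<m}. z (p
      i))(m := (0, 0))) \<rho> m" for z
  proof -
    have "local_count s M (q ` {..m}) (z(j := (0, 0))) \<rho> (q m) = local_count s M {..m} (z(j := (0,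
        0)) \<circ> q) \<rho> m"
      by (rule local_count_reindex[OF injq]) simp
    also have "\<dots> = local_count s M {..m} ((\<lambda>i\<in>{..<m}. z (p i))(m := (0, 0))) \<rho> m"
      using imp J(2) unfolding atm by (intro local_count_cong) (auto simp: q_def)
    finally show ?thesis unfolding imq by (simp add: q_def)
  qed
  then have "(\<integral>\<^sup>+z. ennreal (local_count s M (insert j J) (z(j := (0, 0))) \<rho> j) \<partial>(\<Pi>\<^sub>M l\<in>J.
      marked_uniform s (square 0 K))) =
     (\<integral>\<^sup>+z. ?G (\<lambda>i\<in>{..<m}. z (p i)) \<partial>(\<Pi>\<^sub>M l\<in>p ` {..<m}. marked_uniform s (square 0 K)))"
    by (simp add: imp)
  also have "\<dots> = (\<integral>\<^sup>+z. ?G z \<partial>(\<Pi>\<^sub>M l\<in>{..<m}. marked_uniform s (square 0 K)))"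
    using measurable_local_count_upd[of "{..<m}" m s M "(0, 0)" \<rho> "square 0 K"]
    by (intro nn_integral_PiM_reindex prob_space_marked_square K injp) (simp add: atm)
  finally show ?thesis by (simp add: window_mean_def m_def)
qed

text \<open>When the window around y fits into the square, the number of other points in it is
  binomial with the window area as success probability. Given that number, the rescaled points
  follow the law in \<open>window_mean\<close>, so all dependence on n sits in the binomial
  weights.\<close>

lemma local_count_interior:
  assumes n: "j < n" and l: "0 < l" and \<rho>: "0 < \<rho>" and K: "(real M ^ 2 + 2) * \<rho> \<le> K"
    and sub: "square y (l * K) \<subseteq> cbox 0 1"
  shows "(\<integral>\<^sup>+z. ennreal (local_count s M {..<n} (z(j := (y, 0))) (l * \<rho>) j) \<partial>(sample s ({..<n} - {j}))) =
    (\<Sum>m\<le>n - 1. of_nat (n - 1 choose m) * (ennreal (1 - (2 * (l * K))\<^sup>2) ^ (n - 1 - m) *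
       (ennreal ((2 * (l * K))\<^sup>2) ^ m * window_mean s M \<rho> K m)))"
proof -
  define I where "I = {..<n} - {j}"
  define p where "p = (2 * (l * K))\<^sup>2"
  let ?B = "square y (l * K) \<times> (UNIV :: nat set)"
  have finI: "finite I" and jI: "j \<notin> I" and cardI: "card I = n - 1" and insI: "insert j I = {..<n}"
    using n by (auto simp: I_def)
  have "0 < (real M ^ 2 + 2) * \<rho>" using \<rho> by (intro mult_pos_pos) (auto intro: add_nonneg_pos)
  then have K0: "0 < K" using K by linarith
  have lK: "0 < l * K" using l K0 by simp
  interpret U: prob_space "unit_sample s" by (rule prob_space_unit_sample)
  have BM: "?B \<in> sets (unit_sample s)" by measurable
  have eB: "emeasure (unit_sample s) ?B = ennreal p"
    using sub lK by (subst emeasure_marked_uniform_Times)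
      (auto simp: emeasure_unit_square divide_ennreal_def Int_absorb1 emeasure_square p_def)
  have p1: "p \<le> 1" using U.emeasure_le_1[of ?B] unfolding eB by (simp add: ennreal_le_1)
  have "emeasure (unit_sample s) (space (unit_sample s) - ?B) = emeasure (unit_sample s) (space
      (unit_sample s)) - ennreal p"
    using BM unfolding eB[symmetric] by (intro emeasure_compl) auto
  then have ecB: "emeasure (unit_sample s) (space (unit_sample s) - ?B) = ennreal (1 - p)"
    unfolding U.emeasure_space_1 by (simp add: ennreal_minus p_def flip: ennreal_1)
  let ?H = "\<lambda>J z. ennreal (local_count s M (insert j J) (z(j := (y, 0))) (l * \<rho>) j)"
  \<comment> \<open>This is what the cutoff M is for: points outside the window are farther away
    than (M^2 + 2) l \<rho>, so they cannot change the share of j.\<close>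
  have loc: "ennreal (local_count s M {..<n} (z(j := (y, 0))) (l * \<rho>) j) = ?H {i\<in>I. z i \<in> ?B} z" for z
  proof -
    have "local_count s M {..<n} (z(j := (y, 0))) (l * \<rho>) j = local_count s M (insert j {i\<in>I. z i \<in>
        ?B}) (z(j := (y, 0))) (l * \<rho>) j"
    proof (rule local_count_local)
      fix i assume i: "i \<in> {..<n}" and d: "dist (fst ((z(j := (y, 0))) i)) (fst ((z(j := (y, 0)))
          j)) \<le> (real M ^ 2 + 2) * (l * \<rho>)"
      show "i \<in> insert j {i \<in> I. z i \<in> ?B}"
      proof (cases "i = j")
        case False
        have "(real M ^ 2 + 2) * (l * \<rho>) = l * ((real M ^ 2 + 2) * \<rho>)" by simp
        also have "\<dots> \<le> l * K" using K l by (intro mult_left_mono) auto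
        finally have "dist (fst (z i)) y \<le> l * K" using d False by simp
        then show ?thesis using i False dist_le_imp_square by (auto simp: I_def mem_Times_iff)
      qed simp
    qed (use n l \<rho> in \<open>auto simp: I_def\<close>)
    then show ?thesis by simp
  qed
  have Hm: "?H J \<in> borel_measurable (sample s J)" if "J \<subseteq> I" for J
    using that finI jI by (intro measurable_local_count_upd) (auto intro: finite_subset)
  have "(\<integral>\<^sup>+z. ennreal (local_count s M {..<n} (z(j := (y, 0))) (l * \<rho>) j) \<partial>(sample s I)) =
    (\<Sum>J\<in>Pow I. ennreal (1 - p) ^ card (I - J) *
      (\<integral>\<^sup>+z. (\<Prod>i\<in>J. indicator ?B (z i)) * ?H J z \<partial>(sample s J)))"
    unfolding loc ecB[symmetric]
  proof (rule nn_integral_PiM_subset_decomposition[OF prob_space_unit_sample finI BM Hm])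
    fix J and z z' :: config assume "J \<subseteq> I" "\<And>i. i \<in> J \<Longrightarrow> z i = z' i"
    then show "?H J z = ?H J z'" by (intro arg_cong[where f = ennreal] local_count_cong) auto
  qed
  also have "\<dots> = (\<Sum>J\<in>Pow I. ennreal (1 - p) ^ (card I - card J) * (ennreal p ^ card J * window_mean
      s M \<rho> K (card J)))"
  proof (rule sum.cong[OF refl])
    fix J assume "J \<in> Pow I"
    then have J: "J \<subseteq> I" "finite J" "j \<notin> J" using finI jI by (auto intro: finite_subset)
    let ?g = "\<lambda>w :: (real^2) \<times> nat. (y + l *\<^sub>R fst w, snd w)"
    have gm: "?g \<in> marked_uniform s (square 0 K) \<rightarrow>\<^sub>M unit_sample s" by measurable
    have "(\<integral>\<^sup>+z. (\<Prod>i\<in>J. indicator ?B (z i)) * ?H J z \<partial>(sample s J)) =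
      ennreal p ^ card J * (\<integral>\<^sup>+z. ?H J (\<lambda>i\<in>J. ?g (z i)) \<partial>(\<Pi>\<^sub>M i\<in>J. marked_uniform s (square 0 K)))"
    proof (rule nn_integral_PiM_change_of_variables[OF prob_space_unit_sample
        prob_space_marked_square[OF K0] gm BM _ J(2) Hm[OF J(1)]])
      fix f :: "(real^2) \<times> nat \<Rightarrow> ennreal" assume "f \<in> borel_measurable (unit_sample s)"
      then have "f \<in> borel_measurable (borel \<Otimes>\<^sub>M count_space UNIV)"
        by (simp cong: measurable_cong_sets add: sets_marked_uniform)
      then show "(\<integral>\<^sup>+w. indicator ?B w * f w \<partial>unit_sample s) = ennreal p * (\<integral>\<^sup>+w. f (?g w)
          \<partial>marked_uniform s (square 0 K))"
        unfolding p_def by (rule nn_integral_square_affine[OF K0 l sub])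
    qed
    also have "(\<lambda>z. ?H J (\<lambda>i\<in>J. ?g (z i))) = (\<lambda>z. ennreal (local_count s M (insert j J) (z(j := (0,
        0))) \<rho> j))"
    proof
      fix z :: config
      have "local_count s M (insert j J) ((\<lambda>i\<in>J. ?g (z i))(j := (y, 0))) (l * \<rho>) j =
        local_count s M (insert j J) (\<lambda>i. (y + l *\<^sub>R fst ((z(j := (0, 0))) i), snd ((z(j := (0, 0)))
            i))) (l * \<rho>) j"
        using J(3) by (intro local_count_cong) auto
      then show "?H J (\<lambda>i\<in>J. ?g (z i)) = ennreal (local_count s M (insert j J) (z(j := (0, 0))) \<rho> j)"
        by (simp only: local_count_affine[OF l])
    qed
    also have "(\<integral>\<^sup>+z. ennreal (local_count s M (insert j J) (z(j := (0, 0))) \<rho> j) \<partial>(\<Pi>\<^sub>M l\<in>J.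
        marked_uniform s (square 0 K))) =
        window_mean s M \<rho> K (card J)"
      by (rule window_mean_reindex[OF K0 J(2,3)])
    finally have X: "(\<integral>\<^sup>+z. (\<Prod>i\<in>J. indicator ?B (z i)) * ?H J z \<partial>(sample s J)) =
      ennreal p ^ card J * window_mean s M \<rho> K (card J)" .
    show "ennreal (1 - p) ^ card (I - J) *
      (\<integral>\<^sup>+z. (\<Prod>i\<in>J. indicator ?B (z i)) * ?H J z \<partial>(sample s J)) =
      ennreal (1 - p) ^ (card I - card J) * (ennreal p ^ card J * window_mean s M \<rho> K (card J))"
      by (simp only: X card_Diff_subset[OF J(2,1)])
  qed
  also have "\<dots> = (\<Sum>m\<le>card I. of_nat (card I choose m) * (ennreal (1 - p) ^ (card I - m) * (ennreal p
      ^ m * window_mean s M \<rho> K m)))"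
    by (rule sum_Pow_card[OF finI])
  finally show ?thesis unfolding cardI unfolding p_def I_def .
qed

lemma local_count_color:
  assumes "snd (z j) \<noteq> 0"
  shows "local_count s M I z t j = 0"
proof -
  have "{\<phi> \<in> Domain (lune_graph s I z t). \<phi> 0 = j} = {}"
    using assms by (auto simp: Domain_lune_graph simplex_indices_def)
  then show ?thesis unfolding local_count_def Let_def by (simp only: sum.empty)
qed

text \<open>A crude bound for points near the boundary, whose window sticks out of the square. A
  node charged to j is determined by its other s vertices, which are distinct and within t of the
  position of j, hence in a square of area 4 t^2.\<close>

lemma local_count_expectation_le:
  assumes n: "j < n" and t: "0 \<le> t"
  shows "(\<integral>\<^sup>+z. ennreal (local_count s M {..<n} (z(j := w)) t j) \<partial>(sample s ({..<n} - {j}))) \<le>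
    ennreal ((4 * real n * t\<^sup>2) ^ s)"
proof -
  define I where "I = {..<n} - {j}"
  \<comment> \<open>The vertex of color 0 is j itself, so only the colors from 1 to s are free; this
    makes the exponent s.\<close>
  let ?S = "{1..s}" and ?B = "square (fst w) t \<times> (UNIV :: nat set)"
  let ?X = "\<lambda>z. {\<sigma> \<in> ?S \<rightarrow>\<^sub>E I. inj_on \<sigma> ?S \<and> (\<forall>i\<in>?S. z (\<sigma> i) \<in> ?B)}"
  have finI: "finite I" by (simp add: I_def)
  interpret U: prob_space "unit_sample s" by (rule prob_space_unit_sample)
  have BM: "?B \<in> sets (unit_sample s)" by measurable
  have le: "local_count s M {..<n} (z(j := w)) t j \<le> real (card (?X z))" for z
  proof -
    let ?z = "z(j := w)"
    let ?D = "{\<phi> \<in> Domain (lune_graph s {..<n} ?z t). \<phi> 0 = j}"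
    have "card ?D \<le> card (?X z)"
    proof (rule card_inj_on_le)
      show "inj_on (\<lambda>\<phi>. restrict \<phi> ?S) ?D"
      proof (rule inj_onI)
        fix \<phi> \<psi> assume a: "\<phi> \<in> ?D" "\<psi> \<in> ?D" "restrict \<phi> ?S = restrict \<psi> ?S"
        show "\<phi> = \<psi>"
        proof (rule PiE_ext)
          show "\<phi> \<in> {..s} \<rightarrow>\<^sub>E {..<n}" "\<psi> \<in> {..s} \<rightarrow>\<^sub>E {..<n}"
            using a by (auto simp: Domain_lune_graph simplex_indices_def)
          show "\<phi> i = \<psi> i" if "i \<in> {..s}" for i
          proof (cases "i = 0")
            case False
            then have "i \<in> ?S" using that by simp
            then show ?thesis using fun_cong[OF a(3), of i] by (simp only: restrict_apply if_True)
          qed (use a in auto)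
        qed
      qed
      show "(\<lambda>\<phi>. restrict \<phi> ?S) ` ?D \<subseteq> ?X z"
      proof
        fix \<sigma> assume "\<sigma> \<in> (\<lambda>\<phi>. restrict \<phi> ?S) ` ?D"
        then obtain \<phi> where \<phi>: "\<phi> \<in> Domain (lune_graph s {..<n} ?z t)" "\<phi> 0 = j" "\<sigma> = restrict \<phi> ?S"
            by blast
        have si: "\<phi> \<in> simplex_indices s {..<n} ?z" using \<phi>(1) by (simp add: Domain_lune_graph)
        have inj: "inj_on \<phi> {..s}" by (rule inj_on_simplex_indices[OF si])
        have \<phi>j: "\<phi> i \<noteq> j" "\<phi> i < n" if "i \<in> ?S" for i
        proof -
          show "\<phi> i \<noteq> j" using inj that \<phi>(2) by (auto simp: inj_on_def)
          show "\<phi> i < n" using si that by (auto simp: simplex_indices_def PiE_iff)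
        qed
        have "z (\<phi> i) \<in> ?B" if "i \<in> ?S" for i
        proof -
          have "(\<phi>, \<phi>) \<in> lune_graph s {..<n} ?z t"
            using \<phi>(1) tolerance_lune_graph by (auto simp: tolerance_def)
          then have "dist (fst (?z (\<phi> i))) (fst (?z (\<phi> 0))) \<le> t" using lune_graph_dist[of \<phi> \<phi> s
              "{..<n}" ?z t i 0] that by simp
          then show ?thesis using \<phi>j[OF that] \<phi>(2) dist_le_imp_square by (simp add: mem_Times_iff)
        qed
        then show "\<sigma> \<in> ?X z"
          using \<phi>j inj unfolding \<phi>(3) by (auto simp: I_def intro: inj_on_subset)
      qed
      show "finite (?X z)"
        by (rule finite_subset[of _ "?S \<rightarrow>\<^sub>E I"]) (use finI in \<open>auto simp: finite_PiE\<close>)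
    qed
    then show ?thesis using local_count_le[of "{..<n}" s M ?z t j] by simp
  qed
  have "(\<integral>\<^sup>+z. ennreal (local_count s M {..<n} (z(j := w)) t j) \<partial>(sample s I)) \<le>
    (\<integral>\<^sup>+z. of_nat (card (?X z)) \<partial>(sample s I))"
    using le by (intro nn_integral_mono) (simp add: ennreal_of_nat_eq_real_of_nat ennreal_leI)
  also have "\<dots> = (\<integral>\<^sup>+z. (\<Sum>\<phi> | \<phi> \<in> ?S \<rightarrow>\<^sub>E I \<and> inj_on \<phi> ?S.
      (\<Prod>i\<in>?S. indicator ?B (z (\<phi> i))) * (\<Prod>l\<in>I - \<phi> ` ?S. 1)) \<partial>(sample s I))"
    using card_eq_sum_prod_indicator[OF finI, of ?S _ ?B] by simp
  also have "\<dots> \<le> (of_nat (card I) * emeasure (unit_sample s) ?B) ^ card ?S * (\<integral>\<^sup>+x. 1 \<partial>unit_sample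
      s) ^ (card I - card ?S)"
    by (rule nn_integral_sum_injections[OF prob_space_unit_sample finI _ BM]) auto
  also have "(\<integral>\<^sup>+x. 1 \<partial>unit_sample s) = 1" using U.emeasure_space_1 by simp
  also have "(of_nat (card I) * emeasure (unit_sample s) ?B) ^ card ?S * 1 ^ (card I - card ?S) \<le>
     (ennreal (real n) * ennreal (4 * t\<^sup>2)) ^ s"
  proof -
    have "of_nat (card I) \<le> (of_nat n :: ennreal)"
      using card_mono[of "{..<n}" I] by (intro of_nat_mono) (auto simp: I_def)
    moreover have "emeasure (unit_sample s) ?B \<le> ennreal (4 * t\<^sup>2)"
    proof -
      have "emeasure (unit_sample s) (cbox (fst w - t *\<^sub>R 1) (fst w + t *\<^sub>R 1) \<times> UNIV) \<le>
        ennreal (((fst w + t *\<^sub>R 1) $ 1 - (fst w - t *\<^sub>R 1) $ 1) * ((fst w + t *\<^sub>R 1) $ 2 - (fst w -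
            t *\<^sub>R 1) $ 2))"
        using t by (intro emeasure_unit_sample_le) simp
      then show ?thesis by (simp add: square_def power2_eq_square)
    qed
    ultimately show ?thesis
      by (simp add: ennreal_of_nat_eq_real_of_nat) (intro power_mono mult_mono, auto)
  qed
  also have "\<dots> = ennreal ((4 * real n * t\<^sup>2) ^ s)"
    by (simp add: ennreal_power mult_ac flip: ennreal_mult)
  finally show ?thesis unfolding I_def .
qed

text \<open>Counts all index tuples over {..m}. Polynomial growth in m is weak enough for the
  factorials in the Poisson weights.\<close>

lemma window_mean_le: "0 < K \<Longrightarrow> window_mean s M \<rho> K m \<le> ennreal (real (Suc m) ^ Suc s)"
proof -
  assume K: "0 < K"
  interpret P: prob_space "\<Pi>\<^sub>M l\<in>{..<m}. marked_uniform s (square 0 K)"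
    by (intro prob_space_PiM prob_space_marked_square K)
  have "local_count s M {..m} z \<rho> m \<le> real (Suc m) ^ Suc s" for z
  proof -
    have "{\<phi> \<in> Domain (lune_graph s {..m} z \<rho>). \<phi> 0 = m} \<subseteq> {..s} \<rightarrow>\<^sub>E {..m}"
      by (auto simp: Domain_lune_graph simplex_indices_def)
    then have "card {\<phi> \<in> Domain (lune_graph s {..m} z \<rho>). \<phi> 0 = m} \<le> card ({..s} \<rightarrow>\<^sub>E {..m})"
      by (intro card_mono finite_PiE) auto
    also have "\<dots> = Suc m ^ Suc s" by (simp add: card_PiE)
    finally have "real (card {\<phi> \<in> Domain (lune_graph s {..m} z \<rho>). \<phi> 0 = m}) \<le> real (Suc m ^ Suc s)"
      by (rule of_nat_mono)
    then show ?thesis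
      unfolding of_nat_power by (rule order_trans[OF local_count_le[OF finite_atMost]])
  qed
  then have "window_mean s M \<rho> K m \<le> (\<integral>\<^sup>+z. ennreal (real (Suc m) ^ Suc s) \<partial>(\<Pi>\<^sub>M l\<in>{..<m}.
      marked_uniform s (square 0 K)))"
    unfolding window_mean_def by (intro nn_integral_mono ennreal_leI)
  then show ?thesis by (simp add: P.emeasure_space_1 del: of_nat_Suc)
qed

text \<open>The Poisson limit theorem for a functional of polynomial growth; the limit is the mean
  of c under the Poisson law with parameter a. The denominator is Suc N because N points remain
  besides the distinguished one in a sample of size Suc N.\<close>

lemma binomial_mean_convergent:
  fixes c :: "nat \<Rightarrow> real"
  assumes a: "0 < a" and c: "\<And>m. 0 \<le> c m" "\<And>m. c m \<le> real (Suc m) ^ k"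
  shows "convergent (\<lambda>N. \<Sum>m\<le>N. real (N choose m) * ((1 - a / real (Suc N)) ^ (N - m) * ((a / real
      (Suc N)) ^ m * c m)))"
proof -
  define f where "f m N = (if m \<le> N then real (N choose m) * ((1 - a / real (Suc N)) ^ (N - m) * ((a
      / real (Suc N)) ^ m * c m)) else 0)" for m N
  have z: "(\<lambda>N. b / real (Suc N)) \<longlonglongrightarrow> 0" for b :: real
    using LIMSEQ_Suc[OF lim_const_over_n[of b]] by simp
  have lim: "f m \<longlonglongrightarrow> (\<Prod>i = 0..<m. 1 / real (m - i)) * (exp (- a) * (a ^ m * c m))" for m
  proof -
    have base: "(\<lambda>N. 1 - a / real (Suc N)) \<longlonglongrightarrow> 1 - 0" by (intro tendsto_diff tendsto_const z)
    \<comment> \<open>The power N - m is read as the power Suc N, which tends to exp (- a), divided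
      by the power Suc m of a quantity that tends to 1.\<close>
    have "(\<lambda>N. (1 + (- a) / real (Suc N)) ^ Suc N) \<longlonglongrightarrow> exp (- a)"
      by (rule LIMSEQ_Suc[OF tendsto_exp_limit_sequentially])
    then have "(\<lambda>N. (1 + (- a) / real (Suc N)) ^ Suc N / (1 - a / real (Suc N)) ^ Suc m) \<longlonglongrightarrow> exp (- a)
        / (1 - 0) ^ Suc m"
      by (intro tendsto_divide tendsto_power base) auto
    then have 1: "(\<lambda>N. (1 + (- a) / real (Suc N)) ^ Suc N / (1 - a / real (Suc N)) ^ Suc m) \<longlonglongrightarrow> exp (-
        a)" by simp
    have frac: "(\<lambda>N. (real N - real i) / real (Suc N)) \<longlonglongrightarrow> 1" for i
    proof -
      have "(\<lambda>N. 1 - (real i + 1) / real (Suc N)) \<longlonglongrightarrow> 1 - 0" by (intro tendsto_diff tendsto_const z)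
      moreover have "1 - (real i + 1) / real (Suc N) = (real N - real i) / real (Suc N)" for N
        by (simp add: field_simps)
      ultimately show ?thesis by simp
    qed
    have 2: "(\<lambda>N. \<Prod>i = 0..<m. ((real N - real i) / real (Suc N)) / real (m - i)) \<longlonglongrightarrow> (\<Prod>i = 0..<m. 1 /
        real (m - i))"
      by (intro tendsto_prod tendsto_divide frac tendsto_const) auto
    have "(\<lambda>N. (\<Prod>i = 0..<m. ((real N - real i) / real (Suc N)) / real (m - i)) *
       (((1 + (- a) / real (Suc N)) ^ Suc N / (1 - a / real (Suc N)) ^ Suc m) * (a ^ m * c m)))
       \<longlonglongrightarrow> (\<Prod>i = 0..<m. 1 / real (m - i)) * (exp (- a) * (a ^ m * c m))"
      by (intro tendsto_mult 1 2 tendsto_const)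
    moreover have "eventually (\<lambda>N. (\<Prod>i = 0..<m. ((real N - real i) / real (Suc N)) / real (m - i)) *
       (((1 + (- a) / real (Suc N)) ^ Suc N / (1 - a / real (Suc N)) ^ Suc m) * (a ^ m * c m)) = f m
           N) sequentially"
    proof -
      have "eventually (\<lambda>N. m \<le> N \<and> a < real (Suc N)) sequentially"
      proof -
        obtain N0 where "a < real N0" using reals_Archimedean2 by blast
        then show ?thesis by (intro eventually_sequentiallyI[of "max m N0"]) auto
      qed
      then show ?thesis
      proof eventually_elim
        case (elim N)
        define b where "b = 1 - a / real (Suc N)"
        have b: "0 < b" using elim by (simp add: b_def)
        have "b ^ Suc N = b ^ (N - m) * b ^ Suc m" using elim by (simp flip: power_add power_Suc)
        then have e1: "(1 + (- a) / real (Suc N)) ^ Suc N / (1 - a / real (Suc N)) ^ Suc m = b ^ (N - m)"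
        proof -
          have "1 + (- a) / real (Suc N) = b" "1 - a / real (Suc N) = b" by (simp_all add: b_def)
          moreover have "b ^ Suc N / b ^ Suc m = b ^ (N - m)"
            unfolding \<open>b ^ Suc N = b ^ (N - m) * b ^ Suc m\<close>
            by (rule nonzero_mult_div_cancel_right) (use b in simp)
          ultimately show ?thesis by (simp only:)
        qed
        have e2: "(\<Prod>i = 0..<m. ((real N - real i) / real (Suc N)) / real (m - i)) = real (N choose
            m) / real (Suc N) ^ m"
        proof -
          have "(\<Prod>i = 0..<m. ((real N - real i) / real (Suc N)) / real (m - i)) = (\<Prod>i = 0..<m. (real
              (N - i) / real (m - i)) / real (Suc N))"
            using elim by (intro prod.cong) (auto simp: of_nat_diff)
          also have "\<dots> = (\<Prod>i = 0..<m. real (N - i) / real (m - i)) / real (Suc N) ^ m"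
            by (simp only: prod_dividef prod_constant card_atLeastLessThan diff_zero)
          finally show ?thesis using elim by (simp add: binomial_altdef_of_nat)
        qed
        show ?case unfolding e1 e2 f_def using elim by (simp add: b_def power_divide)
      qed
    qed
    ultimately show ?thesis by (rule Lim_transform_eventually)
  qed
  obtain N0 where N0: "a < real N0" using reals_Archimedean2 by blast
  \<comment> \<open>A majorant free of N, for Tannery's theorem: the binomial coefficient is at most
    N^m / m!, and the powers of Suc N cancel.\<close>
  let ?M = "\<lambda>m. a ^ m / fact m * real (Suc m) ^ k"
  have bound: "norm (f m N) \<le> ?M m" if "N0 \<le> N" for m N
  proof (cases "m \<le> N")
    case True
    have b: "0 \<le> 1 - a / real (Suc N)" "1 - a / real (Suc N) \<le> 1" using that N0 a by auto
    have "real (N choose m) \<le> real N ^ m / fact m"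
    proof -
      have "real (fact m * (N choose m)) \<le> real (N ^ m)"
        using binomial_fact_lemma[OF True] by (intro of_nat_mono) (metis binomial_fact_pow mult.commute)
      then show ?thesis by (simp add: field_simps)
    qed
    also have "\<dots> \<le> real (Suc N) ^ m / fact m" by (intro divide_right_mono power_mono) auto
    finally have ch: "real (N choose m) \<le> real (Suc N) ^ m / fact m" .
    have "norm (f m N) = real (N choose m) * ((1 - a / real (Suc N)) ^ (N - m) * ((a / real (Suc N))
        ^ m * c m))"
      using True b c a by (simp add: f_def abs_mult power_abs del: of_nat_Suc)
    also have "\<dots> \<le> (real (Suc N) ^ m / fact m) * (1 * ((a / real (Suc N)) ^ m * real (Suc m) ^ k))"
      using ch b c a by (intro mult_mono power_le_one mult_nonneg_nonneg) auto
    also have "\<dots> = ?M m" by (simp add: power_divide del: of_nat_Suc)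
    finally show ?thesis .
  next
    case False
    then show ?thesis using a by (simp add: f_def)
  qed
  \<comment> \<open>Since (m + 1)^k <= k! exp (m + 1), the majorant lies below an exponential series
    at a exp 1.\<close>
  have "summable (\<lambda>m. (fact k * exp 1) * (inverse (fact m) * (a * exp 1) ^ m))"
    by (intro summable_mult summable_exp)
  then have summ: "summable ?M"
  proof (rule summable_comparison_test')
    fix m
    have "real (Suc m) ^ k \<le> fact k * exp (real (Suc m))" by (rule power_le_fact_exp) simp
    also have "exp (real (Suc m)) = exp 1 * exp 1 ^ m" by (simp add: exp_add exp_of_nat_mult[symmetric])
    finally have "?M m \<le> a ^ m / fact m * (fact k * (exp 1 * exp 1 ^ m))"
      using a by (intro mult_left_mono) auto
    also have "\<dots> = (fact k * exp 1) * (inverse (fact m) * (a * exp 1) ^ m)"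
      by (simp add: power_mult_distrib field_simps)
    finally show "norm (?M m) \<le> (fact k * exp 1) * (inverse (fact m) * (a * exp 1) ^ m)" using a by simp
  qed
  have "eventually (\<lambda>(m, N). norm (f m N) \<le> ?M m) (at_top \<times>\<^sub>F sequentially)"
    unfolding eventually_prod_filter
    using bound by (intro exI[of _ "\<lambda>_. True"] exI[of _ "\<lambda>N. N0 \<le> N"]) (auto simp: eventually_ge_at_top)
  from tannerys_theorem[OF lim this summ sequentially_bot]
  have "convergent (\<lambda>N. \<Sum>m. f m N)" by (auto simp: convergent_def)
  moreover have "(\<Sum>m. f m N) = (\<Sum>m\<le>N. real (N choose m) * ((1 - a / real (Suc N)) ^ (N - m) * ((a /
      real (Suc N)) ^ m * c m)))" for N
    by (subst suminf_finite[of "{..N}"]) (auto simp: f_def)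
  ultimately show ?thesis by simp
qed

section \<open>Convergence at a fixed scale\<close>

text \<open>Conditions on position and color of point j. A color other than 0 gives no share; color
  0 in an inner square of area v gives exactly Q; in the boundary strip of area 1 - v the share is
  nonnegative and obeys the crude bound.\<close>

lemma local_count_mean_bounds:
  fixes l :: real and s :: nat
  assumes j: "j < n" and l: "0 < l" and \<rho>: "0 < \<rho>" and K: "(real M ^ 2 + 2) * \<rho> \<le> K" and lK: "2 * (l
      * K) < 1"
  defines "Q \<equiv> (\<Sum>m\<le>n - 1. of_nat (n - 1 choose m) * (ennreal (1 - (2 * (l * K))\<^sup>2) ^ (n - 1 - m) *
       (ennreal ((2 * (l * K))\<^sup>2) ^ m * window_mean s M \<rho> K m)))"
    and "v \<equiv> (1 - 2 * (l * K))\<^sup>2"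
    and "T \<equiv> (\<integral>\<^sup>+z. ennreal (local_count s M {..<n} z (l * \<rho>) j) \<partial>(sample s {..<n}))"
  shows "Q * ennreal (v / real (Suc s)) \<le> T"
    and "T \<le> Q * ennreal (v / real (Suc s)) + ennreal ((4 * real n * (l * \<rho>)\<^sup>2) ^ s) * ennreal (1 - v)"
proof -
  define I where "I = {..<n} - {j}"
  define D where "D = (4 * real n * (l * \<rho>)\<^sup>2) ^ s"
  \<comment> \<open>The positions whose window of half side l K stays inside the unit square: a
    concentric square of side 1 - 2 l K.\<close>
  define S where "S = square ((1 / 2) *\<^sub>R 1) (1 / 2 - l * K)"
  have insI: "insert j I = {..<n}" "finite I" "j \<notin> I" using j by (auto simp: I_def)
  have "0 < (real M ^ 2 + 2) * \<rho>" using \<rho> by (intro mult_pos_pos) (auto intro: add_nonneg_pos)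
  then have K0: "0 < K" using K by linarith
  have lK0: "0 < l * K" using l K0 by simp
  interpret U: prob_space "unit_sample s" by (rule prob_space_unit_sample)
  interpret P: product_sigma_finite "\<lambda>_. unit_sample s" by standard
  have v: "0 \<le> v" "v \<le> 1" using lK lK0 unfolding v_def by (simp_all add: power_le_one)
  have Ssub: "S \<subseteq> cbox 0 1"
    using lK0 by (auto simp: S_def mem_square_iff mem_cbox_vec2 abs_le_iff)
  have sub: "square y (l * K) \<subseteq> cbox 0 1" if "y \<in> S" for y
    using that by (auto simp: S_def mem_square_iff mem_cbox_vec2 abs_le_iff)
  have [measurable]: "S \<in> sets borel" by (simp add: S_def)
  have eS: "emeasure lborel S = ennreal v"
    using lK unfolding S_def by (subst emeasure_square) (auto simp: v_def algebra_simps)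
  have A: "S \<times> {0} \<in> sets (unit_sample s)" "UNIV - S \<times> UNIV \<in> sets (unit_sample s)"
  proof -
    show "S \<times> {0} \<in> sets (unit_sample s)" by measurable
    have "S \<times> UNIV \<in> sets (unit_sample s)" by measurable
    then show "UNIV - S \<times> UNIV \<in> sets (unit_sample s)" using sets.compl_sets[of "S \<times> UNIV"
        "unit_sample s"] by simp
  qed
  have eA: "emeasure (unit_sample s) (S \<times> {0}) = ennreal (v / real (Suc s))"
  proof -
    have "emeasure (unit_sample s) (S \<times> {0}) = ennreal v * ennreal (1 / real (Suc s))"
      using Ssub by (subst emeasure_marked_uniform_Times)
        (auto simp: emeasure_unit_square divide_ennreal_def Int_absorb1 eS emeasure_pmf_of_set_single)
    also have "\<dots> = ennreal (v / real (Suc s))"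
      using v by (simp add: ennreal_mult[symmetric] del: of_nat_Suc)
    finally show ?thesis .
  qed
  have eN: "emeasure (unit_sample s) (UNIV - S \<times> UNIV) = ennreal (1 - v)"
  proof -
    have "emeasure (unit_sample s) (S \<times> UNIV) = ennreal v"
      using Ssub by (subst emeasure_marked_uniform_Times)
        (auto simp: emeasure_unit_square divide_ennreal_def Int_absorb1 eS)
    moreover have "S \<times> UNIV \<in> sets (unit_sample s)" by measurable
    then have "emeasure (unit_sample s) (space (unit_sample s) - S \<times> UNIV) =
        emeasure (unit_sample s) (space (unit_sample s)) - emeasure (unit_sample s) (S \<times> UNIV)"
      by (intro emeasure_compl) auto
    ultimately show ?thesis using U.emeasure_space_1 v by (simp add: ennreal_minus flip: ennreal_1)
  qed
  let ?\<Psi> = "\<lambda>w. \<integral>\<^sup>+z. ennreal (local_count s M {..<n} (z(j := w)) (l * \<rho>) j) \<partial>(sample s I)"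
  have T: "T = (\<integral>\<^sup>+w. ?\<Psi> w \<partial>unit_sample s)"
  proof -
    have "(\<lambda>z. ennreal (local_count s M (insert j I) z (l * \<rho>) j)) \<in> borel_measurable (sample s
        (insert j I))"
    proof -
      have "(\<lambda>z. local_count s M (insert j I) z (l * \<rho>) j) \<in> borel_measurable (sample s (insert j I))"
        by (subst measurable_cong_sets[OF sets_PiM_marked refl], rule measurable_local_count) (use
            insI in simp)
      then show ?thesis by measurable
    qed
    from P.product_nn_integral_insert_rev[OF insI(2,3) this] show ?thesis
      unfolding T_def insI(1) .
  qed
  have int: "?\<Psi> (y, c) = (if c = 0 then Q else 0)" if "y \<in> S" for y c
  proof (cases "c = 0")
    case True
    then show ?thesis
      using local_count_interior[OF j l \<rho> K sub[OF that], of s] by (simp add: Q_def I_def)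
  next
    case False
    then show ?thesis using local_count_color[of "z(j := (y, c))" j for z] by simp
  qed
  have all: "?\<Psi> w \<le> ennreal D" for w
    unfolding I_def D_def using l \<rho> by (intro local_count_expectation_le[OF j]) simp
  have "(\<integral>\<^sup>+w. Q * indicator (S \<times> {0}) w \<partial>unit_sample s) \<le> T"
    unfolding T
  proof (rule nn_integral_mono)
    fix w :: "(real^2) \<times> nat"
    show "Q * indicator (S \<times> {0}) w \<le> ?\<Psi> w"
    proof (cases "fst w \<in> S")
      case True
      then show ?thesis using int[OF True, of "snd w"] by (simp add: indicator_def mem_Times_iff)
    qed (simp add: indicator_def mem_Times_iff)
  qed
  then show "Q * ennreal (v / real (Suc s)) \<le> T"
    using A by (simp add: nn_integral_cmult_indicator eA)
  have "T \<le> (\<integral>\<^sup>+w. Q * indicator (S \<times> {0}) w + ennreal D * indicator (UNIV - S \<times> UNIV) w \<partial>unit_sample s)"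
    unfolding T
  proof (rule nn_integral_mono)
    fix w :: "(real^2) \<times> nat"
    show "?\<Psi> w \<le> Q * indicator (S \<times> {0}) w + ennreal D * indicator (UNIV - S \<times> UNIV) w"
    proof (cases "fst w \<in> S")
      case True
      then show ?thesis using int[OF True, of "snd w"] by (simp add: indicator_def mem_Times_iff)
    next
      case False
      then show ?thesis using all[of w] by (simp add: indicator_def mem_Times_iff)
    qed
  qed
  also have "\<dots> = Q * ennreal (v / real (Suc s)) + ennreal D * ennreal (1 - v)"
    using A by (subst nn_integral_add) (auto simp: nn_integral_cmult_indicator eA eN)
  finally show "T \<le> Q * ennreal (v / real (Suc s)) + ennreal ((4 * real n * (l * \<rho>)\<^sup>2) ^ s) *
      ennreal (1 - v)"
    unfolding D_def .
qed

text \<open>The limit L may change with M. For large N the sequence stays within about A / M of it,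
  so its oscillation tends to 0 and it is Cauchy.\<close>

lemma convergent_if_squeezed:
  fixes x :: "nat \<Rightarrow> real"
  assumes A: "0 \<le> A"
    and sq: "\<And>M. 0 < M \<Longrightarrow> \<exists>u w L. u \<longlonglongrightarrow> L \<and> w \<longlonglongrightarrow> L \<and>
      eventually (\<lambda>N. u N \<le> x N \<and> x N \<le> w N + A / real M) sequentially"
  shows "convergent x"
proof (rule Cauchy_convergent, rule metric_CauchyI)
  fix e :: real assume e: "0 < e"
  obtain M0 :: nat where M0: "8 * A / e < real M0" using reals_Archimedean2 by blast
  define M where "M = Suc M0"
  have "8 * A / e < real M" using M0 by (simp add: M_def)
  then have AM: "A / real M < e / 4" using e A by (simp add: field_simps M_def del: of_nat_Suc)
  obtain u w L where L: "u \<longlonglongrightarrow> L" "w \<longlonglongrightarrow> L"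
    and ev: "eventually (\<lambda>N. u N \<le> x N \<and> x N \<le> w N + A / real M) sequentially"
    using sq[of M] by (auto simp: M_def)
  have "eventually (\<lambda>N. dist (u N) L < e / 4) sequentially" "eventually (\<lambda>N. dist (w N) L < e / 4)
      sequentially"
    using tendstoD[OF L(1), of "e / 4"] tendstoD[OF L(2), of "e / 4"] e by auto
  with ev have "eventually (\<lambda>N. \<bar>x N - L\<bar> < e / 2) sequentially"
    by eventually_elim (use AM in \<open>unfold dist_real_def, linarith\<close>)
  then obtain N0 where N0: "\<And>N. N0 \<le> N \<Longrightarrow> \<bar>x N - L\<bar> < e / 2" by (auto simp: eventually_sequentially)
  have "dist (x m) (x n) < e" if "N0 \<le> m" "N0 \<le> n" for m n
    using N0[OF that(1)] N0[OF that(2)] unfolding dist_real_def by linarith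
  then show "\<exists>N. \<forall>m\<ge>N. \<forall>n\<ge>N. dist (x m) (x n) < e" by blast
qed

section \<open>Bounds on the expected number of merges\<close>

definition expected_merges :: "nat \<Rightarrow> nat \<Rightarrow> real \<Rightarrow> ennreal" where
  "expected_merges s n t =
     (\<integral>\<^sup>+z. of_nat (num_components (lune_graph s {..<n} z t) - 1) \<partial>(sample s {..<n}))"

lemma measurable_num_components:
  fixes F :: "_ \<Rightarrow> 'b :: topological_space"
  shows "(\<lambda>z. F (lune_graph s {..<n} z t)) \<in> borel_measurable (sample s {..<n})"
  by (subst measurable_cong_sets[OF sets_PiM_marked refl], rule measurable_lune_graph_fixed) simp

text \<open>The summand 1 on the lower side is the price of k - 1 against k, and the node count over
  M that of the cutoff. The first disappears after division by n, the second as M grows.\<close>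

lemma expected_num_components_bounds:
  fixes s n :: nat and t :: real
  assumes M: "0 < M"
  defines "L \<equiv> (\<Sum>j<n. \<integral>\<^sup>+z. ennreal (local_count s M {..<n} z t j) \<partial>(sample s {..<n}))"
  shows "L \<le> expected_merges s n t + 1"
    and "expected_merges s n t \<le> L + (\<integral>\<^sup>+z. of_nat (card (Domain (lune_graph s {..<n} z t)))
        \<partial>(sample s {..<n})) / of_nat M"
proof -
  let ?P = "sample s {..<n}"
  interpret P: prob_space ?P by (intro prob_space_PiM prob_space_unit_sample)
  have mlc: "(\<lambda>z. ennreal (local_count s M {..<n} z t j)) \<in> borel_measurable ?P" for j
  proof -
    have "(\<lambda>z. local_count s M {..<n} z t j) \<in> borel_measurable ?P"
      by (subst measurable_cong_sets[OF sets_PiM_marked refl], rule measurable_local_count) simp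
    then show ?thesis by measurable
  qed
  have L: "L = (\<integral>\<^sup>+z. ennreal (\<Sum>j<n. local_count s M {..<n} z t j) \<partial>?P)"
    unfolding L_def by (subst nn_integral_sum[symmetric], rule mlc) (simp add: sum_ennreal
        local_count_nonneg)
  have "L \<le> (\<integral>\<^sup>+z. of_nat (num_components (lune_graph s {..<n} z t) - 1) + 1 \<partial>?P)"
    unfolding L
  proof (rule nn_integral_mono)
    fix z :: config
    have "(\<Sum>j<n. local_count s M {..<n} z t j) \<le> real (num_components (lune_graph s {..<n} z t))"
      by (rule sum_local_count(1)[OF finite_lessThan M])
    also have "\<dots> \<le> real (num_components (lune_graph s {..<n} z t) - 1) + 1" by linarith
    finally have "ennreal (\<Sum>j<n. local_count s M {..<n} z t j) \<le> ennreal (real (num_components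
        (lune_graph s {..<n} z t) - 1) + 1)"
      by (rule ennreal_leI)
    then show "ennreal (\<Sum>j<n. local_count s M {..<n} z t j) \<le> of_nat (num_components (lune_graph s
        {..<n} z t) - 1) + 1"
      by (simp add: ennreal_plus ennreal_of_nat_eq_real_of_nat del: of_nat_diff)
  qed
  also have "\<dots> = expected_merges s n t + 1"
    unfolding expected_merges_def
    by (subst nn_integral_add) (auto simp: P.emeasure_space_1 intro: measurable_num_components)
  finally show "L \<le> expected_merges s n t + 1" .
  have "expected_merges s n t \<le> (\<integral>\<^sup>+z. ennreal (\<Sum>j<n. local_count s M {..<n} z t j) +
     of_nat (card (Domain (lune_graph s {..<n} z t))) / of_nat M \<partial>?P)"
    unfolding expected_merges_def
  proof (rule nn_integral_mono)
    fix z :: config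
    have "real (num_components (lune_graph s {..<n} z t) - 1) \<le> real (num_components (lune_graph s
        {..<n} z t))" by simp
    also have "\<dots> \<le> (\<Sum>j<n. local_count s M {..<n} z t j) + real (card (Domain (lune_graph s {..<n} z
        t))) / real M"
      by (rule sum_local_count(2)[OF finite_lessThan M])
    finally have "ennreal (real (num_components (lune_graph s {..<n} z t) - 1)) \<le>
      ennreal ((\<Sum>j<n. local_count s M {..<n} z t j) + real (card (Domain (lune_graph s {..<n} z t)))
          / real M)"
      by (rule ennreal_leI)
    also have "\<dots> = ennreal (\<Sum>j<n. local_count s M {..<n} z t j) + ennreal (real (card (Domain
        (lune_graph s {..<n} z t))) / real M)"
      by (rule ennreal_plus) (auto intro: sum_nonneg local_count_nonneg)
    also have "ennreal (real (card (Domain (lune_graph s {..<n} z t))) / real M) =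
        of_nat (card (Domain (lune_graph s {..<n} z t))) / of_nat M"
      using M by (simp add: divide_ennreal ennreal_of_nat_eq_real_of_nat)
    finally show "of_nat (num_components (lune_graph s {..<n} z t) - 1) \<le> ennreal (\<Sum>j<n. local_count
        s M {..<n} z t j) +
     of_nat (card (Domain (lune_graph s {..<n} z t))) / of_nat M"
      unfolding ennreal_of_nat_eq_real_of_nat .
  qed
  also have "\<dots> = L + (\<integral>\<^sup>+z. of_nat (card (Domain (lune_graph s {..<n} z t))) / of_nat M \<partial>?P)"
    unfolding L
  proof (rule nn_integral_add)
    show "(\<lambda>z. ennreal (\<Sum>j<n. local_count s M {..<n} z t j)) \<in> borel_measurable ?P"
    proof -
      have "(\<lambda>z. \<Sum>j<n. ennreal (local_count s M {..<n} z t j)) \<in> borel_measurable ?P"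
        using mlc by (intro borel_measurable_sum)
      then show ?thesis by (simp add: sum_ennreal local_count_nonneg)
    qed
    show "(\<lambda>z. of_nat (card (Domain (lune_graph s {..<n} z t))) / of_nat M :: ennreal) \<in>
        borel_measurable ?P"
      by (rule measurable_num_components)
  qed
  also have "(\<integral>\<^sup>+z. of_nat (card (Domain (lune_graph s {..<n} z t))) / of_nat M \<partial>?P) =
     (\<integral>\<^sup>+z. of_nat (card (Domain (lune_graph s {..<n} z t))) \<partial>?P) / of_nat M"
    by (rule nn_integral_divide) (rule measurable_num_components)
  finally show "expected_merges s n t \<le> L + (\<integral>\<^sup>+z. of_nat (card (Domain (lune_graph s {..<n} z t)))
      \<partial>?P) / of_nat M" .
qed

text \<open>After division by n both sides of the squeeze tend to q0 / (s + 1), as the boundary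
  strip and the term 1 / n vanish. Only A / M survives, where n A is the node bound at this
  scale.\<close>

lemma expected_merges_convergent:
  assumes \<rho>: "0 < \<rho>"
  shows "convergent (\<lambda>N. enn2real (expected_merges s (Suc N) (\<rho> / sqrt (real (Suc N)))) / real (Suc N))"
proof (rule convergent_if_squeezed)
  define A where "A = 36 / \<rho>\<^sup>2 * (4 * \<rho>\<^sup>2) ^ Suc s"
  show "0 \<le> A" by (simp add: A_def)
  fix M :: nat assume M: "0 < M"
  \<comment> \<open>In units of 1 / sqrt n this is the radius from \<open>local_count_local\<close>.
    The window then has area (2 K)^2 / n, so (2 K)^2 is the Poisson parameter.\<close>
  define K where "K = (real M ^ 2 + 2) * \<rho>"
  have K0: "0 < K" unfolding K_def using \<rho> by (intro mult_pos_pos) (auto intro: add_nonneg_pos)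
  define a where "a = (2 * K)\<^sup>2"
  define c where "c m = enn2real (window_mean s M \<rho> K m)" for m
  have wm: "window_mean s M \<rho> K m = ennreal (c m)" for m
    unfolding c_def using window_mean_le[OF K0, of s M \<rho> m]
    by (intro ennreal_enn2real[symmetric]) (auto simp: top_unique intro: le_less_trans)
  have c: "0 \<le> c m" "c m \<le> real (Suc m) ^ Suc s" for m
  proof -
    show "0 \<le> c m" by (simp add: c_def)
    show "c m \<le> real (Suc m) ^ Suc s"
      using window_mean_le[OF K0, of s M \<rho> m] unfolding wm by (subst (asm) ennreal_le_iff) auto
  qed
  define q where "q N = (\<Sum>m\<le>N. real (N choose m) * ((1 - a / real (Suc N)) ^ (N - m) * ((a / real
      (Suc N)) ^ m * c m)))" for N
  define l where "l N = 1 / sqrt (real (Suc N))" for N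
  define v where "v N = (1 - 2 * (l N * K))\<^sup>2" for N
  define D where "D = (4 * \<rho>\<^sup>2) ^ s"
  have "convergent q"
    unfolding q_def using binomial_mean_convergent[of a c "Suc s"] K0 c by (simp add: a_def)
  then obtain q0 where q0: "q \<longlonglongrightarrow> q0" by (auto simp: convergent_def)
  have l0: "l \<longlonglongrightarrow> 0"
  proof -
    have "filterlim (\<lambda>N. sqrt (real (Suc N))) at_top sequentially"
      by (rule filterlim_compose[OF sqrt_at_top]) (rule filterlim_compose[OF
          filterlim_real_sequentially filterlim_Suc])
    then show ?thesis unfolding l_def by (rule real_tendsto_divide_at_top[OF tendsto_const])
  qed
  have v1: "v \<longlonglongrightarrow> 1"
  proof -
    have "v \<longlonglongrightarrow> (1 - 2 * (0 * K))\<^sup>2" unfolding v_def by (intro tendsto_intros l0)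
    then show ?thesis by simp
  qed
  define u where "u N = q N * (v N / real (Suc s)) - 1 / real (Suc N)" for N
  define w where "w N = q N * (v N / real (Suc s)) + D * (1 - v N)" for N
  have inv0: "(\<lambda>N. 1 / real (Suc N)) \<longlonglongrightarrow> 0"
    using LIMSEQ_Suc[OF lim_const_over_n[of 1]] by simp
  have "u \<longlonglongrightarrow> q0 * (1 / real (Suc s)) - 0"
    unfolding u_def by (intro tendsto_diff tendsto_mult tendsto_divide q0 v1 tendsto_const inv0) simp
  moreover have "w \<longlonglongrightarrow> q0 * (1 / real (Suc s)) + D * (1 - 1)"
    unfolding w_def by (intro tendsto_add tendsto_diff tendsto_mult tendsto_divide q0 v1
        tendsto_const) simp
  moreover have "eventually (\<lambda>N. u N \<le> enn2real (expected_merges s (Suc N) (\<rho> / sqrt (real (Suc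
      N)))) / real (Suc N) \<and>
     enn2real (expected_merges s (Suc N) (\<rho> / sqrt (real (Suc N)))) / real (Suc N) \<le> w N + A / real
         M) sequentially"
  proof -
    have lK0: "(\<lambda>N. 2 * (l N * K)) \<longlonglongrightarrow> 2 * (0 * K)" "(\<lambda>N. l N * \<rho>) \<longlonglongrightarrow> 0 * \<rho>"
      by (intro tendsto_intros l0)+
    \<comment> \<open>For large N the window fits into the square and the threshold lies in the
      range of the grid bounds.\<close>
    have "eventually (\<lambda>N. 2 * (l N * K) < 1) sequentially" "eventually (\<lambda>N. l N * \<rho> < 3) sequentially"
      using order_tendstoD(2)[OF lK0(1), of 1] order_tendstoD(2)[OF lK0(2), of 3] by simp_all
    then show ?thesis
    proof eventually_elim
      case (elim N)
      define n where "n = Suc N"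
      define t where "t = l N * \<rho>"
      have n0: "0 < n" "n - 1 = N" by (simp_all add: n_def)
      have lN: "0 < l N" by (simp add: l_def)
      have t: "0 < t" "t \<le> 3" "t = \<rho> / sqrt (real n)" using lN \<rho> elim by (auto simp: t_def l_def n_def)
      have nt: "real n * t\<^sup>2 = \<rho>\<^sup>2" "4 * real n * t\<^sup>2 = 4 * \<rho>\<^sup>2" unfolding t(3) using n0 by
          (simp_all add: power_divide)
      have p: "(2 * (l N * K))\<^sup>2 = a / real n"
        by (simp add: l_def a_def n_def power_mult_distrib power_divide)
      have p1: "a / real n \<le> 1"
        unfolding p[symmetric] using elim(1) lN K0 by (intro power_le_one) auto
      have a0: "0 \<le> a / real n" by (simp add: a_def)
      have v01: "0 \<le> v N" "v N \<le> 1" using elim(1) lN K0 unfolding v_def by (auto intro!: power_le_one)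
      have q0: "0 \<le> q N" unfolding q_def n_def[symmetric] using p1 a0 c
        by (intro sum_nonneg mult_nonneg_nonneg zero_le_power) auto
      have D0: "0 \<le> D" by (simp add: D_def)
      have Q: "(\<Sum>m\<le>n - 1. of_nat (n - 1 choose m) * (ennreal (1 - (2 * (l N * K))\<^sup>2) ^ (n - 1 - m) *
       (ennreal ((2 * (l N * K))\<^sup>2) ^ m * window_mean s M \<rho> K m))) = ennreal (q N)"
      proof -
        have "of_nat (N choose m) * (ennreal (1 - a / real n) ^ (N - m) * (ennreal (a / real n) ^ m
            * ennreal (c m))) =
          ennreal (real (N choose m) * ((1 - a / real n) ^ (N - m) * ((a / real n) ^ m * c m)))" for m
          using p1 a0 c(1)[of m]
          by (simp only: ennreal_of_nat_eq_real_of_nat ennreal_power ennreal_mult zero_le_power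
              diff_ge_0_iff_ge mult_nonneg_nonneg of_nat_0_le_iff)
        then show ?thesis
          unfolding n0(2) p wm q_def n_def[symmetric] using p1 a0 c
          by (subst sum_ennreal[symmetric]) (auto intro!: mult_nonneg_nonneg zero_le_power)
      qed
      define E where "E = expected_merges s n t"
      define L where "L = (\<Sum>j<n. \<integral>\<^sup>+z. ennreal (local_count s M {..<n} z t j) \<partial>(sample s {..<n}))"
      let ?qv = "q N * (v N / real (Suc s))"
      have qv0: "0 \<le> ?qv" using q0 v01 by simp
      have each: "ennreal ?qv \<le> (\<integral>\<^sup>+z. ennreal (local_count s M {..<n} z t j) \<partial>(sample s {..<n}))"
        "(\<integral>\<^sup>+z. ennreal (local_count s M {..<n} z t j) \<partial>(sample s {..<n})) \<le> ennreal (w N)" if "j <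
            n" for j
      proof -
        note b = local_count_mean_bounds[OF that lN \<rho> _ elim(1), of M s, unfolded K_def[symmetric],
            OF order_refl, unfolded Q v_def[symmetric] t_def[symmetric] nt]
        have e1: "ennreal (q N) * ennreal (v N / real (Suc s)) = ennreal ?qv"
          using q0 v01 by (intro ennreal_mult[symmetric]) auto
        have e2: "ennreal ?qv + ennreal ((4 * \<rho>\<^sup>2) ^ s) * ennreal (1 - v N) = ennreal (w N)"
          unfolding w_def D_def[symmetric] using qv0 v01 D0
          by (subst ennreal_plus) (auto simp: ennreal_mult)
        show "ennreal ?qv \<le> (\<integral>\<^sup>+z. ennreal (local_count s M {..<n} z t j) \<partial>(sample s {..<n}))"
          using b(1) unfolding e1 .
        show "(\<integral>\<^sup>+z. ennreal (local_count s M {..<n} z t j) \<partial>(sample s {..<n})) \<le> ennreal (w N)"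
          using b(2) unfolding e1 e2 .
      qed
      have w0: "0 \<le> w N" using qv0 D0 v01 by (simp add: w_def)
      have "ennreal (real n * ?qv) = (\<Sum>j<n. ennreal ?qv)"
        using qv0 by (simp only: sum_constant card_lessThan ennreal_of_nat_eq_real_of_nat
            ennreal_mult of_nat_0_le_iff)
      also have "\<dots> \<le> L" unfolding L_def using each(1) by (intro sum_mono) auto
      also have "\<dots> \<le> E + 1" unfolding L_def E_def by (rule expected_num_components_bounds(1)[OF M])
      finally have lo: "ennreal (real n * ?qv) \<le> E + 1" .
      have "L \<le> (\<Sum>j<n. ennreal (w N))" unfolding L_def using each(2) by (intro sum_mono) auto
      also have "\<dots> = ennreal (real n * w N)"
        using w0 by (simp add: ennreal_of_nat_eq_real_of_nat ennreal_mult)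
      finally have Lw: "L \<le> ennreal (real n * w N)" .
      have A: "36 / t\<^sup>2 * (4 * real n * t\<^sup>2) ^ Suc s = real n * A"
        unfolding nt A_def t(3) using n0 by (simp add: power_divide)
      have A0: "0 \<le> A" by (simp add: A_def)
      have "E \<le> L + (\<integral>\<^sup>+z. of_nat (card (Domain (lune_graph s {..<n} z t))) \<partial>(sample s {..<n})) /
          of_nat M"
        unfolding L_def E_def by (rule expected_num_components_bounds(2)[OF M])
      also have "\<dots> \<le> ennreal (real n * w N) + ennreal (real n * A) / of_nat M"
        using nn_integral_card_Domain_le[OF t(1,2), where n = n and s = s] unfolding A
        by (intro add_mono Lw divide_right_mono_ennreal)
      also have "\<dots> = ennreal (real n * w N + real n * A / real M)"
        using M w0 A0 by (simp add: ennreal_of_nat_eq_real_of_nat divide_ennreal ennreal_plus)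
      finally have hi: "E \<le> ennreal (real n * w N + real n * A / real M)" .
      define x where "x = enn2real E"
      have x0: "0 \<le> x" by (simp add: x_def)
      have Ex: "E = ennreal x"
        unfolding x_def using hi by (intro ennreal_enn2real[symmetric]) (auto simp: top_unique
            intro: le_less_trans)
      have h0: "0 \<le> real n * w N + real n * A / real M" using w0 A0 by simp
      have "x \<le> real n * w N + real n * A / real M"
        using hi h0 unfolding Ex by (simp add: ennreal_le_iff)
      then have "x \<le> real n * (w N + A / real M)" by (simp add: distrib_left)
      then have xhi: "x / real n \<le> w N + A / real M" using n0 by (simp add: divide_le_eq mult.commute)
      have "ennreal (real n * ?qv) \<le> ennreal (x + 1)" 
        using lo unfolding Ex by (simp only: ennreal_plus[OF x0 zero_le_one] ennreal_1)
      moreover have "0 \<le> x + 1" using x0 by simp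
      ultimately have "real n * ?qv \<le> x + 1" by (simp only: ennreal_le_iff)
      then have "?qv \<le> (x + 1) / real n" using n0 by (simp add: pos_le_divide_eq mult.commute)
      then have xlo: "u N \<le> x / real n" by (simp add: u_def n_def add_divide_distrib)
      show ?case using xlo xhi unfolding x_def E_def t(3) n_def by simp
    qed
  qed
  ultimately show "\<exists>u w L. u \<longlonglongrightarrow> L \<and> w \<longlonglongrightarrow> L \<and>
      eventually (\<lambda>N. u N \<le> enn2real (expected_merges s (Suc N) (\<rho> / sqrt (real (Suc N)))) / real
          (Suc N) \<and>
        enn2real (expected_merges s (Suc N) (\<rho> / sqrt (real (Suc N)))) / real (Suc N) \<le> w N + A /
            real M) sequentially"
    by (intro exI[of _ u] exI[of _ w] exI[of _ "q0 * (1 / real (Suc s))"]) simp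
qed

section \<open>The limit theorem\<close>

text \<open>A uniform coloring is a family of independent uniform colors: on rectangles, the sum
  over all colorings of a product over the points factors into a product of sums over the colors. So
  points and coloring together have the law of independent colored points.\<close>

lemma distr_colored_sample:
  "distr (colored_sample s n) (sample s {..<n}) (\<lambda>\<omega>. \<lambda>j\<in>{..<n}. (fst \<omega> j, snd \<omega> j)) =
    (sample s {..<n})" (is "?D = ?P")
  and measurable_mark:
  "(\<lambda>\<omega>. \<lambda>j\<in>{..<n}. (fst \<omega> j, snd \<omega> j)) \<in> colored_sample s n \<rightarrow>\<^sub>M (sample s {..<n})"
proof -
  let ?U = "uniform_measure lborel (cbox (0 :: real^2) 1)"
  let ?PU = "\<Pi>\<^sub>M j\<in>{..<n}. ?U"
  let ?F = "{..<n} \<rightarrow>\<^sub>E {..s}"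
  let ?mark = "\<lambda>\<omega> :: (nat \<Rightarrow> real^2) \<times> (nat \<Rightarrow> nat). \<lambda>j\<in>{..<n}. (fst \<omega> j, snd \<omega> j)"
  define r where "r = ennreal (1 / real (Suc s))"
  have finF: "finite ?F" by (simp add: finite_PiE)
  have cardF: "card ?F = Suc s ^ n" by (simp add: card_PiE)
  have Uprob: "prob_space ?U"
    by (rule prob_space_uniform_measure) (simp_all add: emeasure_unit_square)
  interpret U: prob_space ?U by (rule Uprob)
  interpret PU: product_sigma_finite "\<lambda>_. ?U" by standard
  interpret M: prob_space "unit_sample s" by (rule prob_space_unit_sample)
  interpret P: product_sigma_finite "\<lambda>_. unit_sample s" by standard
  interpret PUp: prob_space ?PU by (rule prob_space_PiM) (rule Uprob)
  have "prob_space (uniform_count_measure ?F)"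
    by (rule prob_space_uniform_count_measure) (auto intro: finite_PiE simp: PiE_eq_empty_iff)
  then interpret C: prob_space "uniform_count_measure ?F" .
  interpret pair: pair_sigma_finite ?PU "uniform_count_measure ?F" by unfold_locales
  interpret marked: pair_sigma_finite ?U "measure_pmf (pmf_of_set {..s})" by unfold_locales
  show mark: "?mark \<in> colored_sample s n \<rightarrow>\<^sub>M (sample s {..<n})"
  proof (rule measurable_restrict)
    fix j assume j: "j \<in> {..<n}"
    have "(\<lambda>\<omega>. fst \<omega> j) \<in> colored_sample s n \<rightarrow>\<^sub>M ?U"
      unfolding colored_sample_def
      by (rule measurable_compose[OF measurable_fst measurable_component_singleton]) (rule j)
    then have 1: "(\<lambda>\<omega>. fst \<omega> j) \<in> colored_sample s n \<rightarrow>\<^sub>M borel"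
      by (simp cong: measurable_cong_sets)
    have "(\<lambda>\<kappa>. \<kappa> j) \<in> uniform_count_measure ?F \<rightarrow>\<^sub>M count_space UNIV"
      by (simp cong: measurable_cong_sets add: sets_uniform_count_measure_count_space)
    then have 2: "(\<lambda>\<omega>. snd \<omega> j) \<in> colored_sample s n \<rightarrow>\<^sub>M count_space UNIV"
      unfolding colored_sample_def by (rule measurable_compose[OF measurable_snd])
    show "(\<lambda>\<omega>. (fst \<omega> j, snd \<omega> j)) \<in> colored_sample s n \<rightarrow>\<^sub>M unit_sample s"
      by (subst measurable_cong_sets[OF refl sets_marked_uniform]) (rule measurable_Pair[OF 1 2])
  qed
  show "?D = ?P"
  proof (rule P.PiM_eqI)
    fix A :: "nat \<Rightarrow> ((real^2) \<times> nat) set" assume A: "\<And>i. i \<in> {..<n} \<Longrightarrow> A i \<in> sets (unit_sample s)"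
    define a where "a j c = (\<integral>\<^sup>+x. indicator (A j) (x, c) \<partial>?U)" for j c
    have Am: "indicator (A j) \<in> borel_measurable (?U \<Otimes>\<^sub>M measure_pmf (pmf_of_set {..s}))" if "j < n"
        for j
      using A[of j] that by (simp add: marked_uniform_def)
    have Ac: "(\<lambda>x. indicator (A j) (x, c) :: ennreal) \<in> borel_measurable ?U" if "j < n" for j c
      using measurable_compose[OF measurable_Pair2' Am[OF that], of c] by simp
    have eA: "emeasure (unit_sample s) (A j) = r * (\<Sum>c\<le>s. a j c)" if "j < n" for j
    proof -
      have "emeasure (unit_sample s) (A j) = (\<integral>\<^sup>+w. indicator (A j) w \<partial>unit_sample s)"
        using A[of j] that by simp
      also have "\<dots> = (\<integral>\<^sup>+c. a j c \<partial>measure_pmf (pmf_of_set {..s}))"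
        unfolding marked_uniform_def a_def by (rule marked.nn_integral_snd[OF Am[OF that], symmetric])
      also have "\<dots> = (\<Sum>c\<le>s. a j c) / of_nat (Suc s)"
        by (subst nn_integral_pmf_of_set) auto
      also have "\<dots> = r * (\<Sum>c\<le>s. a j c)"
        unfolding r_def divide_ennreal_def ennreal_of_nat_eq_real_of_nat
        by (subst inverse_ennreal) (auto simp: inverse_eq_divide mult.commute simp del: of_nat_Suc)
      finally show ?thesis .
    qed
    have PA: "Pi\<^sub>E {..<n} A \<in> sets ?P" using A by (intro sets_PiM_I_finite) auto
    have "emeasure ?D (Pi\<^sub>E {..<n} A) = (\<integral>\<^sup>+\<omega>. indicator (Pi\<^sub>E {..<n} A) (?mark \<omega>) \<partial>colored_sample s n)"
      using PA nn_integral_distr[OF mark, of "indicator (Pi\<^sub>E {..<n} A)"] by simp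
    also have "\<dots> = (\<integral>\<^sup>+\<omega>. (\<Prod>j<n. indicator (A j) (fst \<omega> j, snd \<omega> j)) \<partial>colored_sample s n)"
    proof (rule nn_integral_cong)
      fix \<omega> :: "(nat \<Rightarrow> real^2) \<times> (nat \<Rightarrow> nat)"
      show "indicator (Pi\<^sub>E {..<n} A) (?mark \<omega>) = (\<Prod>j<n. indicator (A j) (fst \<omega> j, snd \<omega> j) :: ennreal)"
      proof (cases "\<forall>j<n. (fst \<omega> j, snd \<omega> j) \<in> A j")
        case True
        then have "?mark \<omega> \<in> Pi\<^sub>E {..<n} A" by auto
        then show ?thesis using True by simp
      next
        case False
        then obtain j where j: "j < n" "(fst \<omega> j, snd \<omega> j) \<notin> A j" by blast
        then have "?mark \<omega> \<notin> Pi\<^sub>E {..<n} A" by (auto simp: PiE_iff)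
        moreover have "(\<Prod>j<n. indicator (A j) (fst \<omega> j, snd \<omega> j) :: ennreal) = 0"
          using j by (intro prod_zero bexI[of _ j]) auto
        ultimately show ?thesis by simp
      qed
    qed
    also have "\<dots> = (\<integral>\<^sup>+\<kappa>. (\<integral>\<^sup>+X. (\<Prod>j<n. indicator (A j) (X j, \<kappa> j)) \<partial>?PU) \<partial>uniform_count_measure ?F)"
    proof -
      have "(\<lambda>\<omega>. \<Prod>j<n. indicator (A j) (fst \<omega> j, snd \<omega> j) :: ennreal) \<in> borel_measurable
          (colored_sample s n)"
      proof (rule borel_measurable_prod_ennreal)
        fix j assume j: "j \<in> {..<n}"
        have "(\<lambda>\<omega>. ?mark \<omega> j) \<in> colored_sample s n \<rightarrow>\<^sub>M unit_sample s"
          by (rule measurable_compose[OF mark measurable_component_singleton[OF j]])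
        then have "(\<lambda>\<omega>. indicator (A j) (?mark \<omega> j) :: ennreal) \<in> borel_measurable (colored_sample s n)"
          by (rule measurable_compose) (use A[OF j] in simp)
        then show "(\<lambda>\<omega>. indicator (A j) (fst \<omega> j, snd \<omega> j) :: ennreal) \<in> borel_measurable
            (colored_sample s n)"
          using j by simp
      qed
      from pair.nn_integral_snd[OF this[unfolded colored_sample_def]] show ?thesis
        unfolding colored_sample_def by simp
    qed
    also have "\<dots> = (\<integral>\<^sup>+\<kappa>. (\<Prod>j<n. a j (\<kappa> j)) \<partial>uniform_count_measure ?F)"
      unfolding a_def using Ac
      by (intro nn_integral_cong PU.product_nn_integral_prod) auto
    also have "\<dots> = (\<Sum>\<kappa>\<in>?F. ennreal (1 / real (card ?F)) * (\<Prod>j<n. a j (\<kappa> j)))"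
      unfolding uniform_count_measure_def by (rule nn_integral_point_measure_finite[OF finF])
    also have "\<dots> = ennreal (1 / real (card ?F)) * (\<Prod>j<n. \<Sum>c\<le>s. a j c)"
      by (simp add: prod_sum_PiE sum_distrib_left)
    also have "ennreal (1 / real (card ?F)) = r ^ n"
      unfolding cardF r_def by (simp add: ennreal_power power_one_over del: of_nat_Suc)
    also have "r ^ n * (\<Prod>j<n. \<Sum>c\<le>s. a j c) = (\<Prod>j<n. emeasure (unit_sample s) (A j))"
      by (simp add: eA prod.distrib)
    finally show "emeasure ?D (Pi\<^sub>E {..<n} A) = (\<Prod>j<n. emeasure (unit_sample s) (A j))" .
  qed simp_all
qed

lemma lunar_cost_nonneg:
  fixes z :: config
  assumes "\<And>i. A i = {fst (z j) | j. j \<in> I \<and> snd (z j) = i}" and "finite I"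
  shows "0 \<le> lunar_cost s A"
proof -
  have "has_bochner_integral lborel
     (\<lambda>t. indicator {0..} t * real (num_components (lune_graph s I z t) - 1)) (lunar_cost s A)"
    by (rule lunar_cost_integral) (rule assms)+
  from has_bochner_integral_integral_eq[OF this, symmetric] show ?thesis by simp
qed

text \<open>Tonelli for the integral over thresholds. The expectation is a Bochner integral, which
  by convention is 0 for a function that is not integrable; the finiteness assumption excludes
  this.\<close>

lemma expected_lunar_cost_eq:
  "ennreal (expected_lunar_cost s n) = (\<integral>\<^sup>+t. indicator {0..} t * expected_merges s n t \<partial>lborel)"
  if fin: "(\<integral>\<^sup>+t. indicator {0..} t * expected_merges s n t \<partial>lborel) < \<infinity>"
proof -
  let ?P = "sample s {..<n}"
  let ?h = "\<lambda>z t. indicator {0..} t * of_nat (num_components (lune_graph s {..<n} z t) - 1) :: ennreal"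
  interpret P: prob_space ?P by (intro prob_space_PiM prob_space_unit_sample)
  interpret pair: pair_sigma_finite lborel ?P by unfold_locales
  define G where "G z = lunar_cost s (\<lambda>i. {fst (z j) | j. j \<in> {..<n} \<and> snd (z j) = i})" for z :: config
  have G: "has_bochner_integral lborel (\<lambda>t. indicator {0..} t * real (num_components (lune_graph s
      {..<n} z t) - 1)) (G z)" for z
    unfolding G_def by (rule lunar_cost_integral) auto
  have G0: "0 \<le> G z" for z
    unfolding G_def by (rule lunar_cost_nonneg[OF _ finite_lessThan]) auto
  have Gn: "ennreal (G z) = (\<integral>\<^sup>+t. ?h z t \<partial>lborel)" for z
  proof -
    have "ennreal (G z) = ennreal (\<integral>t. indicator {0..} t * real (num_components (lune_graph s {..<n}
        z t) - 1) \<partial>lborel)"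
      using G[of z] by (simp only: has_bochner_integral_integral_eq)
    also have "\<dots> = (\<integral>\<^sup>+t. ennreal (indicator {0..} t * real (num_components (lune_graph s {..<n} z
        t) - 1)) \<partial>lborel)"
      using G[of z] by (intro nn_integral_eq_integral[symmetric]) (auto simp: has_bochner_integral_iff)
    also have "\<dots> = (\<integral>\<^sup>+t. ?h z t \<partial>lborel)"
      by (intro nn_integral_cong) (auto simp: indicator_def ennreal_of_nat_eq_real_of_nat)
    finally show ?thesis .
  qed
  have hm: "(\<lambda>(t, z). ?h z t) \<in> borel_measurable (lborel \<Otimes>\<^sub>M ?P)"
  proof -
    have sets: "sets (lborel \<Otimes>\<^sub>M ?P) = sets (borel \<Otimes>\<^sub>M config_space {..<n})"
      by (intro sets_pair_measure_cong sets_PiM_marked) simp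
    have "(\<lambda>w. of_nat (num_components (lune_graph s {..<n} (snd w) (fst w)) - 1) :: ennreal) \<in>
        borel_measurable (lborel \<Otimes>\<^sub>M ?P)"
      by (subst measurable_cong_sets[OF sets refl], rule measurable_lune_graph) simp
    then show ?thesis unfolding split_beta' by measurable
  qed
  have "(\<lambda>z. \<integral>\<^sup>+t. ?h z t \<partial>lborel) \<in> borel_measurable ?P"
    by (rule lborel.borel_measurable_nn_integral) (use measurable_compose[OF measurable_pair_swap'
        hm] in \<open>simp add: split_beta'\<close>)
  then have "(\<lambda>z. enn2real (ennreal (G z))) \<in> borel_measurable ?P"
    unfolding Gn by measurable
  then have Gm: "G \<in> borel_measurable ?P" using G0 by simp
  have "expected_lunar_cost s n = (\<integral>\<omega>. G (\<lambda>j\<in>{..<n}. (fst \<omega> j, snd \<omega> j)) \<partial>colored_sample s n)"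
  proof -
    have "color_class n (fst \<omega>) (snd \<omega>) = (\<lambda>i. {fst ((\<lambda>j\<in>{..<n}. (fst \<omega> j, snd \<omega> j)) j) | j.
       j \<in> {..<n} \<and> snd ((\<lambda>j\<in>{..<n}. (fst \<omega> j, snd \<omega> j)) j) = i})" for \<omega> :: "(nat \<Rightarrow> real^2) \<times> (nat \<Rightarrow>
           nat)"
    proof
      fix i
      show "color_class n (fst \<omega>) (snd \<omega>) i = {fst ((\<lambda>j\<in>{..<n}. (fst \<omega> j, snd \<omega> j)) j) | j.
         j \<in> {..<n} \<and> snd ((\<lambda>j\<in>{..<n}. (fst \<omega> j, snd \<omega> j)) j) = i}"
        unfolding color_class_def by (intro Collect_cong ex_cong1) auto
    qed
    then show ?thesis unfolding expected_lunar_cost_def G_def by (simp only:)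
  qed
  also have "\<dots> = (\<integral>z. G z \<partial>distr (colored_sample s n) ?P (\<lambda>\<omega>. \<lambda>j\<in>{..<n}. (fst \<omega> j, snd \<omega> j)))"
    by (rule integral_distr[OF measurable_mark Gm, symmetric])
  also have "\<dots> = (\<integral>z. G z \<partial>?P)" by (simp only: distr_colored_sample)
  finally have E: "expected_lunar_cost s n = (\<integral>z. G z \<partial>?P)" .
  have tot: "(\<integral>\<^sup>+z. ennreal (G z) \<partial>?P) = (\<integral>\<^sup>+t. indicator {0..} t * expected_merges s n t \<partial>lborel)"
  proof -
    have "(\<integral>\<^sup>+z. ennreal (G z) \<partial>?P) = (\<integral>\<^sup>+z. (\<integral>\<^sup>+t. ?h z t \<partial>lborel) \<partial>?P)" by (simp only: Gn)
    also have "\<dots> = (\<integral>\<^sup>+t. (\<integral>\<^sup>+z. ?h z t \<partial>?P) \<partial>lborel)"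
      by (rule pair.Fubini'[OF hm])
    also have "\<dots> = (\<integral>\<^sup>+t. indicator {0..} t * expected_merges s n t \<partial>lborel)"
      unfolding expected_merges_def
      by (intro nn_integral_cong nn_integral_cmult measurable_num_components)
    finally show ?thesis .
  qed
  have "integrable ?P G"
    using Gm G0 tot fin by (intro integrableI_bounded) auto
  then have "(\<integral>\<^sup>+z. ennreal (G z) \<partial>?P) = ennreal (\<integral>z. G z \<partial>?P)"
    using G0 by (intro nn_integral_eq_integral) auto
  then show ?thesis using tot E by simp
qed

theorem theorem4p1:
  fixes s :: nat
  shows "\<exists>c :: real. (\<lambda>n. expected_lunar_cost s n / sqrt (real n)) \<longlonglongrightarrow> c"
proof -
  obtain C where C0: "0 \<le> C" and C: "\<And>n \<rho>. 0 < n \<Longrightarrow> 0 < \<rho> \<Longrightarrow>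
      expected_merges s n (\<rho> / sqrt (real n)) \<le> ennreal (real n * (C / (1 + \<rho>\<^sup>2)))"
    using expected_num_components_dominated[of s] unfolding expected_merges_def by blast
  \<comment> \<open>The integrand in \<rho> = t sqrt n, per sample point, with n = Suc N. The
    half-line is open because the bound and the limit are available only for \<rho> > 0.\<close>
  define y where "y N \<rho> = indicator {0<..} \<rho> * (enn2real (expected_merges s (Suc N) (\<rho> / sqrt (real
      (Suc N)))) / real (Suc N))"
    for N and \<rho> :: real
  define w where "w \<rho> = C * inverse (1 + \<rho>\<^sup>2)" for \<rho> :: real
  have em: "expected_merges s n \<in> borel_measurable borel" for n
  proof -
    interpret P: prob_space "sample s {..<n}" by (intro prob_space_PiM prob_space_unit_sample)
    have sets: "sets (borel \<Otimes>\<^sub>M (sample s {..<n})) = sets (borel \<Otimes>\<^sub>M config_space {..<n})"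
      by (intro sets_pair_measure_cong sets_PiM_marked) simp
    have "(\<lambda>w. of_nat (num_components (lune_graph s {..<n} (snd w) (fst w)) - 1) :: ennreal) \<in>
        borel_measurable (borel \<Otimes>\<^sub>M (sample s {..<n}))"
      by (subst measurable_cong_sets[OF sets refl], rule measurable_lune_graph) simp
    then show ?thesis
      unfolding expected_merges_def
      by (intro P.borel_measurable_nn_integral) (simp add: split_beta')
  qed
  have ym: "y N \<in> borel_measurable lborel" for N
  proof -
    have "(\<lambda>\<rho>. expected_merges s (Suc N) (\<rho> / sqrt (real (Suc N)))) \<in> borel_measurable borel"
      by (rule measurable_compose[OF _ em]) simp
    then have "y N \<in> borel_measurable borel" unfolding y_def by measurable
    then show ?thesis by simp
  qed
  have y0: "0 \<le> y N \<rho>" for N \<rho> by (simp add: y_def)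
  have fin: "expected_merges s (Suc N) (\<rho> / sqrt (real (Suc N))) = ennreal (y N \<rho> * real (Suc N))"
    and yw: "y N \<rho> \<le> w \<rho>" if "0 < \<rho>" for N \<rho>
  proof -
    let ?E = "expected_merges s (Suc N) (\<rho> / sqrt (real (Suc N)))"
    have le: "?E \<le> ennreal (real (Suc N) * (C / (1 + \<rho>\<^sup>2)))" using C[of "Suc N" \<rho>] that by simp
    then have lt: "?E < \<infinity>" by (rule order.strict_trans1) simp
    have y: "y N \<rho> * real (Suc N) = enn2real ?E" using that by (simp add: y_def del: of_nat_Suc)
    show e: "?E = ennreal (y N \<rho> * real (Suc N))"
      unfolding y using lt by simp
    have "0 \<le> real (Suc N) * (C / (1 + \<rho>\<^sup>2))" using C0 by (intro mult_nonneg_nonneg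
        divide_nonneg_nonneg) auto
    then have "y N \<rho> * real (Suc N) \<le> real (Suc N) * (C / (1 + \<rho>\<^sup>2))"
      using le unfolding e by (simp only: ennreal_le_iff)
    then have "real (Suc N) * y N \<rho> \<le> real (Suc N) * (C / (1 + \<rho>\<^sup>2))" by (simp only: mult.commute)
    then have "y N \<rho> \<le> C / (1 + \<rho>\<^sup>2)" by (rule mult_left_le_imp_le) simp
    then show "y N \<rho> \<le> w \<rho>" by (simp add: w_def divide_inverse)
  qed
  have w0: "0 \<le> w \<rho>" for \<rho> using C0 by (simp add: w_def)
  have wint: "integrable lborel w"
    using integrable_inverse_1_plus_square unfolding w_def by (simp add: set_integrable_def)
  have bound: "norm (y N \<rho>) \<le> w \<rho>" for N \<rho>
    using yw[of \<rho> N] y0[of N \<rho>] w0[of \<rho>] by (cases "0 < \<rho>") (auto simp: y_def)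
  have "\<exists>L. (\<lambda>N. y N \<rho>) \<longlonglongrightarrow> L" for \<rho>
  proof (cases "0 < \<rho>")
    case True
    then show ?thesis using expected_merges_convergent[OF True, of s] by (simp add: y_def convergent_def)
  next
    case False
    then show ?thesis by (auto simp: y_def intro!: exI[of _ 0])
  qed
  then obtain f where f: "\<And>\<rho>. (\<lambda>N. y N \<rho>) \<longlonglongrightarrow> f \<rho>" by metis
  have fm: "f \<in> borel_measurable lborel"
    by (rule borel_measurable_LIMSEQ_real[OF f ym])
  have conv: "(\<lambda>N. \<integral>\<rho>. y N \<rho> \<partial>lborel) \<longlonglongrightarrow> (\<integral>\<rho>. f \<rho> \<partial>lborel)"
    by (rule integral_dominated_convergence[OF fm ym wint]) (use f bound in auto)
  have yint: "integrable lborel (y N)" for N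
    by (rule Bochner_Integration.integrable_bound[OF wint ym]) (use bound in \<open>auto intro:
        order_trans[OF _ abs_ge_self]\<close>)
  \<comment> \<open>The substitution contributes 1 / sqrt n and the normalization of
    \<open>y\<close> a factor n; together they give sqrt n, so the quotient in the theorem equals
    the integral of \<open>y N\<close> with no error term.\<close>
  have eq: "expected_lunar_cost s (Suc N) / sqrt (real (Suc N)) = (\<integral>\<rho>. y N \<rho> \<partial>lborel)" for N
  proof -
    define q where "q = sqrt (real (Suc N))"
    have q: "0 < q" "q * q = real (Suc N)" by (simp_all add: q_def)
    have "(\<integral>\<^sup>+t. indicator {0..} t * expected_merges s (Suc N) t \<partial>lborel) =
      ennreal \<bar>1 / q\<bar> * (\<integral>\<^sup>+\<rho>. indicator {0..} (0 + 1 / q * \<rho>) * expected_merges s (Suc N) (0 + 1 /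
          q * \<rho>) \<partial>lborel)"
      using em[of "Suc N"] q by (intro nn_integral_real_affine) auto
    also have "(\<integral>\<^sup>+\<rho>. indicator {0..} (0 + 1 / q * \<rho>) * expected_merges s (Suc N) (0 + 1 / q * \<rho>)
        \<partial>lborel) =
      (\<integral>\<^sup>+\<rho>. ennreal (real (Suc N)) * ennreal (y N \<rho>) \<partial>lborel)"
    proof (rule nn_integral_cong_AE)
      \<comment> \<open>At \<rho> = 0 the closed and the open half-line differ, so the integrands
        agree only almost everywhere.\<close>
      have "AE \<rho> in lborel. \<rho> \<noteq> (0::real)" by (rule AE_lborel_singleton)
      then show "AE \<rho> in lborel. indicator {0..} (0 + 1 / q * \<rho>) * expected_merges s (Suc N) (0 + 1
          / q * \<rho>) =
        ennreal (real (Suc N)) * ennreal (y N \<rho>)"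
      proof eventually_elim
        case (elim \<rho>)
        show ?case
        proof (cases "0 < \<rho>")
          case True
          have "expected_merges s (Suc N) (0 + 1 / q * \<rho>) = ennreal (y N \<rho> * real (Suc N))"
            using fin[OF True, of N] by (simp add: q_def)
          moreover have "(0 + 1 / q * \<rho>) \<in> {0..}" using True q by simp
          ultimately show ?thesis using y0[of N \<rho>] by (simp add: ennreal_mult mult.commute del:
              of_nat_Suc)
        next
          case False
          then have "\<not> 0 \<le> 1 / q * \<rho>" using q elim by (simp add: zero_le_divide_iff)
          then show ?thesis using False by (simp add: y_def)
        qed
      qed
    qed
    also have "\<dots> = ennreal (real (Suc N)) * (\<integral>\<^sup>+\<rho>. ennreal (y N \<rho>) \<partial>lborel)"
      by (intro nn_integral_cmult measurable_compose[OF ym measurable_ennreal])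
    also have "(\<integral>\<^sup>+\<rho>. ennreal (y N \<rho>) \<partial>lborel) = ennreal (\<integral>\<rho>. y N \<rho> \<partial>lborel)"
      using yint y0 by (intro nn_integral_eq_integral) auto
    also have "ennreal \<bar>1 / q\<bar> * (ennreal (real (Suc N)) * ennreal (\<integral>\<rho>. y N \<rho> \<partial>lborel)) = ennreal (q
        * (\<integral>\<rho>. y N \<rho> \<partial>lborel))"
    proof -
      have "0 \<le> (\<integral>\<rho>. y N \<rho> \<partial>lborel)" using y0 by simp
      then have "ennreal \<bar>1 / q\<bar> * (ennreal (real (Suc N)) * ennreal (\<integral>\<rho>. y N \<rho> \<partial>lborel)) =
        ennreal (\<bar>1 / q\<bar> * (real (Suc N) * (\<integral>\<rho>. y N \<rho> \<partial>lborel)))"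
        by (simp only: ennreal_mult abs_ge_zero of_nat_0_le_iff mult_nonneg_nonneg)
      also have "\<bar>1 / q\<bar> * (real (Suc N) * (\<integral>\<rho>. y N \<rho> \<partial>lborel)) = q * (\<integral>\<rho>. y N \<rho> \<partial>lborel)"
        using q(1) unfolding q(2)[symmetric] by simp
      finally show ?thesis .
    qed
    finally have tot: "(\<integral>\<^sup>+t. indicator {0..} t * expected_merges s (Suc N) t \<partial>lborel) = ennreal (q
        * (\<integral>\<rho>. y N \<rho> \<partial>lborel))" .
    have "ennreal (expected_lunar_cost s (Suc N)) = ennreal (q * (\<integral>\<rho>. y N \<rho> \<partial>lborel))"
      using expected_lunar_cost_eq[of s "Suc N"] unfolding tot by simp
    \<comment> \<open>Since \<open>ennreal\<close> sends negative numbers to 0, equality of the real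
      values needs both sides to be nonnegative.\<close>
    moreover have "0 \<le> expected_lunar_cost s (Suc N)"
    proof -
      have "0 \<le> lunar_cost s (color_class (Suc N) X \<kappa>)" for X \<kappa>
        by (rule lunar_cost_nonneg[of _ "\<lambda>j. (X j, \<kappa> j)" "{..<Suc N}"]) (auto simp: color_class_def)
      then show ?thesis unfolding expected_lunar_cost_def by (intro Bochner_Integration.integral_nonneg)
    qed
    moreover have "0 \<le> q * (\<integral>\<rho>. y N \<rho> \<partial>lborel)" using q y0 by simp
    ultimately have "expected_lunar_cost s (Suc N) = q * (\<integral>\<rho>. y N \<rho> \<partial>lborel)"
      by (simp add: ennreal_inj)
    then show ?thesis using q(1) unfolding q_def[symmetric] by simp
  qed
  have "(\<lambda>N. expected_lunar_cost s (Suc N) / sqrt (real (Suc N))) \<longlonglongrightarrow> (\<integral>\<rho>. f \<rho> \<partial>lborel)"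
    unfolding eq by (rule conv)
  then show ?thesis by (intro exI) (rule LIMSEQ_imp_Suc)
qed

end
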